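(* Let $C_1,D_1\subset\mathbb{R}^{n_1}$ and $C_2,D_2\subset\mathbb{R}^{n_2}$ be closed, and consider the hybrid system $\mathcal{H}:=(C_1\times C_2,F,D_1\times D_2,G)$ on $\mathbb{R}^{n_1}\times\mathbb{R}^{n_2}$, satisfying the Basic Assumptions, whose set-valued maps have the upper triangular structure $$F(x^1,x^2)=\begin{bmatrix} F_1(x^1,x^2) \\ F_2(x^2) \end{bmatrix},\qquad G(x^1,x^2)=\begin{bmatrix} G_1(x^1,x^2) \\ G_2(x^2) \end{bmatrix},\qquad (x^1,x^2)\in\mathbb{R}^{n_1}\times\mathbb{R}^{n_2}.$$ Define $\hat F_1(x^1):=F_1(x^1,0)$, $\hat G_1(x^1):=G_1(x^1,0)$, and consider the hybrid subsystems $\mathcal{H}_1:=(C_1,\hat F_1,D_1,\hat G_1)$ on $\mathbb{R}^{n_1}$ and $\mathcal{H}_2:=(C_2,F_2,D_2,G_2)$ on $\mathbb{R}^{n_2}$, both satisfying the Basic Assumptions. Let $\hat\Gamma_1\subset\mathbb{R}^{n_1}$ be a compact set and let $$\Gamma_1=\{(x^1,x^2)\in\mathbb{R}^{n_1}\times\mathbb{R}^{n_2}:x^1\in\hat\Gamma_1,\ x^2=0\}.$$ Suppose that $0\in C_2\cup D_2$. Then the following holds: (i) $\Gamma_1$ is asymptotically stable for $\mathcal{H}$ if $\hat\Gamma_1$ is asymptotically stable for $\mathcal{H}_1$ and $0\in\mathbb{R}^{n_2}$ is asymptotically stable for $\mathcal{H}_2$. (ii) $\Gamma_1$ is globally asymptotically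 stable for $\mathcal{H}$ if $\hat\Gamma_1$ is globally asymptotically stable for $\mathcal{H}_1$, $0\in\mathbb{R}^{n_2}$ is globally asymptotically stable for $\mathcal{H}_2$, and all solutions of $\mathcal{H}$ are bounded.
   Context: Notation: $|x|_\Gamma=\inf_{y\in\Gamma}|x-y|$ and, for $c>0$, $B_c(\Gamma)=\{x\in\mathbb{R}^n:|x|_\Gamma<c\}$. The column notation for set-valued maps means the Cartesian product of the component sets, e.g. $F(x^1,x^2)=F_1(x^1,x^2)\times F_2(x^2)$. Hybrid system on $\mathbb{R}^n$: a 4-tuple $\mathcal{H}=(C,F,D,G)$ satisfying the Basic Assumptions: (A1) $C,D$ are closed subsets of $\mathbb{R}^n$; (A2) $F:\mathbb{R}^n\rightrightarrows\mathbb{R}^n$ is a set-valued map that is outer semicontinuous, locally bounded on $C$, with $F(x)$ nonempty and convex for each $x\in C$; (A3) $G:\mathbb{R}^n\rightrightarrows\mathbb{R}^n$ is outer semicontinuous, locally bounded on $D$, with $G(x)$ nonempty for each $x\in D$. Solutions: a hybrid time domain is a subset of $\mathbb{R}_{\ge0}\times\mathbb{N}$ that is a union of infinitely many sets $[t_j,t_{j+1}]\times\{j\}$, $j\in\mathbb{N}$, or of finitely many such sets with the last one of the form $[t_j,t_{j+1}]\times\{j\}$, $[t_j,t_{j+1})\times\{j\}$ or $[t_j,\infty)\times\{j\}$, where $0=t_0\le t_1\le\cdots$. A hybrid arc is a function $x:\mathrm{dom}(x)\to\mathbb{R}^n$ on a hybrid time domain such that for each $j$ the map $t\mapsto x(t,j)$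 is locally absolutely continuous on $I_j=\{t:(t,j)\in\mathrm{dom}(x)\}$. A solution of $\mathcal{H}$ is a hybrid arc such that: for each $j$ for which $I_j$ has nonempty interior, $\dot x(t,j)\in F(x(t,j))$ for almost all $t\in I_j$ and $x(t,j)\in C$ for all $t\in[\min I_j,\sup I_j)$; and whenever $(t,j),(t,j+1)\in\mathrm{dom}(x)$, $x(t,j)\in D$ and $x(t,j+1)\in G(x(t,j))$. (From a point outside $C\cup D$ the only solution is the trivial one with domain $\{(0,0)\}$.) All solutions considered are maximal (cannot be extended). A solution is complete if its domain is unbounded, and bounded if its range is bounded. $\mathcal{S}_{\mathcal{H}}(x_0)$ is the set of maximal solutions with $x(0,0)=x_0$, $\mathcal{S}_{\mathcal{H}}(U)=\bigcup_{x_0\in U}\mathcal{S}_{\mathcal{H}}(x_0)$, and $\mathrm{rge}(\mathcal{S}_{\mathcal{H}}(U))$ is the union of the ranges of the solutions in $\mathcal{S}_{\mathcal{H}}(U)$. Stability notions for a compact set $\Gamma$: $\Gamma$ is stable for $\mathcal{H}$ if for every $\varepsilon>0$ there is $\delta>0$ with $\mathrm{rge}(\mathcal{S}_{\mathcal{H}}(B_\delta(\Gamma)))\subset B_\varepsilon(\Gamma)$. The basin of attraction of $\Gamma$ is the set of points $p\in\mathbb{R}^n$ such that each $x\in\mathcal{S}_{\mathcal{H}}(p)$ is bounded and, if $x$ is complete, $|x(t,j)|_\Gamma\to0$ as $t+j\to\infty$, $(t,j)\in\mathrm{dom}(x)$. $\Gamma$ is attractive if its basin of attraction contains $\Gamma$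 in its interior; globally attractive if its basin of attraction is $\mathbb{R}^n$; (globally) asymptotically stable if stable and (globally) attractive. A point $0$ has a property if the set $\{0\}$ does. *)

theory Defs
  imports "HOL-Analysis.Analysis"
begin

section \<open>Hybrid systems and the Basic Assumptions\<close>

text \<open>Set-valued maps are functions into \<open>'a set\<close>; they may take the value \<open>{}\<close>.\<close>

record 'a hybrid_system =
  flow_set :: "'a set"
  flow_map :: "'a \<Rightarrow> 'a set"
  jump_set :: "'a set"
  jump_map :: "'a \<Rightarrow> 'a set"

definition outer_semicontinuous ::
  "('a::metric_space \<Rightarrow> 'b::metric_space set) \<Rightarrow> bool" where
  "outer_semicontinuous M \<longleftrightarrow>
     (\<forall>X Y x y. X \<longlonglongrightarrow> x \<longrightarrow> Y \<longlonglongrightarrow> y \<longrightarrow> (\<forall>i::nat. Y i \<in> M (X i)) \<longrightarrow> y \<in> M x)"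

text \<open>Local boundedness on \<open>S\<close> is taken relative to \<open>S\<close>: the values of \<open>M\<close> off \<open>S\<close>
  are not constrained.\<close>

definition locally_bounded_on ::
  "'a::metric_space set \<Rightarrow> ('a \<Rightarrow> 'b::metric_space set) \<Rightarrow> bool" where
  "locally_bounded_on S M \<longleftrightarrow>
     (\<forall>x\<in>S. \<exists>r>0. bounded (\<Union>y\<in>ball x r \<inter> S. M y))"

definition basic_assumptions :: "'a::euclidean_space hybrid_system \<Rightarrow> bool" where
  "basic_assumptions H \<longleftrightarrow>
     closed (flow_set H) \<and> closed (jump_set H) \<and>
     outer_semicontinuous (flow_map H) \<and> locally_bounded_on (flow_set H) (flow_map H) \<and>
     (\<forall>x\<in>flow_set H. flow_map H x \<noteq> {} \<and> convex (flow_map H x)) \<and>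
     outer_semicontinuous (jump_map H) \<and> locally_bounded_on (jump_set H) (jump_map H) \<and>
     (\<forall>x\<in>jump_set H. jump_map H x \<noteq> {})"

section \<open>Hybrid time domains and hybrid arcs\<close>

text \<open>In the finite case the last piece has index \<open>J\<close>. A half-open last piece is required to be
  nonempty: an empty one with \<open>J > 0\<close> gives no new domain, and with \<open>J = 0\<close> it would give the
  empty domain, which does not contain the initial time \<open>(0, 0)\<close>.\<close>

definition hybrid_time_domain :: "(real \<times> nat) set \<Rightarrow> bool" where
  "hybrid_time_domain E \<longleftrightarrow>
     (\<exists>t::nat \<Rightarrow> real. t 0 = 0 \<and> incseq t \<and>
        (E = (\<Union>j. {t j..t (Suc j)} \<times> {j}) \<or>
         (\<exists>J L. (L = {t J..t (Suc J)} \<or> (t J < t (Suc J) \<and> L = {t J..<t (Suc J)}) \<or> L = {t J..}) \<and>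
                E = (\<Union>j<J. {t j..t (Suc j)} \<times> {j}) \<union> L \<times> {J})))"

text \<open>A hybrid arc is a partial function of hybrid time, so that its domain, its range and the
  extension order are \<open>dom\<close>, \<open>ran\<close> and \<open>\<subseteq>\<^sub>m\<close>.\<close>

type_synonym 'a arc = "real \<times> nat \<rightharpoonup> 'a"

definition time_slice :: "'a arc \<Rightarrow> nat \<Rightarrow> real set" where
  "time_slice x j = {t. (t, j) \<in> dom x}"

definition absolutely_continuous_on_interval ::
  "real \<Rightarrow> real \<Rightarrow> (real \<Rightarrow> 'a::real_normed_vector) \<Rightarrow> bool" where
  "absolutely_continuous_on_interval a b f \<longleftrightarrow>
     (\<forall>\<epsilon>>0. \<exists>\<delta>>0. \<forall>(m::nat) u v.
        (\<forall>i<m. a \<le> u i \<and> u i \<le> v i \<and> v i \<le> b) \<longrightarrow>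
        disjoint_family_on (\<lambda>i. {u i<..<v i}) {..<m} \<longrightarrow>
        (\<Sum>i<m. v i - u i) < \<delta> \<longrightarrow>
        (\<Sum>i<m. norm (f (v i) - f (u i))) < \<epsilon>)"

definition locally_absolutely_continuous_on ::
  "real set \<Rightarrow> (real \<Rightarrow> 'a::real_normed_vector) \<Rightarrow> bool" where
  "locally_absolutely_continuous_on I f \<longleftrightarrow>
     (\<forall>a b. {a..b} \<subseteq> I \<longrightarrow> absolutely_continuous_on_interval a b f)"

definition hybrid_arc :: "'a::euclidean_space arc \<Rightarrow> bool" where
  "hybrid_arc x \<longleftrightarrow>
     hybrid_time_domain (dom x) \<and>
     (\<forall>j. locally_absolutely_continuous_on (time_slice x j) (\<lambda>t. the (x (t, j))))"

section \<open>Solutions\<close>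

text \<open>Since each \<open>I = time_slice x j\<close> is an interval, the condition
  \<open>t \<in> I \<and> (\<exists>s\<in>I. t < s)\<close> says \<open>t \<in> [min I, sup I)\<close>, also when \<open>I\<close> is unbounded.\<close>

definition solution :: "'a::euclidean_space hybrid_system \<Rightarrow> 'a arc \<Rightarrow> bool" where
  "solution H x \<longleftrightarrow>
     hybrid_arc x \<and>
     (\<forall>j. interior (time_slice x j) \<noteq> {} \<longrightarrow>
        (AE t in lebesgue. t \<in> time_slice x j \<longrightarrow>
           (\<exists>v\<in>flow_map H (the (x (t, j))).
              ((\<lambda>s. the (x (s, j))) has_vector_derivative v) (at t within time_slice x j))) \<and>
        (\<forall>t\<in>time_slice x j. (\<exists>s\<in>time_slice x j. t < s) \<longrightarrow> the (x (t, j)) \<in> flow_set H)) \<and>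
     (\<forall>t j. (t, j) \<in> dom x \<longrightarrow> (t, Suc j) \<in> dom x \<longrightarrow>
        the (x (t, j)) \<in> jump_set H \<and> the (x (t, Suc j)) \<in> jump_map H (the (x (t, j))))"

definition maximal_solution :: "'a::euclidean_space hybrid_system \<Rightarrow> 'a arc \<Rightarrow> bool" where
  "maximal_solution H x \<longleftrightarrow>
     solution H x \<and> (\<forall>y. solution H y \<longrightarrow> x \<subseteq>\<^sub>m y \<longrightarrow> y = x)"

definition solutions_from :: "'a::euclidean_space hybrid_system \<Rightarrow> 'a set \<Rightarrow> 'a arc set" where
  "solutions_from H U = {x. maximal_solution H x \<and> (\<exists>p\<in>U. x (0, 0) = Some p)}"

definition rge :: "'a arc set \<Rightarrow> 'a set" where
  "rge X = (\<Union>x\<in>X. ran x)"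

text \<open>The domain is embedded in the plane because \<open>nat\<close> carries no metric in the library.\<close>

definition complete_arc :: "'a arc \<Rightarrow> bool" where
  "complete_arc x \<longleftrightarrow> \<not> bounded ((\<lambda>(t, j). (t, real j)) ` dom x)"

definition bounded_arc :: "'a::euclidean_space arc \<Rightarrow> bool" where
  "bounded_arc x \<longleftrightarrow> bounded (ran x)"

section \<open>Stability of a set\<close>

text \<open>For nonempty \<open>\<Gamma>\<close> the distance \<open>infdist x \<Gamma>\<close> is the infimum of \<open>dist x y\<close> over
  \<open>y \<in> \<Gamma>\<close>; \<open>infdist x {} = 0\<close> by library convention.\<close>

definition set_nbhd :: "real \<Rightarrow> 'a::metric_space set \<Rightarrow> 'a set" where
  "set_nbhd c \<Gamma> = {x. infdist x \<Gamma> < c}"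

definition stable :: "'a::euclidean_space hybrid_system \<Rightarrow> 'a set \<Rightarrow> bool" where
  "stable H \<Gamma> \<longleftrightarrow>
     (\<forall>\<epsilon>>0. \<exists>\<delta>>0. rge (solutions_from H (set_nbhd \<delta> \<Gamma>)) \<subseteq> set_nbhd \<epsilon> \<Gamma>)"

text \<open>The filter below expresses \<open>t + j \<longrightarrow> \<infinity>\<close> along \<open>(t, j) \<in> dom x\<close>.\<close>

definition converges_to_set :: "'a::euclidean_space arc \<Rightarrow> 'a set \<Rightarrow> bool" where
  "converges_to_set x \<Gamma> \<longleftrightarrow>
     ((\<lambda>p. infdist (the (x p)) \<Gamma>) \<longlongrightarrow> 0)
       (inf (filtercomap (\<lambda>(t, j). t + real j) at_top) (principal (dom x)))"

definition basin_of_attraction :: "'a::euclidean_space hybrid_system \<Rightarrow> 'a set \<Rightarrow> 'a set" where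
  "basin_of_attraction H \<Gamma> =
     {p. \<forall>x\<in>solutions_from H {p}. bounded_arc x \<and> (complete_arc x \<longrightarrow> converges_to_set x \<Gamma>)}"

definition attractive :: "'a::euclidean_space hybrid_system \<Rightarrow> 'a set \<Rightarrow> bool" where
  "attractive H \<Gamma> \<longleftrightarrow> \<Gamma> \<subseteq> interior (basin_of_attraction H \<Gamma>)"

definition globally_attractive :: "'a::euclidean_space hybrid_system \<Rightarrow> 'a set \<Rightarrow> bool" where
  "globally_attractive H \<Gamma> \<longleftrightarrow> basin_of_attraction H \<Gamma> = UNIV"

definition asymptotically_stable :: "'a::euclidean_space hybrid_system \<Rightarrow> 'a set \<Rightarrow> bool" where
  "asymptotically_stable H \<Gamma> \<longleftrightarrow> stable H \<Gamma> \<and> attractive H \<Gamma>"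

definition globally_asymptotically_stable ::
  "'a::euclidean_space hybrid_system \<Rightarrow> 'a set \<Rightarrow> bool" where
  "globally_asymptotically_stable H \<Gamma> \<longleftrightarrow> stable H \<Gamma> \<and> globally_attractive H \<Gamma>"

end

theory Submission
  imports Defs "HOL-Complex_Analysis.Great_Picard"
begin

text \<open>
  The second component of a solution of the cascade solves \<open>H2\<close> and so stays small, and it tends
  to \<open>0\<close> on complete solutions.  Solutions with values in a compact set are sequentially compact:
  jump times converge in the extended reals, the flow pieces are equi-Lipschitz, and a limit of
  flow pieces satisfies the differential inclusion at every point of differentiability because
  the flow map is upper semicontinuous with convex values.  Hence limits of solutions whose second
  component shrinks to \<open>0\<close> are solutions of \<open>H1\<close>, and a failure of stability or attractivity
  for the cascade would produce a solution of \<open>H1\<close> that contradicts the same property of \<open>H1\<close>.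
\<close>


section \<open>Differentiability of Lipschitz curves\<close>

text \<open>The maps are only outer semicontinuous, so no estimate compares the first component of a
  cascade solution with solutions of \<open>H1\<close>; what survives is closedness of the set of
  solutions, and every contradiction is reached in the limit. Limits need compactness, hence windows
  of hybrid time on which the arcs stay in one bounded set. Two gaps have to be bridged. The
  stability notions quantify over maximal solutions, while projections, tails and limits are mere
  solutions; extending these by Zorn's lemma closes the first gap. And a limit of flow pieces
  inherits a Lipschitz bound but no derivative: differentiability almost everywhere comes from
  Lebesgue's theorem for Lipschitz curves, and the inclusion is transported through increments,
  \<open>p \<bullet> (f t - f s) \<le> c * (t - s)\<close> for half-spaces containing the
  velocities, since increments pass to pointwise limits and derivatives do not.\<close>

lemma Vitali_measure_compare:
  fixes S W :: "real set" and \<alpha> \<beta> :: "real measure"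
  assumes sets: "sets \<alpha> = sets borel" "sets \<beta> = sets borel"
    and small: "\<And>x d. x \<in> S \<Longrightarrow> 0 < d \<Longrightarrow>
      \<exists>u v. u < x \<and> x < v \<and> v - u < d \<and> emeasure \<alpha> {u<..<v} \<le> emeasure \<beta> {u<..<v}"
    and W: "open W" "S \<subseteq> W"
  obtains U where "open U" "U \<subseteq> W" "negligible (S - U)" "emeasure \<alpha> U \<le> emeasure \<beta> U"
proof -
  \<comment> \<open>Good intervals are coded by midpoint and half length, in the form that the
    covering theorem for balls takes. Countable additivity over the disjoint selected balls then
    transfers the inequality from the pieces to their union.\<close>
  define K where "K = {(c, r). ball c r \<subseteq> W \<and> emeasure \<alpha> (ball c r) \<le> emeasure \<beta> (ball c r)}"
  have *: "\<exists>i. i \<in> K \<and> x \<in> ball (fst i) (snd i) \<and> snd i < d" if x: "x \<in> S" and d: "0 < d" for x d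
  proof -
    obtain e where e: "e > 0" "ball x e \<subseteq> W"
      using W x openE by blast
    obtain u v where uv: "u < x" "x < v" "v - u < min d e" "emeasure \<alpha> {u<..<v} \<le> emeasure \<beta> {u<..<v}"
      using small[OF x, of "min d e"] d e by auto
    have b: "ball ((u+v)/2) ((v-u)/2) = {u<..<v}"
      by (simp add: ball_eq_greaterThanLessThan field_simps)
    have "{u<..<v} \<subseteq> ball x e"
      using uv by (auto simp: dist_real_def abs_if)
    then have "((u+v)/2, (v-u)/2) \<in> K"
      using e uv by (auto simp: K_def b)
    moreover have "x \<in> ball ((u+v)/2) ((v-u)/2)"
      using uv unfolding b by auto
    ultimately show ?thesis
      using uv d by (intro exI[of _ "((u+v)/2, (v-u)/2)"]) auto
  qed
  obtain C where C: "countable C" "C \<subseteq> K"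
     "pairwise (\<lambda>i j. disjnt (ball (fst i) (snd i)) (ball (fst j) (snd j))) C"
     "negligible(S - (\<Union>i \<in> C. ball (fst i) (snd i)))"
    by (rule Vitali_covering_theorem_balls[of S K fst snd, OF *])
  let ?B = "\<lambda>i::real\<times>real. ball (fst i) (snd i)"
  have disj: "disjoint_family_on ?B C"
    using C(3) by (auto simp: disjoint_family_on_def pairwise_def disjnt_def)
  have "emeasure \<alpha> (\<Union>(?B ` C)) = (\<integral>\<^sup>+i. emeasure \<alpha> (?B i) \<partial>count_space C)"
    by (rule emeasure_UN_countable) (auto simp: sets C disj)
  also have "\<dots> \<le> (\<integral>\<^sup>+i. emeasure \<beta> (?B i) \<partial>count_space C)"
    using C(2) by (intro nn_integral_mono) (auto simp: K_def)
  also have "\<dots> = emeasure \<beta> (\<Union>(?B ` C))"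
    by (rule emeasure_UN_countable[symmetric]) (auto simp: sets C disj)
  finally have "emeasure \<alpha> (\<Union>(?B ` C)) \<le> emeasure \<beta> (\<Union>(?B ` C))" .
  moreover have "(\<Union>(?B ` C)) \<subseteq> W"
    using C(2) unfolding K_def by fastforce
  ultimately show thesis
    using C(4) by (intro that[of "\<Union>(?B ` C)"]) auto
qed

text \<open>Slopes are taken over intervals straddling \<open>x\<close> instead of having
  \<open>x\<close> as an end point: for each \<open>n\<close> the condition then defines an open set
  of points \<open>x\<close>, so the whole set is Borel, and the intervals form Vitali
  coverings.\<close>

definition oscillating_slopes :: "(real \<Rightarrow> real) \<Rightarrow> real \<Rightarrow> real \<Rightarrow> real set" where
  "oscillating_slopes f p q =
    {x. (\<forall>n. \<exists>u v. u < x \<and> x < v \<and> v - u < inverse (real (Suc n)) \<and> f v - f u < p * (v - u)) \<and>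
        (\<forall>n. \<exists>u v. u < x \<and> x < v \<and> v - u < inverse (real (Suc n)) \<and> q * (v - u) < f v - f u)}"

text \<open>With \<open>I\<close> the Stieltjes measure of \<open>f\<close>, a Vitali covering by
  flat intervals gives \<open>U\<close> with \<open>I(U) \<le> p \<lambda>(U)\<close>, and a second
  covering inside \<open>U\<close> by steep intervals gives \<open>V\<close> with
  \<open>q \<lambda>(V) \<le> I(V)\<close>. Both lose only null sets, so
  \<open>q m \<le> p (m + e)\<close> for the measure \<open>m\<close> of a bounded part of the set,
  which forces \<open>m = 0\<close>.\<close>

lemma negligible_oscillating_slopes:
  fixes f :: "real \<Rightarrow> real"
  assumes mono: "\<And>s t. s \<le> t \<Longrightarrow> f s \<le> f t" and cont: "continuous_on UNIV f"
    and pq: "0 < p" "p < q"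
  shows "negligible (oscillating_slopes f p q)" (is "negligible ?E")
proof -
  let ?I = "interval_measure f"
  have fin: "emeasure ?I {u<..<v} = ennreal (f v - f u)" if "u \<le> v" for u v
  proof -
    have Icc: "emeasure ?I {a..b} = ennreal (f b - f a)" if "a \<le> b" for a b
      using that mono cont by (rule emeasure_interval_measure_Icc)
    have "emeasure ?I {u<..<v} = emeasure ?I {u..v}"
    proof (rule emeasure_eq_AE)
      have "{u, v} \<in> null_sets ?I"
      proof -
        have "{w} \<in> null_sets ?I" for w
          using Icc[of w w] by (auto simp: null_sets_def)
        from null_sets.Un[OF this[of u] this[of v]] show ?thesis
          by (simp add: insert_commute)
      qed
      then show "AE x in ?I. (x \<in> {u<..<v}) = (x \<in> {u..v})"
        by (rule AE_I') auto
    qed auto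
    then show ?thesis
      using Icc that by simp
  qed
  have opn: "open {x. \<exists>u v. u < x \<and> x < v \<and> P u v}" for P :: "real \<Rightarrow> real \<Rightarrow> bool"
    by (intro open_Collect_ex open_Collect_conj open_Collect_less open_Collect_const continuous_intros)
  have "{x. \<forall>n::nat. \<exists>u v. u < x \<and> x < v \<and> P n u v} \<in> sets borel" for P :: "nat \<Rightarrow> real \<Rightarrow> real \<Rightarrow> bool"
    unfolding Collect_all_eq by (intro sets.countable_INT image_subsetI borel_open[OF opn]) simp
  then have E_meas: "?E \<in> sets borel"
    unfolding oscillating_slopes_def Collect_conj_eq by (intro sets.Int)
  have "negligible (?E \<inter> {-real B<..<real B})" for B
  proof -
    define S where "S = ?E \<inter> {-real B<..<real B}"
    have S: "S \<in> sets borel"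
      unfolding S_def using E_meas by auto
    have "bounded S"
      by (rule bounded_subset[OF compact_imp_bounded[OF compact_Icc[of "-real B" "real B"]]]) (auto simp: S_def)
    then have S_lm: "S \<in> lmeasurable"
      using S by (intro bounded_set_imp_lmeasurable) auto
    let ?m = "measure lebesgue S"
    have key: "q * ?m \<le> p * (?m + e)" if e: "e > 0" for e
    proof -
      obtain T where T: "open T" "S \<subseteq> T" "(T - S) \<in> lmeasurable" "emeasure lebesgue (T - S) < ennreal e"
        using sets_lebesgue_outer_open[of S e] S e by auto
      have T_le: "emeasure lborel T \<le> ennreal (?m + e)"
      proof -
        have "emeasure lborel T = emeasure lebesgue T"
          using T by simp
        also have "\<dots> = emeasure lebesgue (S \<union> (T - S))"
          using T(2) by (metis Un_Diff_cancel sup.absorb2)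
        also have "\<dots> \<le> emeasure lebesgue S + emeasure lebesgue (T - S)"
          using T S by (intro emeasure_subadditive) auto
        also have "\<dots> \<le> ennreal ?m + ennreal e"
          using T(4) S_lm by (intro add_mono) (auto simp: emeasure_eq_measure2)
        finally show ?thesis using e by simp
      qed
      obtain U where U: "open U" "U \<subseteq> T" "negligible (S - U)"
        "emeasure ?I U \<le> emeasure (scale_measure (ennreal p) lborel) U"
      proof (rule Vitali_measure_compare[where S = S and W = T])
        fix x d :: real assume "x \<in> S" "0 < d"
        moreover obtain n where "inverse (real (Suc n)) < d"
          using reals_Archimedean[OF \<open>0 < d\<close>] by blast
        ultimately obtain u v where uv: "u < x" "x < v" "v - u < d" "f v - f u < p * (v - u)"
          unfolding S_def oscillating_slopes_def by (auto dest!: spec[of _ n])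
        then have "emeasure ?I {u<..<v} \<le> emeasure (scale_measure (ennreal p) lborel) {u<..<v}"
          using pq by (simp add: fin ennreal_mult[symmetric] ennreal_leI)
        with uv show "\<exists>u v. u < x \<and> x < v \<and> v - u < d \<and>
            emeasure ?I {u<..<v} \<le> emeasure (scale_measure (ennreal p) lborel) {u<..<v}"
          by blast
      qed (use T in auto)
      obtain V where V: "open V" "V \<subseteq> U" "negligible (S \<inter> U - V)"
        "emeasure (scale_measure (ennreal q) lborel) V \<le> emeasure ?I V"
      proof (rule Vitali_measure_compare[where S = "S \<inter> U" and W = U])
        fix x d :: real assume "x \<in> S \<inter> U" "0 < d"
        moreover obtain n where "inverse (real (Suc n)) < d"
          using reals_Archimedean[OF \<open>0 < d\<close>] by blast
        ultimately obtain u v where uv: "u < x" "x < v" "v - u < d" "q * (v - u) < f v - f u"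
          unfolding S_def oscillating_slopes_def by (auto dest!: spec[of _ n])
        then have "emeasure (scale_measure (ennreal q) lborel) {u<..<v} \<le> emeasure ?I {u<..<v}"
          using pq by (simp add: fin ennreal_mult[symmetric] ennreal_leI)
        with uv show "\<exists>u v. u < x \<and> x < v \<and> v - u < d \<and>
            emeasure (scale_measure (ennreal q) lborel) {u<..<v} \<le> emeasure ?I {u<..<v}"
          by blast
      qed (use U in auto)
      have "negligible (S - V)"
        by (rule negligible_subset[OF negligible_Un[OF U(3) V(3)]]) auto
      then have "S - V \<in> null_sets lebesgue"
        by (simp add: negligible_iff_null_sets)
      then have "emeasure lebesgue S \<le> emeasure lebesgue V"
        by (intro emeasure_mono_AE) (use V S in \<open>auto intro!: AE_I'[of "S - V"]\<close>)
      then have "ennreal q * ennreal ?m \<le> ennreal q * emeasure lborel V"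
        using S_lm V by (intro mult_left_mono) (auto simp: emeasure_eq_measure2)
      also have "\<dots> \<le> emeasure ?I V"
        using V by simp
      also have "\<dots> \<le> emeasure ?I U"
        using U V by (intro emeasure_mono) auto
      also have "\<dots> \<le> ennreal p * emeasure lborel U"
        using U by simp
      also have "\<dots> \<le> ennreal p * emeasure lborel T"
        using U T by (intro mult_left_mono emeasure_mono) auto
      also have "\<dots> \<le> ennreal p * ennreal (?m + e)"
        using T_le by (intro mult_left_mono) auto
      finally have "ennreal (q * ?m) \<le> ennreal (p * (?m + e))"
        using pq e by (simp add: ennreal_mult)
      then show ?thesis
        using pq e by (subst (asm) ennreal_le_iff) auto
    qed
    have "?m \<le> 0"
    proof (rule ccontr)
      assume "\<not> ?m \<le> 0"
      then have m: "?m > 0" by simp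
      \<comment> \<open>This choice of \<open>e\<close> spends half of the gap \<open>q - p\<close>
        and leaves \<open>(q - p) * ?m \<le> 0\<close>.\<close>
      have "q * ?m \<le> p * (?m + (q - p) * ?m / (2 * p))"
        using pq m by (intro key) auto
      also have "\<dots> = p * ?m + (q - p) * ?m / 2"
        using pq by (simp add: field_simps)
      finally have "(q - p) * ?m \<le> 0" by (simp add: field_simps)
      then show False using pq m by (simp add: mult_le_0_iff)
    qed
    then have "?m = 0" by (simp add: measure_le_0_iff)
    then show ?thesis
      using S_lm unfolding S_def by (simp add: negligible_iff_measure)
  qed
  then have "negligible (\<Union>B. ?E \<inter> {-real B<..<real B})"
    by (intro negligible_countable_Union) auto
  moreover have "?E \<subseteq> (\<Union>B. ?E \<inter> {-real B<..<real B})"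
  proof
    fix x assume x: "x \<in> ?E"
    obtain B where "\<bar>x\<bar> < real B" using reals_Archimedean2 by blast
    then have "x \<in> {-real B<..<real B}" by auto
    with x show "x \<in> (\<Union>B. ?E \<inter> {-real B<..<real B})" by blast
  qed
  ultimately show ?thesis
    by (rule negligible_subset)
qed

text \<open>Off the countably many exceptional sets for rational \<open>p < q\<close>, the lower
  limit of the straddling slopes is also their upper limit, hence the derivative.\<close>

lemma lipschitz_mono_differentiable_real:
  fixes f :: "real \<Rightarrow> real"
  assumes mono: "\<And>s t. s \<le> t \<Longrightarrow> f s \<le> f t"
    and lip: "\<And>s t. s \<le> t \<Longrightarrow> f t - f s \<le> L * (t - s)"
  shows "negligible {x. \<not> f differentiable (at x)}"
proof -
  have L: "0 \<le> L"
    using mono[of 0 1] lip[of 0 1] by simp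
  have "L-lipschitz_on UNIV f"
  proof (rule lipschitz_onI)
    fix x y show "dist (f x) (f y) \<le> L * dist x y"
      using mono[of x y] mono[of y x] lip[of x y] lip[of y x] by (auto simp: dist_real_def abs_if)
  qed (rule L)
  then have cont: "continuous_on UNIV f"
    by (rule lipschitz_on_continuous_on)
  let ?E = "oscillating_slopes f"
  define R where "R = {(p, q). p \<in> \<rat> \<and> q \<in> \<rat> \<and> 0 < p \<and> p < (q::real)}"
  have "R \<subseteq> \<rat> \<times> \<rat>"
    by (auto simp: R_def)
  then have "countable R"
    using countable_rat countable_SIGMA countable_subset by metis
  then have "negligible (\<Union>(p, q)\<in>R. ?E p q)"
  proof (rule negligible_countable_Union[OF countable_image])
    fix S assume "S \<in> (\<lambda>(p, q). ?E p q) ` R"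
    then obtain p q where "0 < p" "p < q" "S = ?E p q"
      by (auto simp: R_def)
    then show "negligible S"
      using negligible_oscillating_slopes[OF mono cont] by simp
  qed
  moreover have "f differentiable (at x)" if x: "x \<notin> (\<Union>(p, q)\<in>R. ?E p q)" for x
  proof -
    \<comment> \<open>\<open>A\<close> collects the eventual lower bounds of the slopes, so its
      supremum \<open>D\<close> is their lower limit. The Lipschitz bound makes \<open>D\<close>
      finite; monotonicity makes it nonnegative, so that rationals above \<open>D\<close> are
      positive as \<open>R\<close> requires.\<close>
    define A where "A = {p. \<exists>d>0. \<forall>u v. u < x \<and> x < v \<and> v - u < d \<longrightarrow> p * (v - u) \<le> f v - f u}"
    have A_le: "p \<le> L" if p: "p \<in> A" for p
    proof -
      obtain d where d: "d > 0" "\<And>u v. u < x \<Longrightarrow> x < v \<Longrightarrow> v - u < d \<Longrightarrow> p * (v - u) \<le> f v - f u"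
        using p unfolding A_def by blast
      have "p * (x + d/3 - (x - d/3)) \<le> L * (x + d/3 - (x - d/3))"
        using d(2)[of "x - d/3" "x + d/3"] lip[of "x - d/3" "x + d/3"] d(1) by linarith
      then show ?thesis
        using d(1) by simp
    qed
    have A0: "0 \<in> A"
      unfolding A_def using mono by (auto intro!: exI[of _ 1])
    define D where "D = Sup A"
    have bdd: "bdd_above A"
      using A_le by (rule bdd_aboveI)
    have D0: "0 \<le> D"
      unfolding D_def using A0 bdd by (rule cSup_upper)
    have slopes: "\<exists>d>0. \<forall>u v. u < x \<and> x < v \<and> v - u < d \<longrightarrow>
        (D - e) * (v - u) \<le> f v - f u \<and> f v - f u \<le> (D + e) * (v - u)" if e: "e > 0" for e
    proof -
      obtain p where p: "p \<in> A" "D - e < p"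
        using less_cSup_iff[of A "D - e"] A0 bdd e unfolding D_def by auto
      obtain d1 where d1: "d1 > 0" "\<And>u v. u < x \<Longrightarrow> x < v \<Longrightarrow> v - u < d1 \<Longrightarrow> p * (v - u) \<le> f v - f u"
        using p unfolding A_def by blast
      \<comment> \<open>Two rationals fit between \<open>D\<close> and \<open>D + e\<close>. Slopes
        below \<open>p'\<close> occur at every scale because \<open>p'\<close> exceeds
        \<open>Sup A\<close>; slopes above \<open>q'\<close> then cannot, as \<open>x\<close> avoids
        the exceptional set of \<open>(p', q')\<close>.\<close>
      obtain p' where p': "p' \<in> \<rat>" "D < p'" "p' < D + e"
        using Rats_dense_in_real[of D "D + e"] e by auto
      obtain q' where q': "q' \<in> \<rat>" "p' < q'" "q' < D + e"
        using Rats_dense_in_real[of p' "D + e"] p' by auto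
      have "(p', q') \<in> R"
        using p' q' D0 by (auto simp: R_def)
      then have "x \<notin> ?E p' q'"
        using x by blast
      moreover have "\<exists>u v. u < x \<and> x < v \<and> v - u < inverse (real (Suc n)) \<and> f v - f u < p' * (v - u)" for n
      proof -
        have "p' \<notin> A"
          using p' cSup_upper[OF _ bdd, of p'] unfolding D_def by auto
        moreover have "0 < inverse (real (Suc n))"
          by simp
        ultimately show ?thesis
          unfolding A_def by (auto simp: not_le)
      qed
      ultimately obtain n where n: "\<not> (\<exists>u v. u < x \<and> x < v \<and> v - u < inverse (real (Suc n)) \<and> q' * (v - u) < f v - f u)"
        unfolding oscillating_slopes_def by blast
      define d2 where "d2 = inverse (real (Suc n))"
      have "d2 > 0" "\<not> (\<exists>u v. u < x \<and> x < v \<and> v - u < d2 \<and> q' * (v - u) < f v - f u)"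
        using n by (simp_all add: d2_def)
      then have d2: "d2 > 0" "\<And>u v. u < x \<Longrightarrow> x < v \<Longrightarrow> v - u < d2 \<Longrightarrow> f v - f u \<le> q' * (v - u)"
        using not_less by blast+
      have "(D - e) * (v - u) \<le> f v - f u \<and> f v - f u \<le> (D + e) * (v - u)"
        if uv: "u < x" "x < v" "v - u < min d1 d2" for u v
      proof -
        have "(D - e) * (v - u) \<le> p * (v - u)" "q' * (v - u) \<le> (D + e) * (v - u)"
          using p(2) q'(3) uv by (auto intro!: mult_right_mono)
        then show ?thesis
          using d1(2)[of u v] d2(2)[of u v] uv by linarith
      qed
      then show ?thesis
        using d1(1) d2(1) by (intro exI[of _ "min d1 d2"]) auto
    qed
    \<comment> \<open>Difference quotients at \<open>x\<close> have \<open>x\<close> as an end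
      point. They are reached by widening the interval by \<open>s\<close> on both sides and letting
      \<open>s\<close> tend to \<open>0\<close>, with \<open>h\<close> chosen to keep the widened
      length below \<open>d\<close>.\<close>
    have slopes': "\<exists>d>0. \<forall>u v. u \<le> x \<and> x \<le> v \<and> u < v \<and> v - u < d \<longrightarrow>
        \<bar>f v - f u - D * (v - u)\<bar> \<le> e * (v - u)" if e: "e > 0" for e
    proof -
      obtain d where d: "d > 0" "\<And>u v. u < x \<Longrightarrow> x < v \<Longrightarrow> v - u < d \<Longrightarrow>
        (D - e) * (v - u) \<le> f v - f u \<and> f v - f u \<le> (D + e) * (v - u)"
        using slopes[OF e] by blast
      have "\<bar>f v - f u - D * (v - u)\<bar> \<le> e * (v - u)" if uv: "u \<le> x" "x \<le> v" "u < v" "v - u < d" for u v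
      proof -
        define h where "h = (d - (v - u)) / 2"
        define g where "g s = \<bar>f (v + s) - f (u - s) - D * (v + s - (u - s))\<bar> - e * (v + s - (u - s))" for s
        have h: "0 < h"
          using uv by (simp add: h_def)
        have "continuous_on (closure {0<..<h}) g"
          unfolding g_def by (intro continuous_intros continuous_on_compose2[OF cont]) auto
        moreover have "0 \<in> closure {0<..<h}"
          using h by simp
        moreover have "g s \<le> 0" if "s \<in> {0<..<h}" for s
        proof -
          have "v + s - (u - s) < d" "u - s < x" "x < v + s"
            using that uv by (auto simp: h_def)
          then show ?thesis
            using d(2)[of "u - s" "v + s"] unfolding g_def left_diff_distrib distrib_right by linarith
        qed
        ultimately have "g 0 \<le> 0"
          by (rule continuous_le_on_closure)
        then show ?thesis
          by (simp add: g_def)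
      qed
      then show ?thesis using d(1) by blast
    qed
    have "(f has_real_derivative D) (at x)"
      unfolding has_field_derivative_def has_derivative_at_alt
    proof (intro conjI allI impI)
      fix e :: real assume e: "0 < e"
      then obtain d where d: "d > 0" "\<And>u v. u \<le> x \<Longrightarrow> x \<le> v \<Longrightarrow> u < v \<Longrightarrow> v - u < d \<Longrightarrow>
          \<bar>f v - f u - D * (v - u)\<bar> \<le> e * (v - u)"
        using slopes'[OF e] by metis
      have "norm (f y - f x - D * (y - x)) \<le> e * norm (y - x)" if y: "norm (y - x) < d" for y
      proof (cases y x rule: linorder_cases)
        case less
        then have "\<bar>f x - f y - D * (x - y)\<bar> \<le> e * (x - y)"
          using d(2)[of y x] y by auto
        moreover have "f y - f x - D * (y - x) = - (f x - f y - D * (x - y))"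
          by (simp add: algebra_simps)
        ultimately show ?thesis
          using less by (simp only: real_norm_def abs_minus_cancel) auto
      next
        case greater
        then show ?thesis using d(2)[of x y] y by auto
      qed auto
      then show "\<exists>d>0. \<forall>y. norm (y - x) < d \<longrightarrow> norm (f y - f x - D * (y - x)) \<le> e * norm (y - x)"
        using d(1) by blast
    qed (rule bounded_linear_mult_right)
    then show ?thesis
      using real_differentiable_def by blast
  qed
  ultimately show ?thesis
    by (elim negligible_subset) blast
qed

text \<open>Adding \<open>K * t\<close> turns a \<open>K\<close>-Lipschitz component into a monotone
  one with slopes at most \<open>2 * K\<close>, and does not affect differentiability.\<close>

theorem negligible_lipschitz_not_differentiable:
  fixes f :: "real \<Rightarrow> 'a::euclidean_space"
  assumes lip: "K-lipschitz_on UNIV f"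
  shows "negligible {t. \<not> f differentiable (at t)}"
proof -
  have K: "0 \<le> K"
    using lip by (rule lipschitz_on_nonneg)
  have "negligible {t. \<not> (\<lambda>t. f t \<bullet> i) differentiable (at t)}" if i: "i \<in> Basis" for i
  proof -
    have inc: "\<bar>f t \<bullet> i - f s \<bullet> i\<bar> \<le> K * \<bar>t - s\<bar>" for s t
    proof -
      have "\<bar>(f t - f s) \<bullet> i\<bar> \<le> norm (f t - f s)"
        using i by (rule Basis_le_norm)
      also have "\<dots> \<le> K * \<bar>t - s\<bar>"
        using lipschitz_onD[OF lip, of t s] by (simp add: dist_norm)
      finally show ?thesis by (simp add: inner_diff_left)
    qed
    have "negligible {t. \<not> (\<lambda>t. f t \<bullet> i + K * t) differentiable (at t)}"
    proof (rule lipschitz_mono_differentiable_real[where L = "2 * K"])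
      fix s t :: real assume "s \<le> t"
      then show "f s \<bullet> i + K * s \<le> f t \<bullet> i + K * t"
        "f t \<bullet> i + K * t - (f s \<bullet> i + K * s) \<le> 2 * K * (t - s)"
        using inc[of t s] by (auto simp: algebra_simps abs_le_iff)
    qed
    moreover have "(\<lambda>t. f t \<bullet> i) differentiable (at t)"
      if "(\<lambda>t. f t \<bullet> i + K * t) differentiable (at t)" for t
    proof -
      have "(\<lambda>t. (f t \<bullet> i + K * t) - K * t) differentiable (at t)"
        using that by (intro differentiable_diff) auto
      then show ?thesis by simp
    qed
    ultimately show ?thesis
      by (elim negligible_subset) blast
  qed
  then have "negligible (\<Union>i\<in>Basis. {t. \<not> (\<lambda>t. f t \<bullet> i) differentiable (at t)})"
    by (intro negligible_Union) auto
  moreover have "{t. \<not> f differentiable (at t)} \<subseteq> (\<Union>i\<in>Basis. {t. \<not> (\<lambda>t. f t \<bullet> i) differentiable (at t)})"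
    using differentiable_componentwise_within[of f _ UNIV] by auto
  ultimately show ?thesis
    by (rule negligible_subset)
qed

section \<open>Absolute continuity and a mean value inequality\<close>

lemma absolutely_continuous_sum_less:
  fixes f :: "real \<Rightarrow> 'a::real_normed_vector"
  assumes ac: "absolutely_continuous_on_interval a b f" and e: "0 < e"
  obtains d where "d > 0"
    "\<And>(P :: 'i set) u v. finite P \<Longrightarrow> (\<And>i. i \<in> P \<Longrightarrow> a \<le> u i \<and> u i \<le> v i \<and> v i \<le> b) \<Longrightarrow>
      disjoint_family_on (\<lambda>i. {u i<..<v i}) P \<Longrightarrow> (\<Sum>i\<in>P. v i - u i) < d \<Longrightarrow>
      (\<Sum>i\<in>P. norm (f (v i) - f (u i))) < e"
proof -
  obtain d where d: "d > 0" "\<And>(m::nat) u v. (\<forall>i<m. a \<le> u i \<and> u i \<le> v i \<and> v i \<le> b) \<Longrightarrow>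
        disjoint_family_on (\<lambda>i. {u i<..<v i}) {..<m} \<Longrightarrow>
        (\<Sum>i<m. v i - u i) < d \<Longrightarrow> (\<Sum>i<m. norm (f (v i) - f (u i))) < e"
    using ac e unfolding absolutely_continuous_on_interval_def by meson
  show thesis
  proof (rule that[OF d(1)])
    fix P :: "'i set" and u v
    assume P: "finite P" "\<And>i. i \<in> P \<Longrightarrow> a \<le> u i \<and> u i \<le> v i \<and> v i \<le> b"
      "disjoint_family_on (\<lambda>i. {u i<..<v i}) P" "(\<Sum>i\<in>P. v i - u i) < d"
    \<comment> \<open>The definition speaks of families indexed by \<open>{..<m}\<close>; the
      reindexing admits any finite index set, in particular the tagged intervals of a
      division.\<close>
    obtain h where h: "bij_betw h {..<card P} P"
      using ex_bij_betw_nat_finite[OF P(1)] by (auto simp: atLeast0LessThan)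
    have hP: "h i \<in> P" if "i < card P" for i
      using h that by (auto simp: bij_betw_def)
    have inj: "h i \<noteq> h j" if "i < card P" "j < card P" "i \<noteq> j" for i j
      using h that by (auto simp: bij_betw_def inj_on_def)
    have "(\<Sum>i<card P. norm (f (v (h i)) - f (u (h i)))) < e"
    proof (rule d(2))
      show "disjoint_family_on (\<lambda>i. {u (h i)<..<v (h i)}) {..<card P}"
        using P(3) hP inj by (auto simp: disjoint_family_on_def)
      show "(\<Sum>i<card P. v (h i) - u (h i)) < d"
        using P(4) sum.reindex_bij_betw[OF h, of "\<lambda>i. v i - u i"] by simp
    qed (use P(2) hP in auto)
    then show "(\<Sum>i\<in>P. norm (f (v i) - f (u i))) < e"
      using sum.reindex_bij_betw[OF h, of "\<lambda>i. norm (f (v i) - f (u i))"] by simp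
  qed
qed

text \<open>A mean value inequality proved by a gauge instead of integration. For
  \<open>h t = p \<bullet> f t - c * t\<close>, differentiability bounds the increment over an
  interval with a good tag by a small multiple of its length; the intervals tagged in
  \<open>N\<close> have small total length, so absolute continuity bounds their
  contribution.\<close>

lemma absolutely_continuous_increment_le:
  fixes f :: "real \<Rightarrow> 'a::euclidean_space"
  assumes ac: "absolutely_continuous_on_interval a b f" and ab: "a \<le> b"
    and N: "negligible N"
    and deriv: "\<And>t. t \<in> {a..b} - N \<Longrightarrow> \<exists>v. (f has_vector_derivative v) (at t within {a..b}) \<and> p \<bullet> v \<le> c"
  shows "p \<bullet> (f b - f a) \<le> c * (b - a)"
proof -
  define h where "h t = p \<bullet> f t - c * t" for t
  \<comment> \<open>\<open>norm p * (b - a)\<close> pays for the intervals with good tags,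
    \<open>norm p + \<bar>c\<bar>\<close> for those tagged in \<open>N\<close>.\<close>
  define K where "K = norm p * (b - a) + norm p + \<bar>c\<bar>"
  have K: "0 \<le> K"
    using ab by (auto simp: K_def)
  have key: "h b - h a \<le> K * e" if e: "e > 0" for e
  proof -
    obtain d where d: "d > 0" "\<And>(P :: (real \<times> real set) set) u v. finite P \<Longrightarrow> (\<And>i. i \<in> P \<Longrightarrow> a \<le> u i \<and> u i \<le> v i \<and> v i \<le> b) \<Longrightarrow>
      disjoint_family_on (\<lambda>i. {u i<..<v i}) P \<Longrightarrow> (\<Sum>i\<in>P. v i - u i) < d \<Longrightarrow>
      (\<Sum>i\<in>P. norm (f (v i) - f (u i))) < e"
      using absolutely_continuous_sum_less[OF ac e] by blast
    have Nl: "N \<in> sets lebesgue" "N \<in> null_sets lebesgue"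
      using N by (auto simp: negligible_iff_null_sets)
    obtain T where T: "open T" "N \<subseteq> T" "T - N \<in> lmeasurable" "emeasure lebesgue (T - N) < ennreal (min d e)"
      using sets_lebesgue_outer_open[OF Nl(1), of "min d e"] d(1) e by auto
    have emT: "emeasure lebesgue T < ennreal (min d e)"
      using T emeasure_Diff_null_set[OF Nl(2), of T] by simp
    have "\<exists>v r. p \<bullet> v \<le> c \<and> r > 0 \<and> (\<forall>y\<in>{a..b}. \<bar>y - t\<bar> < r \<longrightarrow> norm (f y - f t - (y - t) *\<^sub>R v) \<le> e * \<bar>y - t\<bar>)"
      if t: "t \<in> {a..b} - N" for t
      using deriv[OF t] e unfolding has_vector_derivative_def has_derivative_within_alt real_norm_def by blast
    then obtain D \<rho> where D: "\<And>t. t \<in> {a..b} - N \<Longrightarrow> p \<bullet> D t \<le> c" and \<rho>: "\<And>t. t \<in> {a..b} - N \<Longrightarrow> \<rho> t > 0"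
      "\<And>t y. t \<in> {a..b} - N \<Longrightarrow> y \<in> {a..b} \<Longrightarrow> \<bar>y - t\<bar> < \<rho> t \<Longrightarrow>
         norm (f y - f t - (y - t) *\<^sub>R D t) \<le> e * \<bar>y - t\<bar>"
      by metis
    \<comment> \<open>At tags in \<open>N\<close> the gauge is a fixed open set of measure below
      \<open>min d e\<close>, which bounds the total length of their intervals. The last branch only
      makes \<open>g\<close> a gauge on the whole line.\<close>
    define g where "g t = (if t \<in> N then T else if t \<in> {a..b} then ball t (\<rho> t) else ball t 1)" for t
    have "gauge g"
      using \<rho>(1) T by (auto simp: gauge_def g_def)
    then obtain P where P: "P tagged_division_of {a..b}" "g fine P"
      by (rule fine_division_exists_real)
    have finP: "finite P"
      using P(1) by auto
    have Pk: "\<exists>u v. k = {u..v} \<and> a \<le> u \<and> u \<le> x \<and> x \<le> v \<and> v \<le> b \<and> Inf k = u \<and> Sup k = v \<and> k \<subseteq> g x"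
      if k: "(x, k) \<in> P" for x k
    proof -
      obtain u v where uv: "k = cbox u v"
        using tagged_division_ofD(4)[OF P(1) k] by blast
      have "x \<in> k" "k \<subseteq> {a..b}" "k \<subseteq> g x"
        using tagged_division_ofD(2,3)[OF P(1) k] P(2) k by (auto simp: fine_def)
      then show ?thesis
        using uv by (intro exI[of _ u] exI[of _ v]) auto
    qed
    define B where "B = {i \<in> P. fst i \<in> N}"
    have finB: "finite B"
      using finP by (simp add: B_def)
    have disj: "disjoint_family_on (\<lambda>i. {Inf (snd i)<..<Sup (snd i)}) P"
    proof (unfold disjoint_family_on_def, intro ballI impI)
      fix i j assume ij: "i \<in> P" "j \<in> P" "i \<noteq> j"
      obtain x k y l where [simp]: "i = (x, k)" "j = (y, l)"
        by (metis surj_pair)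
      have "interior k \<inter> interior l = {}"
        using tagged_division_ofD(5)[OF P(1)] ij by auto
      moreover have "interior k = {Inf k<..<Sup k}" "interior l = {Inf l<..<Sup l}"
        using Pk[of x k] Pk[of y l] ij by (metis interior_atLeastAtMost_real \<open>i = (x, k)\<close> \<open>j = (y, l)\<close>)+
      ultimately show "{Inf (snd i)<..<Sup (snd i)} \<inter> {Inf (snd j)<..<Sup (snd j)} = {}"
        by simp
    qed
    have len: "(\<Sum>i\<in>B. Sup (snd i) - Inf (snd i)) < min d e"
    proof -
      have disjB: "disjoint_family_on (\<lambda>i. {Inf (snd i)<..<Sup (snd i)}) B"
        using disj by (rule disjoint_family_on_mono[rotated]) (auto simp: B_def)
      have le: "Inf (snd i) \<le> Sup (snd i)" if "i \<in> B" for i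
        using Pk[of "fst i" "snd i"] that by (auto simp: B_def)
      have "(\<Sum>i\<in>B. Sup (snd i) - Inf (snd i)) = (\<Sum>i\<in>B. measure lebesgue {Inf (snd i)<..<Sup (snd i)})"
        using le by (intro sum.cong) auto
      also have "\<dots> = measure lebesgue (\<Union>i\<in>B. {Inf (snd i)<..<Sup (snd i)})"
        using le by (intro measure_finite_Union[symmetric] finB disjB) auto
      also have "\<dots> \<le> measure lebesgue T"
      proof (rule measure_mono_fmeasurable)
        show "(\<Union>i\<in>B. {Inf (snd i)<..<Sup (snd i)}) \<subseteq> T"
        proof (rule UN_least)
          fix i assume i: "i \<in> B"
          then show "{Inf (snd i)<..<Sup (snd i)} \<subseteq> T"
            using Pk[of "fst i" "snd i"] by (auto simp: B_def g_def)
        qed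
        show "T \<in> lmeasurable"
          using emT T(1) by (auto simp: fmeasurable_def intro: less_trans)
        show "(\<Union>i\<in>B. {Inf (snd i)<..<Sup (snd i)}) \<in> sets lebesgue"
          using finB by (intro sets.finite_UN) auto
      qed
      also have "\<dots> < min d e"
      proof -
        have "ennreal (measure lebesgue T) < ennreal (min d e)"
          using emT by (subst emeasure_eq_ennreal_measure[symmetric]) auto
        then show ?thesis
          by (subst (asm) ennreal_less_iff) auto
      qed
      finally show ?thesis .
    qed
    have "(\<Sum>i\<in>B. norm (f (Sup (snd i)) - f (Inf (snd i)))) < e"
    proof (rule d(2)[OF finB])
      show "a \<le> Inf (snd i) \<and> Inf (snd i) \<le> Sup (snd i) \<and> Sup (snd i) \<le> b" if "i \<in> B" for i
        using Pk[of "fst i" "snd i"] that by (auto simp: B_def)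
      show "disjoint_family_on (\<lambda>i. {Inf (snd i)<..<Sup (snd i)}) B"
        using disj by (rule disjoint_family_on_mono[rotated]) (auto simp: B_def)
    qed (use len in auto)
    note bad = this
    let ?inc = "\<lambda>i::real \<times> real set. h (Sup (snd i)) - h (Inf (snd i))"
    let ?len = "\<lambda>i::real \<times> real set. Sup (snd i) - Inf (snd i)"
    have "h b - h a = (\<Sum>i\<in>P. ?inc i)"
      using additive_tagged_division_1[OF ab P(1), of h] by (simp add: case_prod_beta)
    also have "\<dots> = (\<Sum>i\<in>P - B. ?inc i) + (\<Sum>i\<in>B. ?inc i)"
      by (rule sum.subset_diff) (auto simp: B_def finP)
    also have "(\<Sum>i\<in>P - B. ?inc i) \<le> (\<Sum>i\<in>P - B. norm p * e * ?len i)"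
    proof (rule sum_mono)
      fix i assume i: "i \<in> P - B"
      obtain x k where [simp]: "i = (x, k)"
        by (metis surj_pair)
      have xk: "(x, k) \<in> P" "x \<notin> N"
        using i by (auto simp: B_def)
      obtain u v where uv: "k = {u..v}" "a \<le> u" "u \<le> x" "x \<le> v" "v \<le> b" "Inf k = u" "Sup k = v" "k \<subseteq> g x"
        using Pk[OF xk(1)] by blast
      have x: "x \<in> {a..b} - N"
        using uv xk by auto
      have "k \<subseteq> ball x (\<rho> x)"
        using uv(8) x by (auto simp: g_def)
      moreover have "u \<in> k" "v \<in> k"
        using uv by auto
      ultimately have "u \<in> ball x (\<rho> x)" "v \<in> ball x (\<rho> x)"
        by blast+
      then have "\<bar>u - x\<bar> < \<rho> x" "\<bar>v - x\<bar> < \<rho> x"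
        by (auto simp: dist_real_def abs_minus_commute)
      then have 1: "norm (f u - f x - (u - x) *\<^sub>R D x) \<le> e * (x - u)"
        and 2: "norm (f v - f x - (v - x) *\<^sub>R D x) \<le> e * (v - x)"
        using \<rho>(2)[OF x, of u] \<rho>(2)[OF x, of v] uv by auto
      have ps: "p \<bullet> w \<le> norm p * m" if "norm w \<le> m" for w m
        using order_trans[OF norm_cauchy_schwarz mult_left_mono[OF that norm_ge_zero]] .
      have "p \<bullet> (f v - f u) = p \<bullet> (f v - f x - (v - x) *\<^sub>R D x) + p \<bullet> - (f u - f x - (u - x) *\<^sub>R D x) + (v - u) * (p \<bullet> D x)"
        by (simp add: inner_diff_right algebra_simps)
      moreover have "(v - u) * (p \<bullet> D x) \<le> (v - u) * c"
        using D[OF x] uv by (intro mult_left_mono) auto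
      ultimately have "p \<bullet> (f v - f u) \<le> norm p * (e * (v - x)) + norm p * (e * (x - u)) + (v - u) * c"
        using ps[OF 2] ps[of "- (f u - f x - (u - x) *\<^sub>R D x)", OF 1[folded norm_minus_cancel[of "f u - f x - (u - x) *\<^sub>R D x"]]]
        by linarith
      then show "?inc i \<le> norm p * e * ?len i"
        using uv by (simp add: h_def inner_diff_right algebra_simps)
    qed
    also have "\<dots> \<le> (\<Sum>i\<in>P. norm p * e * ?len i)"
    proof (rule sum_mono2[OF finP])
      fix i assume "i \<in> P - (P - B)"
      then show "0 \<le> norm p * e * ?len i"
        using Pk[of "fst i" "snd i"] e by (auto simp: B_def)
    qed auto
    also have "\<dots> = norm p * e * (b - a)"
      using additive_tagged_division_1[OF ab P(1), of "\<lambda>x. x"]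
      by (simp add: case_prod_beta sum_distrib_left[symmetric])
    also have "(\<Sum>i\<in>B. ?inc i) \<le> (\<Sum>i\<in>B. norm p * norm (f (Sup (snd i)) - f (Inf (snd i))) + \<bar>c\<bar> * ?len i)"
    proof (rule sum_mono)
      fix i assume i: "i \<in> B"
      have "?inc i = p \<bullet> (f (Sup (snd i)) - f (Inf (snd i))) + (- c) * ?len i"
        by (simp add: h_def inner_diff_right algebra_simps)
      also have "p \<bullet> (f (Sup (snd i)) - f (Inf (snd i))) \<le> norm p * norm (f (Sup (snd i)) - f (Inf (snd i)))"
        by (rule norm_cauchy_schwarz)
      also have "(- c) * ?len i \<le> \<bar>c\<bar> * ?len i"
        using Pk[of "fst i" "snd i"] i by (intro mult_right_mono) (auto simp: B_def)
      finally show "?inc i \<le> norm p * norm (f (Sup (snd i)) - f (Inf (snd i))) + \<bar>c\<bar> * ?len i"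
        by simp
    qed
    also have "\<dots> = norm p * (\<Sum>i\<in>B. norm (f (Sup (snd i)) - f (Inf (snd i)))) + \<bar>c\<bar> * (\<Sum>i\<in>B. ?len i)"
      by (simp add: sum.distrib sum_distrib_left)
    also have "\<dots> \<le> norm p * e + \<bar>c\<bar> * e"
      using bad len by (intro add_mono mult_left_mono) auto
    finally show ?thesis
      by (simp add: K_def algebra_simps)
  qed
  have "h b - h a \<le> 0"
  proof (rule field_le_epsilon)
    fix e :: real assume "0 < e"
    then have "h b - h a \<le> K * (e / (K + 1))"
      using K by (intro key) auto
    also have "\<dots> \<le> e"
      using K \<open>0 < e\<close> by (simp add: field_simps)
    finally show "h b - h a \<le> 0 + e" by simp
  qed
  then show ?thesis
    by (simp add: h_def inner_diff_right algebra_simps)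
qed

section \<open>Hybrid time domains\<close>

text \<open>An intrinsic form of the definition, without a sequence of switching times and without a
  case distinction on the last piece. In this form the property can be verified for shifts, unions
  of chains and limits.\<close>

lemma hybrid_time_domain_iff:
  "hybrid_time_domain E \<longleftrightarrow>
     (0, 0) \<in> E \<and> (\<forall>t j. (t, j) \<in> E \<longrightarrow> 0 \<le> t) \<and>
     (\<forall>j s t u. (s, j) \<in> E \<longrightarrow> (u, j) \<in> E \<longrightarrow> s \<le> t \<longrightarrow> t \<le> u \<longrightarrow> (t, j) \<in> E) \<and>
     (\<forall>j t. (t, Suc j) \<in> E \<longrightarrow>
        (\<exists>m. (m, j) \<in> E \<and> (m, Suc j) \<in> E \<and> (\<forall>s. (s, j) \<in> E \<longrightarrow> s \<le> m) \<and> (\<forall>s. (s, Suc j) \<in> E \<longrightarrow> m \<le> s)))"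
    (is "_ = (?P1 \<and> ?P2 \<and> ?P3 \<and> ?P4)")
proof
  assume "hybrid_time_domain E"
  then obtain t where t: "t 0 = 0" "incseq t" and
    E: "E = (\<Union>j. {t j..t (Suc j)} \<times> {j}) \<or>
         (\<exists>J L. (L = {t J..t (Suc J)} \<or> (t J < t (Suc J) \<and> L = {t J..<t (Suc J)}) \<or> L = {t J..}) \<and>
                E = (\<Union>j<J. {t j..t (Suc j)} \<times> {j}) \<union> L \<times> {J})"
    unfolding hybrid_time_domain_def by blast
  have le: "t j \<le> t (Suc j)" "0 \<le> t j" for j
    using t(2) incseqD[OF t(2), of 0 j] t(1) by (auto simp: incseq_SucD)
  \<comment> \<open>\<open>Q j s\<close> says that slice \<open>j\<close> exists and reaches up to
    \<open>s\<close>, whatever the shape of its upper end; this treats the four kinds of domain at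
    once.\<close>
  have "\<exists>Q. (\<forall>s j. (s, j) \<in> E \<longleftrightarrow> t j \<le> s \<and> Q j s) \<and> Q 0 0 \<and> (\<forall>j r s. Q j s \<longrightarrow> r \<le> s \<longrightarrow> Q j r) \<and>
      (\<forall>j s. Q (Suc j) s \<longrightarrow> Q j (t (Suc j)) \<and> (\<forall>r. Q j r \<longrightarrow> r \<le> t (Suc j)))"
    using E
  proof (elim disjE exE conjE)
    assume "E = (\<Union>j. {t j..t (Suc j)} \<times> {j})"
    then show ?thesis
      using le[of 0] t(1) by (intro exI[of _ "\<lambda>j s. s \<le> t (Suc j)"]) auto
  next
    fix J L assume "L = {t J..t (Suc J)}" "E = (\<Union>j<J. {t j..t (Suc j)} \<times> {j}) \<union> L \<times> {J}"
    then show ?thesis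
      using le[of 0] t(1) by (intro exI[of _ "\<lambda>j s. j \<le> J \<and> s \<le> t (Suc j)"]) (auto simp: less_le)
  next
    fix J L assume "L = {t J..<t (Suc J)}" "t J < t (Suc J)"
      "E = (\<Union>j<J. {t j..t (Suc j)} \<times> {j}) \<union> L \<times> {J}"
    then show ?thesis
      using le[of 0] t(1)
      by (intro exI[of _ "\<lambda>j s. j < J \<and> s \<le> t (Suc j) \<or> j = J \<and> s < t (Suc j)"]) (cases "J = 0"; auto)
  next
    fix J L assume "L = {t J..}" "E = (\<Union>j<J. {t j..t (Suc j)} \<times> {j}) \<union> L \<times> {J}"
    then show ?thesis
      using le[of 0] t(1)
      by (intro exI[of _ "\<lambda>j s. j < J \<and> s \<le> t (Suc j) \<or> j = J"]) (cases "J = 0"; auto)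
  qed
  then obtain Q where mem: "\<forall>s j. (s, j) \<in> E \<longleftrightarrow> t j \<le> s \<and> Q j s" and Q0: "Q 0 0"
    and down: "\<forall>j r s. Q j s \<longrightarrow> r \<le> s \<longrightarrow> Q j r"
    and jump: "\<forall>j s. Q (Suc j) s \<longrightarrow> Q j (t (Suc j)) \<and> (\<forall>r. Q j r \<longrightarrow> r \<le> t (Suc j))"
    by (elim exE conjE) (rule that)
  show "?P1 \<and> ?P2 \<and> ?P3 \<and> ?P4"
  proof (intro conjI allI impI)
    show "(0, 0) \<in> E"
      using t(1) Q0 by (simp add: mem)
  next
    fix s j assume "(s, j) \<in> E"
    then show "0 \<le> s"
      using le(2)[of j] by (simp add: mem)
  next
    fix j s r u assume "(s, j) \<in> E" "(u, j) \<in> E" "s \<le> r" "r \<le> u"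
    then show "(r, j) \<in> E"
      using down[rule_format, of j u r] by (simp add: mem)
  next
    fix j s assume s: "(s, Suc j) \<in> E"
    then have "t (Suc j) \<le> s" "Q (Suc j) s"
      by (simp_all add: mem)
    then show "\<exists>m. (m, j) \<in> E \<and> (m, Suc j) \<in> E \<and> (\<forall>s. (s, j) \<in> E \<longrightarrow> s \<le> m) \<and> (\<forall>s. (s, Suc j) \<in> E \<longrightarrow> m \<le> s)"
      using le(1)[of j] jump[rule_format, of j s] down[rule_format, of "Suc j" s "t (Suc j)"] by (intro exI[of _ "t (Suc j)"]) (simp add: mem)
  qed
next
  assume P: "?P1 \<and> ?P2 \<and> ?P3 \<and> ?P4"
  have P4: "\<exists>m. (m, j) \<in> E \<and> (m, Suc j) \<in> E \<and> (\<forall>s. (s, j) \<in> E \<longrightarrow> s \<le> m) \<and> (\<forall>s. (s, Suc j) \<in> E \<longrightarrow> m \<le> s)"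
    if "(t, Suc j) \<in> E" for t j
    using P that by blast
  define jump where "jump j = (SOME m. (m, j) \<in> E \<and> (m, Suc j) \<in> E \<and> (\<forall>s. (s, j) \<in> E \<longrightarrow> s \<le> m) \<and> (\<forall>s. (s, Suc j) \<in> E \<longrightarrow> m \<le> s))" for j
  have jump: "(jump j, j) \<in> E \<and> (jump j, Suc j) \<in> E \<and> (\<forall>s. (s, j) \<in> E \<longrightarrow> s \<le> jump j) \<and> (\<forall>s. (s, Suc j) \<in> E \<longrightarrow> jump j \<le> s)"
    if "(t, Suc j) \<in> E" for t j
    unfolding jump_def using someI_ex[OF P4[OF that]] .
  \<comment> \<open>Slice \<open>j\<close> starts at the jump out of slice \<open>j - 1\<close>,
    hence the shift of the index.\<close>
  define t where "t j = (if j = 0 then 0 else jump (j - 1))" for j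
  have t0: "(t j, j) \<in> E \<and> (\<forall>s. (s, j) \<in> E \<longrightarrow> t j \<le> s)" if "(u, j) \<in> E" for u j
  proof (cases j)
    case 0
    then show ?thesis
      using conjunct1[OF P] conjunct1[OF conjunct2[OF P]] unfolding t_def by auto
  next
    case (Suc i)
    then show ?thesis
      using jump[of u i] that unfolding t_def by simp
  qed
  have t1: "(t (Suc j), j) \<in> E \<and> (\<forall>s. (s, j) \<in> E \<longrightarrow> s \<le> t (Suc j))" if "(u, Suc j) \<in> E" for u j
    using jump[OF that] by (auto simp: t_def)
  have slice: "(s, j) \<in> E \<longleftrightarrow> t j \<le> s \<and> s \<le> t (Suc j)" if "(u, Suc j) \<in> E" for s u j
  proof
    assume "(s, j) \<in> E"
    then show "t j \<le> s \<and> s \<le> t (Suc j)"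
      using t0[of s j] t1[OF that] by auto
  next
    assume "t j \<le> s \<and> s \<le> t (Suc j)"
    moreover have "(t j, j) \<in> E" "(t (Suc j), j) \<in> E"
      using t0[of "t (Suc j)" j] t1[OF that] by auto
    ultimately show "(s, j) \<in> E"
      using P by blast
  qed
  show "hybrid_time_domain E"
  proof (cases "\<forall>j. \<exists>s. (s, j) \<in> E")
    case True
    have sl: "(s, j) \<in> E \<longleftrightarrow> t j \<le> s \<and> s \<le> t (Suc j)" for s j
      using slice True by blast
    have "incseq t"
    proof (rule incseq_SucI)
      fix j show "t j \<le> t (Suc j)"
        using True t0[of _ "Suc j"] sl[of _ j] by (meson order_trans)
    qed
    moreover have "E = (\<Union>j. {t j..t (Suc j)} \<times> {j})"
      using sl by auto
    ultimately show ?thesis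
      unfolding hybrid_time_domain_def by (intro exI[of _ t]) (auto simp: t_def)
  next
    case False
    \<comment> \<open>The index of the last nonempty slice, found as the first one without a
      successor; by the jump condition no later slice can be nonempty.\<close>
    define J where "J = (LEAST j. \<forall>s. (s, Suc j) \<notin> E)"
    have ex: "\<exists>j. \<forall>s. (s, Suc j) \<notin> E"
    proof -
      obtain j where "\<forall>s. (s, j) \<notin> E" using False by auto
      then show ?thesis using P by (cases j) auto
    qed
    have J: "\<forall>s. (s, Suc J) \<notin> E"
      unfolding J_def using LeastI_ex[OF ex] .
    have ltJ: "\<exists>s. (s, Suc j) \<in> E" if "j < J" for j
      using not_less_Least[of j "\<lambda>j. \<forall>s. (s, Suc j) \<notin> E"] that unfolding J_def by auto
    have gtJ: "(s, j) \<notin> E" if "j > J" for s j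
      using that
    proof (induction j arbitrary: s)
      case (Suc j)
      show ?case
      proof (cases "j = J")
        case True then show ?thesis using J by auto
      next
        case False
        then have "(u, j) \<notin> E" for u using Suc by auto
        then show ?thesis using P4[of s j] by blast
      qed
    qed auto
    have sl: "(s, j) \<in> E \<longleftrightarrow> t j \<le> s \<and> s \<le> t (Suc j)" if "j < J" for s j
      using slice ltJ[OF that] by blast
    define S where "S = {s. (s, J) \<in> E}"
    have tJ: "t J \<in> S" "\<And>s. s \<in> S \<Longrightarrow> t J \<le> s"
    proof -
      have "\<exists>u. (u, J) \<in> E"
        using ltJ[of "J - 1"] P by (cases J) auto
      then show "t J \<in> S" "\<And>s. s \<in> S \<Longrightarrow> t J \<le> s"
        using t0 by (auto simp: S_def)
    qed
    have conv: "s \<in> S" if "a \<in> S" "b \<in> S" "a \<le> s" "s \<le> b" for a b s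
      using P that unfolding S_def by blast
    have incr: "t j \<le> t (Suc j)" if "j < J" for j
      using ltJ[OF that] t0[of _ "Suc j"] t0[of "t (Suc j)" j] t1[of _ j] by blast
    have E: "E = (\<Union>j<J. {t j..t (Suc j)} \<times> {j}) \<union> S \<times> {J}"
    proof (intro set_eqI)
      fix x :: "real \<times> nat"
      obtain s j where [simp]: "x = (s, j)" by (cases x)
      show "x \<in> E \<longleftrightarrow> x \<in> (\<Union>j<J. {t j..t (Suc j)} \<times> {j}) \<union> S \<times> {J}"
        using sl[of j s] gtJ[of j s] by (cases j J rule: linorder_cases) (auto simp: S_def)
    qed
    \<comment> \<open>Of the ten shapes of a real interval only three have a least element.\<close>
    obtain a b where "S = {} \<or> S = UNIV \<or> S = {..<b} \<or> S = {..b} \<or> S = {a<..} \<or> S = {a..} \<or>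
        S = {a<..<b} \<or> S = {a<..b} \<or> S = {a..<b} \<or> S = {a..b}"
      using interval_cases[of S] conv by blast
    moreover have "\<exists>s<u. s \<in> S" if "S = UNIV \<or> S = {..<b} \<or> S = {..b} \<or> S = {a<..} \<or> S = {a<..<b} \<or> S = {a<..b}" "u \<in> S" for u
      using that lt_ex[of u] dense[of a u] by (elim disjE) force+
    ultimately have S: "S = {a..} \<or> S = {a..<b} \<or> S = {a..b}"
      using tJ by (metis empty_iff not_le)
    then have "t J = a"
      using tJ by (intro antisym) auto
    have "\<exists>c. t J \<le> c \<and> (S = {t J..c} \<or> (t J < c \<and> S = {t J..<c}) \<or> S = {t J..})"
      using S tJ(1) unfolding \<open>t J = a\<close>
      by (elim disjE; intro exI[of _ "if S = {a..} then a else b"]) auto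
    then obtain c where c: "t J \<le> c" "S = {t J..c} \<or> (t J < c \<and> S = {t J..<c}) \<or> S = {t J..}"
      by blast
    \<comment> \<open>Beyond \<open>J\<close> the values of \<open>t\<close> come from
      \<open>SOME\<close> without a witness and mean nothing. They are replaced by the upper end
      \<open>c\<close> of the last piece, or by some time not before its start if that piece is
      unbounded.\<close>
    define t' where "t' j = (if j \<le> J then t j else c)" for j
    have inc: "incseq t'"
      by (rule incseq_SucI) (use c incr in \<open>auto simp: t'_def Suc_le_eq le_less\<close>)
    have L: "S = {t' J..t' (Suc J)} \<or> (t' J < t' (Suc J) \<and> S = {t' J..<t' (Suc J)}) \<or> S = {t' J..}"
      using c(2) by (simp add: t'_def)
    have "E = (\<Union>j<J. {t' j..t' (Suc j)} \<times> {j}) \<union> S \<times> {J}"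
      unfolding E by (auto simp: t'_def)
    moreover have "t' 0 = 0"
      by (simp add: t'_def t_def)
    ultimately show ?thesis
      unfolding hybrid_time_domain_def using inc L by blast
  qed
qed

section \<open>Order, truncation, shift and union of time domains\<close>

lemma hybrid_time_domain_0: "hybrid_time_domain E \<Longrightarrow> (0, 0) \<in> E"
  and hybrid_time_domain_nonneg: "hybrid_time_domain E \<Longrightarrow> (t, j) \<in> E \<Longrightarrow> 0 \<le> t"
  and hybrid_time_domain_convex: "hybrid_time_domain E \<Longrightarrow> (s, j) \<in> E \<Longrightarrow> (u, j) \<in> E \<Longrightarrow> s \<le> t \<Longrightarrow> t \<le> u \<Longrightarrow> (t, j) \<in> E"
  unfolding hybrid_time_domain_iff by blast+

lemma hybrid_time_domain_jump:
  assumes "hybrid_time_domain E" "(t, Suc j) \<in> E"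
  obtains m where "(m, j) \<in> E" "(m, Suc j) \<in> E" "\<And>s. (s, j) \<in> E \<Longrightarrow> s \<le> m" "\<And>s. (s, Suc j) \<in> E \<Longrightarrow> m \<le> s"
proof -
  have "\<exists>m. (m, j) \<in> E \<and> (m, Suc j) \<in> E \<and> (\<forall>s. (s, j) \<in> E \<longrightarrow> s \<le> m) \<and> (\<forall>s. (s, Suc j) \<in> E \<longrightarrow> m \<le> s)"
    using assms unfolding hybrid_time_domain_iff by blast
  then show thesis using that by blast
qed

lemma hybrid_time_domain_order:
  assumes E: "hybrid_time_domain E" and "(s, i) \<in> E" "(t, j) \<in> E" "i < j"
  shows "s \<le> t"
  using assms(3,4)
proof (induction j arbitrary: t)
  case (Suc j)
  obtain m where m: "(m, j) \<in> E" "(m, Suc j) \<in> E" "\<And>s. (s, j) \<in> E \<Longrightarrow> s \<le> m" "\<And>s. (s, Suc j) \<in> E \<Longrightarrow> m \<le> s"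
    using hybrid_time_domain_jump[OF E Suc.prems(1)] by blast
  have "s \<le> m"
    using Suc.IH[OF m(1)] m(3) assms(2) Suc.prems(2) by (cases "i = j") auto
  then show ?case
    using m(4)[OF Suc.prems(1)] by simp
qed simp

text \<open>A time domain is a chain for the componentwise order, so comparing the sums is enough to
  compare both coordinates.\<close>

lemma hybrid_time_domain_order_sum:
  assumes E: "hybrid_time_domain E" and "(s, i) \<in> E" "(t, j) \<in> E" "s + real i < t + real j"
  shows "s \<le> t \<and> i \<le> j"
  using hybrid_time_domain_order[OF assms(1-3)] hybrid_time_domain_order[OF assms(1,3,2)] assms(4)
  by (cases i j rule: linorder_cases) auto

text \<open>The jump times up to \<open>(T, J)\<close> are padded by the constant \<open>T\<close>:
  arcs with different numbers of jumps then have jump-time sequences indexed by all of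
  \<open>nat\<close>, whose limits can be taken index by index.\<close>

lemma hybrid_time_domain_truncation:
  assumes E: "hybrid_time_domain E" and TJ: "(T, J) \<in> E"
  obtains \<tau> where "\<tau> 0 = (0::real)" "incseq \<tau>" "\<And>j. J < j \<Longrightarrow> \<tau> j = T"
    "\<And>t j. j \<le> J \<Longrightarrow> \<tau> j \<le> t \<Longrightarrow> t \<le> \<tau> (Suc j) \<Longrightarrow> (t, j) \<in> E"
    "\<And>t j. (t, j) \<in> E \<Longrightarrow> j \<le> J \<Longrightarrow> t \<le> T \<Longrightarrow> \<tau> j \<le> t \<and> t \<le> \<tau> (Suc j)"
proof -
  have "\<exists>t. (t, j) \<in> E" if "j \<le> J" for j
    using that
  proof (induction rule: inc_induct)
    case (step j)
    then show ?case by (metis hybrid_time_domain_jump[OF E])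
  qed (use TJ in blast)
  then have "\<forall>j<J. \<exists>m. (m, j) \<in> E \<and> (m, Suc j) \<in> E \<and> (\<forall>s. (s, j) \<in> E \<longrightarrow> s \<le> m) \<and> (\<forall>s. (s, Suc j) \<in> E \<longrightarrow> m \<le> s)"
    using E unfolding hybrid_time_domain_iff by (meson Suc_leI)
  then obtain m where m: "\<And>j. j < J \<Longrightarrow> (m j, j) \<in> E \<and> (m j, Suc j) \<in> E \<and>
      (\<forall>s. (s, j) \<in> E \<longrightarrow> s \<le> m j) \<and> (\<forall>s. (s, Suc j) \<in> E \<longrightarrow> m j \<le> s)"
    by metis
  define \<tau> where "\<tau> j = (case j of 0 \<Rightarrow> 0 | Suc i \<Rightarrow> if i < J then m i else T)" for j
  have lo: "(\<tau> j, j) \<in> E \<and> (\<forall>s. (s, j) \<in> E \<longrightarrow> \<tau> j \<le> s)" if "j \<le> J" for j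
    using that m[of "j - 1"] hybrid_time_domain_0[OF E] hybrid_time_domain_nonneg[OF E]
    by (auto simp: \<tau>_def split: nat.split)
  have hi: "(\<tau> (Suc j), j) \<in> E \<and> (\<forall>s. (s, j) \<in> E \<longrightarrow> s \<le> T \<longrightarrow> s \<le> \<tau> (Suc j))" if "j \<le> J" for j
    using that m[of j] TJ by (cases "j = J") (auto simp: \<tau>_def)
  show thesis
  proof (rule that)
    show "incseq \<tau>"
    proof (rule incseq_SucI)
      fix j show "\<tau> j \<le> \<tau> (Suc j)"
        using lo[of j] hi[of j] by (cases "j \<le> J") (auto simp: \<tau>_def split: nat.split)
    qed
    fix t j assume "j \<le> J" "\<tau> j \<le> t" "t \<le> \<tau> (Suc j)"
    then show "(t, j) \<in> E"
      using hybrid_time_domain_convex[OF E] lo hi by blast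
  qed (use lo hi in \<open>auto simp: \<tau>_def split: nat.split\<close>)
qed

lemma hybrid_time_domain_shift:
  assumes E: "hybrid_time_domain E" and TJ: "(T, J) \<in> E"
  shows "hybrid_time_domain {(t, j). 0 \<le> t \<and> (T + t, J + j) \<in> E}"
  unfolding hybrid_time_domain_iff
  mem_Collect_eq case_prod_conv
proof (intro conjI allI impI)
  fix j s t u assume "0 \<le> s \<and> (T + s, J + j) \<in> E" "0 \<le> u \<and> (T + u, J + j) \<in> E" "s \<le> t" "t \<le> u"
  then show "0 \<le> t" "(T + t, J + j) \<in> E"
    using hybrid_time_domain_convex[OF E, of "T + s" "J + j" "T + u" "T + t"] by auto
next
  fix j t assume *: "0 \<le> t \<and> (T + t, J + Suc j) \<in> E"
  then have t: "0 \<le> t" "(T + t, Suc (J + j)) \<in> E"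
    by auto
  obtain m where m: "(m, J + j) \<in> E" "(m, Suc (J + j)) \<in> E"
    "\<And>s. (s, J + j) \<in> E \<Longrightarrow> s \<le> m" "\<And>s. (s, Suc (J + j)) \<in> E \<Longrightarrow> m \<le> s"
    using hybrid_time_domain_jump[OF E t(2)] by blast
  have "T \<le> m"
    using hybrid_time_domain_order[OF E TJ m(2)] by simp
  then show "\<exists>m. (0 \<le> m \<and> (T + m, J + j) \<in> E) \<and> (0 \<le> m \<and> (T + m, J + Suc j) \<in> E) \<and>
      (\<forall>s. 0 \<le> s \<and> (T + s, J + j) \<in> E \<longrightarrow> s \<le> m) \<and> (\<forall>s. 0 \<le> s \<and> (T + s, J + Suc j) \<in> E \<longrightarrow> m \<le> s)"
    using m by (intro exI[of _ "m - T"]) (auto simp: le_diff_eq diff_le_eq add.commute)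
qed (use TJ hybrid_time_domain_nonneg[OF E] in auto)

text \<open>A jump time of one member stays one for the union: any further point of the union lies
  in a common member with it, where the order of the domain places it on the correct side.\<close>

lemma hybrid_time_domain_Union_chain:
  assumes nonempty: "\<E> \<noteq> {}" and E: "\<And>E. E \<in> \<E> \<Longrightarrow> hybrid_time_domain E"
    and chain: "\<And>E E'. E \<in> \<E> \<Longrightarrow> E' \<in> \<E> \<Longrightarrow> E \<subseteq> E' \<or> E' \<subseteq> E"
  shows "hybrid_time_domain (\<Union>\<E>)"
proof -
  have up: "\<exists>C\<in>\<E>. A \<subseteq> C \<and> B \<subseteq> C" if "A \<in> \<E>" "B \<in> \<E>" for A B
    using chain[OF that] that by blast
  show ?thesis
  unfolding hybrid_time_domain_iff
proof (intro conjI allI impI)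
  show "(0, 0) \<in> \<Union>\<E>"
    using nonempty hybrid_time_domain_0 E by blast
next
  fix t j assume "(t, j) \<in> \<Union>\<E>"
  then show "0 \<le> t"
    using hybrid_time_domain_nonneg E by blast
next
  fix j s t u assume su: "(s, j) \<in> \<Union>\<E>" "(u, j) \<in> \<Union>\<E>" "s \<le> t" "t \<le> u"
  then obtain A B where "A \<in> \<E>" "(s, j) \<in> A" "B \<in> \<E>" "(u, j) \<in> B"
    by blast
  then obtain A where "A \<in> \<E>" "(s, j) \<in> A" "(u, j) \<in> A"
    using up[of A B] by blast
  then show "(t, j) \<in> \<Union>\<E>"
    using hybrid_time_domain_convex[OF E] su(3,4) by blast
next
  fix j t assume "(t, Suc j) \<in> \<Union>\<E>"
  then obtain A where A: "A \<in> \<E>" "(t, Suc j) \<in> A"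
    by blast
  obtain m where m: "(m, j) \<in> A" "(m, Suc j) \<in> A"
    by (rule hybrid_time_domain_jump[OF E[OF A(1)] A(2)])
  have "s \<le> m" if sj: "(s, j) \<in> \<Union>\<E>" for s
  proof -
    obtain B where "B \<in> \<E>" "(s, j) \<in> B"
      using sj by blast
    then obtain B where "B \<in> \<E>" "(s, j) \<in> B" "(m, Suc j) \<in> B"
      using up[OF A(1)] m(2) by blast
    then show ?thesis
      using hybrid_time_domain_order[OF E] by blast
  qed
  moreover have "m \<le> s" if sj: "(s, Suc j) \<in> \<Union>\<E>" for s
  proof -
    obtain B where "B \<in> \<E>" "(s, Suc j) \<in> B"
      using sj by blast
    then obtain B where "B \<in> \<E>" "(s, Suc j) \<in> B" "(m, j) \<in> B"
      using up[OF A(1)] m(1) by blast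
    then show ?thesis
      using hybrid_time_domain_order[OF E] by blast
  qed
  ultimately show "\<exists>m. (m, j) \<in> \<Union>\<E> \<and> (m, Suc j) \<in> \<Union>\<E> \<and>
      (\<forall>s. (s, j) \<in> \<Union>\<E> \<longrightarrow> s \<le> m) \<and> (\<forall>s. (s, Suc j) \<in> \<Union>\<E> \<longrightarrow> m \<le> s)"
    using m A(1) by blast
qed
qed

section \<open>Solutions: shifts and maximal extensions\<close>

lemma AE_lebesgue_iff_negligible: "(AE t in lebesgue. P t) \<longleftrightarrow> negligible {t. \<not> P t}"
proof
  assume "AE t in lebesgue. P t"
  then obtain N where "N \<in> null_sets lebesgue" "{t. \<not> P t} \<subseteq> N"
    unfolding eventually_ae_filter by auto
  then show "negligible {t. \<not> P t}"
    using negligible_iff_null_sets negligible_subset by blast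
next
  assume "negligible {t. \<not> P t}"
  then show "AE t in lebesgue. P t"
    by (intro AE_I') (auto simp: negligible_iff_null_sets)
qed

definition flow_defect :: "'a::euclidean_space hybrid_system \<Rightarrow> real set \<Rightarrow> (real \<Rightarrow> 'a) \<Rightarrow> real set" where
  "flow_defect H S f = {t \<in> S. \<not> (\<exists>v\<in>flow_map H (f t). (f has_vector_derivative v) (at t within S))}"

text \<open>The flow conditions on a single slice, for an arbitrary set of times \<open>S\<close>.
  They can thus be restricted, translated and glued without reference to the hybrid time
  domain.\<close>

definition flow_arc :: "'a::euclidean_space hybrid_system \<Rightarrow> real set \<Rightarrow> (real \<Rightarrow> 'a) \<Rightarrow> bool" where
  "flow_arc H S f \<longleftrightarrow>
     locally_absolutely_continuous_on S f \<and>
     (interior S \<noteq> {} \<longrightarrow>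
        negligible (flow_defect H S f) \<and>
        (\<forall>t\<in>S. (\<exists>s\<in>S. t < s) \<longrightarrow> f t \<in> flow_set H))"

lemma solution_iff_flow_arc:
  "solution H x \<longleftrightarrow>
     hybrid_time_domain (dom x) \<and>
     (\<forall>j. flow_arc H (time_slice x j) (\<lambda>t. the (x (t, j)))) \<and>
     (\<forall>t j. (t, j) \<in> dom x \<longrightarrow> (t, Suc j) \<in> dom x \<longrightarrow>
        the (x (t, j)) \<in> jump_set H \<and> the (x (t, Suc j)) \<in> jump_map H (the (x (t, j))))"
proof -
  have "{t. \<not> (P t \<longrightarrow> Q t)} = {t. P t \<and> \<not> Q t}" for P Q :: "real \<Rightarrow> bool"
    by auto
  then show ?thesis
    unfolding solution_def hybrid_arc_def flow_arc_def flow_defect_def AE_lebesgue_iff_negligible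
    by auto
qed

lemma solution_time_domain: "solution H x \<Longrightarrow> hybrid_time_domain (dom x)"
  and solution_flow_arc: "solution H x \<Longrightarrow> flow_arc H (time_slice x j) (\<lambda>t. the (x (t, j)))"
  and solution_jump: "solution H x \<Longrightarrow> (t, j) \<in> dom x \<Longrightarrow> (t, Suc j) \<in> dom x \<Longrightarrow>
        the (x (t, j)) \<in> jump_set H \<and> the (x (t, Suc j)) \<in> jump_map H (the (x (t, j)))"
  unfolding solution_iff_flow_arc by blast+

lemma solution_start_dom: "solution H x \<Longrightarrow> (0, 0) \<in> dom x"
  by (rule hybrid_time_domain_0[OF solution_time_domain])

text \<open>One comparison for several uses: functions that agree and translations (both with
  \<open>K = 1\<close>), bounded linear images, and Lipschitz functions, which are dominated by the
  identity.\<close>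

lemma absolutely_continuous_dominated:
  assumes f: "absolutely_continuous_on_interval (T + a) (T + b) f" and K: "0 \<le> K"
    and le: "\<And>u v. a \<le> u \<Longrightarrow> u \<le> v \<Longrightarrow> v \<le> b \<Longrightarrow> norm (g v - g u) \<le> K * norm (f (T + v) - f (T + u))"
  shows "absolutely_continuous_on_interval a b g"
  unfolding absolutely_continuous_on_interval_def
proof (intro allI impI)
  fix e :: real assume "0 < e"
  then have "0 < e / (K + 1)"
    using K by simp
  then obtain d where d: "d > 0" "\<And>(m::nat) u v. (\<forall>i<m. T + a \<le> u i \<and> u i \<le> v i \<and> v i \<le> T + b) \<Longrightarrow>
        disjoint_family_on (\<lambda>i. {u i<..<v i}) {..<m} \<Longrightarrow>
        (\<Sum>i<m. v i - u i) < d \<Longrightarrow> (\<Sum>i<m. norm (f (v i) - f (u i))) < e / (K + 1)"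
    using f unfolding absolutely_continuous_on_interval_def by meson
  have "(\<Sum>i<m. norm (g (v i) - g (u i))) < e"
    if uv: "\<forall>i<m. a \<le> u i \<and> u i \<le> v i \<and> v i \<le> b"
      "disjoint_family_on (\<lambda>i. {u i<..<v i}) {..<m}" "(\<Sum>i<m. v i - u i) < d" for m :: nat and u v
  proof -
    let ?S = "\<Sum>i<m. norm (f (T + v i) - f (T + u i))"
    have "{T + p<..<T + q} \<inter> {T + r<..<T + s} = {}" if "{p<..<q} \<inter> {r<..<s} = {}" for p q r s :: real
    proof (rule ccontr)
      assume "{T + p<..<T + q} \<inter> {T + r<..<T + s} \<noteq> {}"
      then obtain z where "z \<in> {T + p<..<T + q} \<inter> {T + r<..<T + s}" by blast
      then have "z - T \<in> {p<..<q} \<inter> {r<..<s}" by auto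
      with that show False by blast
    qed
    then have "disjoint_family_on (\<lambda>i. {T + u i<..<T + v i}) {..<m}"
      using uv(2) unfolding disjoint_family_on_def by blast
    then have S: "?S < e / (K + 1)"
      using d(2)[of m "\<lambda>i. T + u i" "\<lambda>i. T + v i"] uv by simp
    have "(\<Sum>i<m. norm (g (v i) - g (u i))) \<le> (\<Sum>i<m. K * norm (f (T + v i) - f (T + u i)))"
      using uv(1) le by (intro sum_mono) simp
    also have "\<dots> = K * ?S"
      by (simp add: sum_distrib_left)
    also have "\<dots> \<le> (K + 1) * ?S"
      by (intro mult_right_mono sum_nonneg) auto
    also have "\<dots> < e"
      using S K by (simp add: pos_less_divide_eq mult.commute)
    finally show ?thesis .
  qed
  then show "\<exists>d>0. \<forall>(m::nat) u v. (\<forall>i<m. a \<le> u i \<and> u i \<le> v i \<and> v i \<le> b) \<longrightarrow>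
        disjoint_family_on (\<lambda>i. {u i<..<v i}) {..<m} \<longrightarrow>
        (\<Sum>i<m. v i - u i) < d \<longrightarrow> (\<Sum>i<m. norm (g (v i) - g (u i))) < e"
    using d(1) by blast
qed

lemma flow_arc_cong:
  assumes f: "flow_arc H S f" and eq: "\<And>t. t \<in> S \<Longrightarrow> f t = g t"
  shows "flow_arc H S g"
proof -
  have d: "(f has_vector_derivative v) (at t within S) \<longleftrightarrow> (g has_vector_derivative v) (at t within S)" if "t \<in> S" for t v
    using that eq by (metis has_vector_derivative_transform)
  have "flow_defect H S f = flow_defect H S g"
    unfolding flow_defect_def using d eq by (intro Collect_cong) (auto simp: eq)
  moreover have "locally_absolutely_continuous_on S g"
    unfolding locally_absolutely_continuous_on_def
  proof (intro allI impI)
    fix a b assume ab: "{a..b} \<subseteq> S"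
    then have "absolutely_continuous_on_interval a b f"
      using f by (auto simp: flow_arc_def locally_absolutely_continuous_on_def)
    then show "absolutely_continuous_on_interval a b g"
      by (intro absolutely_continuous_dominated[of 0 a b f 1]) (use ab eq in \<open>auto simp: subset_eq\<close>)
  qed
  ultimately show ?thesis
    using f eq unfolding flow_arc_def by auto
qed

lemma flow_arc_subset:
  assumes f: "flow_arc H S f" and sub: "R \<subseteq> S"
  shows "flow_arc H R f"
proof -
  have "locally_absolutely_continuous_on R f"
    using f sub unfolding flow_arc_def locally_absolutely_continuous_on_def by blast
  moreover have "negligible (flow_defect H R f) \<and>
        (\<forall>t\<in>R. (\<exists>s\<in>R. t < s) \<longrightarrow> f t \<in> flow_set H)" if "interior R \<noteq> {}"
  proof
    have int: "interior S \<noteq> {}"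
      using that interior_mono[OF sub] by blast
    show "negligible (flow_defect H R f)"
    proof (rule negligible_subset)
      show "negligible (flow_defect H S f)"
        using f int by (simp add: flow_arc_def)
      show "flow_defect H R f \<subseteq> flow_defect H S f"
        unfolding flow_defect_def using sub has_vector_derivative_within_subset by blast
    qed
    show "\<forall>t\<in>R. (\<exists>s\<in>R. t < s) \<longrightarrow> f t \<in> flow_set H"
      using f int sub unfolding flow_arc_def by blast
  qed
  ultimately show ?thesis
    by (simp add: flow_arc_def)
qed

lemma flow_arc_shift:
  assumes f: "flow_arc H S f"
  shows "flow_arc H {t. T + t \<in> S} (\<lambda>t. f (T + t))"
proof -
  have img: "(+) T ` {t. T + t \<in> S} = S"
  proof (intro set_eqI iffI)
    fix s assume "s \<in> S"
    then show "s \<in> (+) T ` {t. T + t \<in> S}"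
      by (intro image_eqI[of _ _ "s - T"]) auto
  qed auto
  have img': "{t. T + t \<in> A} = (+) (- T) ` A" for A
  proof (intro set_eqI iffI)
    fix s assume "s \<in> {t. T + t \<in> A}"
    then show "s \<in> (+) (- T) ` A"
      by (intro image_eqI[of _ _ "T + s"]) auto
  qed auto
  have "locally_absolutely_continuous_on {t. T + t \<in> S} (\<lambda>t. f (T + t))"
    unfolding locally_absolutely_continuous_on_def
  proof (intro allI impI)
    fix a b assume ab: "{a..b} \<subseteq> {t. T + t \<in> S}"
    have "{T + a..T + b} \<subseteq> S"
    proof
      fix s assume "s \<in> {T + a..T + b}"
      then have "s - T \<in> {a..b}" by auto
      then show "s \<in> S" using ab by force
    qed
    then have "absolutely_continuous_on_interval (T + a) (T + b) f"
      using f by (auto simp: flow_arc_def locally_absolutely_continuous_on_def)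
    then show "absolutely_continuous_on_interval a b (\<lambda>t. f (T + t))"
      by (rule absolutely_continuous_dominated[where K = 1]) auto
  qed
  moreover have "negligible (flow_defect H {t. T + t \<in> S} (\<lambda>t. f (T + t))) \<and>
        (\<forall>t\<in>{t. T + t \<in> S}. (\<exists>s\<in>{t. T + t \<in> S}. t < s) \<longrightarrow> f (T + t) \<in> flow_set H)"
    if "interior {t. T + t \<in> S} \<noteq> {}"
  proof
    have int: "interior S \<noteq> {}"
      using that unfolding img' interior_translation by blast
    have d: "((\<lambda>t. f (T + t)) has_vector_derivative v) (at t within {t. T + t \<in> S})"
      if "(f has_vector_derivative v) (at (T + t) within S)" for t v
    proof -
      have "((+) T has_vector_derivative 1) (at t within {t. T + t \<in> S})"
        by (auto intro!: derivative_eq_intros)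
      moreover have "(f has_vector_derivative v) (at (T + t) within (+) T ` {t. T + t \<in> S})"
        using that unfolding img .
      ultimately have "(f \<circ> (+) T has_vector_derivative 1 *\<^sub>R v) (at t within {t. T + t \<in> S})"
        by (rule vector_diff_chain_within)
      then show ?thesis by (simp add: o_def)
    qed
    show "negligible (flow_defect H {t. T + t \<in> S} (\<lambda>t. f (T + t)))"
    proof (rule negligible_subset)
      show "negligible ((+) (- T) ` flow_defect H S f)"
        using f int by (intro negligible_translation) (simp add: flow_arc_def)
      show "flow_defect H {t. T + t \<in> S} (\<lambda>t. f (T + t)) \<subseteq> (+) (- T) ` flow_defect H S f"
        unfolding img'[symmetric] flow_defect_def using d by blast
    qed
    show "\<forall>t\<in>{t. T + t \<in> S}. (\<exists>s\<in>{t. T + t \<in> S}. t < s) \<longrightarrow> f (T + t) \<in> flow_set H"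
      using f int unfolding flow_arc_def by (auto intro: add_strict_left_mono)
  qed
  ultimately show ?thesis
    by (simp add: flow_arc_def)
qed

text \<open>The chain may be uncountable, so the null sets of its members cannot simply be united.
  An interval with rational end points in the union lies in one member; these countably many
  intervals capture the defect at all interior times, and the frontier of a convex set is
  null.\<close>

lemma flow_arc_Union_chain:
  assumes f: "\<And>S. S \<in> \<S> \<Longrightarrow> flow_arc H S f" and conv: "\<And>S. S \<in> \<S> \<Longrightarrow> convex S"
    and chain: "\<And>S S'. S \<in> \<S> \<Longrightarrow> S' \<in> \<S> \<Longrightarrow> S \<subseteq> S' \<or> S' \<subseteq> S"
  shows "flow_arc H (\<Union>\<S>) f"
proof -
  let ?U = "\<Union>\<S>"
  have Icc: "\<exists>S\<in>\<S>. {a..b} \<subseteq> S" if ab: "a \<in> ?U" "b \<in> ?U" for a b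
  proof -
    obtain A B where "a \<in> A" "A \<in> \<S>" "b \<in> B" "B \<in> \<S>"
      using ab by blast
    then obtain S where S: "S \<in> \<S>" "a \<in> S" "b \<in> S"
      using chain[of A B] by blast
    then have "is_interval S"
      using conv is_interval_convex_1 by blast
    then have "{a..b} \<subseteq> S"
      using mem_is_interval_1_I[OF _ S(2,3)] by auto
    with S show ?thesis by blast
  qed
  have "convex ?U"
    unfolding is_interval_convex_1[symmetric] is_interval_1
  proof (intro ballI allI impI)
    fix a b x assume "a \<in> ?U" "b \<in> ?U" "a \<le> x \<and> x \<le> b"
    then show "x \<in> ?U" using Icc[of a b] by fastforce
  qed
  have "locally_absolutely_continuous_on ?U f"
    unfolding locally_absolutely_continuous_on_def
  proof (intro allI impI)
    fix a b assume ab: "{a..b} \<subseteq> ?U"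
    show "absolutely_continuous_on_interval a b f"
    proof (cases "a \<le> b")
      case True
      then have "a \<in> {a..b}" "b \<in> {a..b}"
        by auto
      then have "a \<in> ?U" "b \<in> ?U"
        using ab by blast+
      then obtain S where "S \<in> \<S>" "{a..b} \<subseteq> S"
        using Icc by blast
      then show ?thesis
        using f[of S] by (auto simp: flow_arc_def locally_absolutely_continuous_on_def)
    next
      case False
      \<comment> \<open>An empty interval admits only the empty family, for which absolute
        continuity is trivial.\<close>
      have "m = 0" if "\<forall>i<m. a \<le> u i \<and> u i \<le> v i \<and> v i \<le> b" for m :: nat and u v
        using that False by (cases m) force+
      then show ?thesis
        unfolding absolutely_continuous_on_interval_def
        by (metis (no_types, lifting) lessThan_0 sum.empty zero_less_one)
    qed
  qed
  moreover have "negligible (flow_defect H ?U f)"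
  proof -
    let ?exc = "\<lambda>S. flow_defect H S f"
    define Q where "Q = {(p, q). p \<in> \<rat> \<and> q \<in> \<rat> \<and> p < q \<and> p \<in> ?U \<and> q \<in> ?U}"
    have "Q \<subseteq> \<rat> \<times> \<rat>"
      by (auto simp: Q_def)
    then have "countable Q"
      using countable_rat countable_SIGMA countable_subset by metis
    define N where "N = (\<lambda>(p, q). ?exc {p..q}) ` Q"
    have "negligible (\<Union>N)"
    proof (rule negligible_countable_Union)
      show "countable N"
        unfolding N_def using \<open>countable Q\<close> by simp
      fix S assume "S \<in> N"
      then obtain p q where pq: "S = ?exc {p..q}" "p < q" "p \<in> ?U" "q \<in> ?U"
        by (auto simp: N_def Q_def)
      then obtain A where "A \<in> \<S>" "{p..q} \<subseteq> A"
        using Icc by blast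
      then have "flow_arc H {p..q} f"
        using f flow_arc_subset by blast
      then show "negligible S"
        using pq by (simp add: flow_arc_def)
    qed
    moreover have "negligible (frontier ?U)"
      using \<open>convex ?U\<close> by (rule negligible_convex_frontier)
    ultimately have "negligible (frontier ?U \<union> \<Union>N)"
      by (intro negligible_Un)
    moreover have "?exc ?U \<subseteq> frontier ?U \<union> \<Union>N"
    proof
      fix t assume t: "t \<in> ?exc ?U"
      show "t \<in> frontier ?U \<union> \<Union>N"
      proof (cases "t \<in> interior ?U")
        case True
        then obtain e where e: "e > 0" "ball t e \<subseteq> ?U"
          by (auto simp: mem_interior)
        obtain p q where pq: "p \<in> \<rat>" "t - e < p" "p < t" "q \<in> \<rat>" "t < q" "q < t + e"
          using Rats_dense_in_real[of "t - e" t] Rats_dense_in_real[of t "t + e"] e(1) by auto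
        then have "p \<in> ball t e" "q \<in> ball t e"
          by (auto simp: dist_real_def)
        then have "(p, q) \<in> Q"
          using pq e by (auto simp: Q_def)
        moreover have "at t within {p..q} = at t within ?U"
        proof -
          have "t \<in> interior {p..q}"
            using pq by simp
          then show ?thesis
            using at_within_interior[OF True] at_within_interior[of t "{p..q}"] by metis
        qed
        ultimately have "t \<in> ?exc {p..q}"
          using t pq by (auto simp: flow_defect_def)
        then show ?thesis
          unfolding N_def using \<open>(p, q) \<in> Q\<close> by blast
      next
        case False
        then show ?thesis
          using t closure_subset[of ?U] by (auto simp: frontier_def flow_defect_def)
      qed
    qed
    ultimately show ?thesis
      by (rule negligible_subset)
  qed
  moreover have "f t \<in> flow_set H" if ts: "t \<in> ?U" "s \<in> ?U" "t < s" for t s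
  proof -
    obtain A where "A \<in> \<S>" "{t..s} \<subseteq> A"
      using ts Icc by blast
    then have "flow_arc H {t..s} f"
      using f flow_arc_subset by blast
    then show ?thesis
      using ts(3) unfolding flow_arc_def by force
  qed
  ultimately show ?thesis
    unfolding flow_arc_def by blast
qed

section \<open>Tails of solutions, unions of chains and maximal extensions\<close>

definition shift_arc :: "real \<Rightarrow> nat \<Rightarrow> 'a arc \<Rightarrow> 'a arc" where
  "shift_arc T J x = (\<lambda>(t, j). if 0 \<le> t then x (T + t, J + j) else None)"

lemma dom_shift_arc: "dom (shift_arc T J x) = {(t, j). 0 \<le> t \<and> (T + t, J + j) \<in> dom x}"
  by (auto simp: shift_arc_def split: if_splits)

lemma shift_arc_eq: "0 \<le> t \<Longrightarrow> shift_arc T J x (t, j) = x (T + t, J + j)"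
  by (simp add: shift_arc_def)

lemma solution_shift:
  assumes x: "solution H x" and TJ: "(T, J) \<in> dom x"
  shows "solution H (shift_arc T J x)"
  unfolding solution_iff_flow_arc
proof (intro conjI allI impI)
  show "hybrid_time_domain (dom (shift_arc T J x))"
    unfolding dom_shift_arc by (rule hybrid_time_domain_shift[OF solution_time_domain[OF x] TJ])
  fix j
  have "flow_arc H {t. T + t \<in> time_slice x (J + j)} (\<lambda>t. the (x (T + t, J + j)))"
    by (rule flow_arc_shift[OF solution_flow_arc[OF x]])
  then have "flow_arc H (time_slice (shift_arc T J x) j) (\<lambda>t. the (x (T + t, J + j)))"
    by (rule flow_arc_subset) (auto simp: time_slice_def dom_shift_arc)
  then show "flow_arc H (time_slice (shift_arc T J x) j) (\<lambda>t. the (shift_arc T J x (t, j)))"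
    by (rule flow_arc_cong) (auto simp: time_slice_def shift_arc_def split: if_splits)
next
  fix t j assume "(t, j) \<in> dom (shift_arc T J x)" "(t, Suc j) \<in> dom (shift_arc T J x)"
  then have *: "0 \<le> t" "(T + t, J + j) \<in> dom x" "(T + t, Suc (J + j)) \<in> dom x"
    unfolding dom_shift_arc by simp_all
  then show "the (shift_arc T J x (t, j)) \<in> jump_set H"
    "the (shift_arc T J x (t, Suc j)) \<in> jump_map H (the (shift_arc T J x (t, j)))"
    using solution_jump[OF x *(2,3)] by (simp_all add: shift_arc_eq)
qed

lemma convex_time_slice:
  assumes "hybrid_time_domain (dom x)"
  shows "convex (time_slice x j)"
  unfolding is_interval_convex_1[symmetric] is_interval_1 time_slice_def
  using hybrid_time_domain_convex[OF assms] by blast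

lemma solution_Union_chain:
  assumes nonempty: "\<C> \<noteq> {}" and sol: "\<And>x. x \<in> \<C> \<Longrightarrow> solution H x"
    and chain: "\<And>x y. x \<in> \<C> \<Longrightarrow> y \<in> \<C> \<Longrightarrow> x \<subseteq>\<^sub>m y \<or> y \<subseteq>\<^sub>m x"
  obtains y where "solution H y" "\<And>x. x \<in> \<C> \<Longrightarrow> x \<subseteq>\<^sub>m y"
proof -
  define y where "y p = (if \<exists>x\<in>\<C>. p \<in> dom x then (SOME x. x \<in> \<C> \<and> p \<in> dom x) p else None)" for p
  have y_eq: "y p = x p" if "x \<in> \<C>" "p \<in> dom x" for x p
  proof -
    have "\<exists>x. x \<in> \<C> \<and> p \<in> dom x"
      using that by blast
    from someI_ex[OF this] have *: "(SOME x. x \<in> \<C> \<and> p \<in> dom x) \<in> \<C>" "p \<in> dom (SOME x. x \<in> \<C> \<and> p \<in> dom x)"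
      by blast+
    have "(SOME x. x \<in> \<C> \<and> p \<in> dom x) p = x p"
      using chain[OF *(1) that(1)]
    proof
      assume "(SOME x. x \<in> \<C> \<and> p \<in> dom x) \<subseteq>\<^sub>m x"
      then show ?thesis
        using *(2) unfolding map_le_def by (rule bspec)
    next
      assume "x \<subseteq>\<^sub>m (SOME x. x \<in> \<C> \<and> p \<in> dom x)"
      then show ?thesis
        using that(2) unfolding map_le_def by simp
    qed
    then show ?thesis
      using that unfolding y_def by auto
  qed
  have dom_y: "dom y = \<Union>(dom ` \<C>)"
  proof (intro set_eqI iffI)
    fix p assume "p \<in> \<Union>(dom ` \<C>)"
    then obtain x where "x \<in> \<C>" "p \<in> dom x" by blast
    then show "p \<in> dom y" using y_eq[of x p] by (simp add: dom_def)
  next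
    fix p assume "p \<in> dom y"
    then have "y p \<noteq> None" by auto
    then show "p \<in> \<Union>(dom ` \<C>)"
      unfolding y_def by (meson UN_I)
  qed
  have dom_chain: "dom x \<subseteq> dom z \<or> dom z \<subseteq> dom x" if "x \<in> \<C>" "z \<in> \<C>" for x z
    using chain[OF that] map_le_implies_dom_le by blast
  have slice: "time_slice y j = \<Union>((\<lambda>x. time_slice x j) ` \<C>)" for j
    unfolding time_slice_def dom_y by auto
  have "solution H y"
    unfolding solution_iff_flow_arc
  proof (intro conjI allI impI)
    show "hybrid_time_domain (dom y)"
      unfolding dom_y
    proof (rule hybrid_time_domain_Union_chain)
      fix A B assume "A \<in> dom ` \<C>" "B \<in> dom ` \<C>"
      then show "A \<subseteq> B \<or> B \<subseteq> A"
        using dom_chain by blast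
    qed (use nonempty sol solution_time_domain in blast)+
    fix j show "flow_arc H (time_slice y j) (\<lambda>t. the (y (t, j)))"
      unfolding slice
    proof (rule flow_arc_Union_chain)
      fix S assume "S \<in> (\<lambda>x. time_slice x j) ` \<C>"
      then obtain x where x: "x \<in> \<C>" "S = time_slice x j" by blast
      show "flow_arc H S (\<lambda>t. the (y (t, j)))"
        using solution_flow_arc[OF sol[OF x(1)], of j] unfolding x(2)
        by (rule flow_arc_cong) (use y_eq[OF x(1)] in \<open>auto simp: time_slice_def\<close>)
      show "convex S"
        unfolding x(2) by (rule convex_time_slice[OF solution_time_domain[OF sol[OF x(1)]]])
      fix S' assume "S' \<in> (\<lambda>x. time_slice x j) ` \<C>"
      then obtain z where z: "z \<in> \<C>" "S' = time_slice z j" by blast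
      show "S \<subseteq> S' \<or> S' \<subseteq> S"
        unfolding x(2) z(2) time_slice_def using dom_chain[OF x(1) z(1)] by blast
    qed
  next
    fix t j assume t: "(t, j) \<in> dom y" "(t, Suc j) \<in> dom y"
    then obtain x z where "x \<in> \<C>" "(t, j) \<in> dom x" "z \<in> \<C>" "(t, Suc j) \<in> dom z"
      unfolding dom_y by blast
    then obtain x where x: "x \<in> \<C>" "(t, j) \<in> dom x" "(t, Suc j) \<in> dom x"
      using dom_chain[of x z] by blast
    show "the (y (t, j)) \<in> jump_set H" "the (y (t, Suc j)) \<in> jump_map H (the (y (t, j)))"
      using solution_jump[OF sol[OF x(1)] x(2,3)] y_eq[OF x(1)] x(2,3) by simp_all
  qed
  moreover have "x \<subseteq>\<^sub>m y" if "x \<in> \<C>" for x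
    unfolding map_le_def using y_eq[OF that] by simp
  ultimately show thesis
    using that by blast
qed

text \<open>Stability and attraction quantify over maximal solutions only, whereas projections,
  tails and limits need not be maximal. Zorn's lemma for \<open>\<subseteq>\<^sub>m\<close> lets
  properties of maximal solutions descend to them.\<close>

theorem maximal_extension_exists:
  assumes x: "solution H x"
  obtains y where "maximal_solution H y" "x \<subseteq>\<^sub>m y"
proof -
  define A where "A = {y. solution H y \<and> x \<subseteq>\<^sub>m y}"
  have "\<exists>m\<in>A. \<forall>a\<in>A. m \<subseteq>\<^sub>m a \<longrightarrow> a = m"
  proof (rule predicate_Zorn)
    show "partial_order_on A (relation_of (\<subseteq>\<^sub>m) A)"
      by (rule partial_order_on_relation_ofI) (auto intro: map_le_trans map_le_antisym)
    fix \<C> assume C: "\<C> \<in> Chains (relation_of (\<subseteq>\<^sub>m) A)"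
    then have CA: "\<C> \<subseteq> A"
      by (rule Chains_relation_of)
    have chain: "y \<subseteq>\<^sub>m z \<or> z \<subseteq>\<^sub>m y" if "y \<in> \<C>" "z \<in> \<C>" for y z
      using C that by (auto simp: Chains_def relation_of_def)
    show "\<exists>u\<in>A. \<forall>a\<in>\<C>. a \<subseteq>\<^sub>m u"
    proof (cases "\<C> = {}")
      case True
      then show ?thesis using x by (auto simp: A_def)
    next
      case False
      obtain y where y: "solution H y" "\<And>x. x \<in> \<C> \<Longrightarrow> x \<subseteq>\<^sub>m y"
        using solution_Union_chain[OF False _ chain, of H] CA unfolding A_def by blast
      obtain z where "z \<in> \<C>" using False by blast
      then have "x \<subseteq>\<^sub>m y"
        using y(2) CA map_le_trans unfolding A_def by blast
      then show ?thesis using y by (auto simp: A_def)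
    qed
  qed
  then obtain y where "y \<in> A" "\<And>a. a \<in> A \<Longrightarrow> y \<subseteq>\<^sub>m a \<Longrightarrow> a = y"
    by blast
  then show thesis
    using map_le_trans unfolding A_def by (intro that[of y]) (auto simp: maximal_solution_def)
qed

section \<open>Limits of flows\<close>

lemma locally_bounded_on_compact:
  assumes lb: "locally_bounded_on S M" and S: "closed S" and K: "compact K"
  shows "bounded (\<Union>x\<in>K \<inter> S. M x)"
proof -
  have "\<exists>r>0. bounded (\<Union>y\<in>ball x r \<inter> S. M y)" if "x \<in> K \<inter> S" for x
    using lb that unfolding locally_bounded_on_def by blast
  then obtain r where r: "\<And>x. x \<in> K \<inter> S \<Longrightarrow> r x > 0"
    "\<And>x. x \<in> K \<inter> S \<Longrightarrow> bounded (\<Union>y\<in>ball x (r x) \<inter> S. M y)"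
    by metis
  have "compact (K \<inter> S)"
    using K S by (rule compact_Int_closed)
  then obtain C where C: "C \<subseteq> K \<inter> S" "finite C" "K \<inter> S \<subseteq> (\<Union>x\<in>C. ball x (r x))"
  proof (rule compactE_image[of _ "K \<inter> S" "\<lambda>x. ball x (r x)"])
    show "K \<inter> S \<subseteq> (\<Union>x\<in>K \<inter> S. ball x (r x))"
      using r(1) by force
  qed auto
  have "bounded (\<Union>x\<in>C. \<Union>y\<in>ball x (r x) \<inter> S. M y)"
    using C(1,2) r(2) by (intro bounded_UN) auto
  then show ?thesis
    by (rule bounded_subset) (use C(3) in blast)
qed

lemma lipschitz_imp_absolutely_continuous:
  fixes f :: "real \<Rightarrow> 'a::real_normed_vector"
  assumes lip: "\<And>s t. norm (f t - f s) \<le> M * \<bar>t - s\<bar>"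
  shows "absolutely_continuous_on_interval a b f"
proof (rule absolutely_continuous_dominated[where T = 0 and f = "\<lambda>t. t" and K = M])
  show "absolutely_continuous_on_interval (0 + a) (0 + b) (\<lambda>t. t)"
    unfolding absolutely_continuous_on_interval_def
  proof (intro allI impI)
    fix e :: real assume "0 < e"
    have "(\<Sum>i<m. norm (v i - u i)) = (\<Sum>i<m. v i - u i)"
      if "\<forall>i<m. 0 + a \<le> u i \<and> u i \<le> v i \<and> v i \<le> 0 + b" for m :: nat and u v :: "nat \<Rightarrow> real"
      using that by (intro sum.cong) auto
    then show "\<exists>d>0. \<forall>(m::nat) u v. (\<forall>i<m. 0 + a \<le> u i \<and> u i \<le> v i \<and> v i \<le> 0 + b) \<longrightarrow>
        disjoint_family_on (\<lambda>i. {u i<..<v i}) {..<m} \<longrightarrow>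
        (\<Sum>i<m. v i - u i) < d \<longrightarrow> (\<Sum>i<m. norm (v i - u i)) < e"
      using \<open>0 < e\<close> by (intro exI[of _ e]) simp
  qed
  show "0 \<le> M"
    using order_trans[OF norm_ge_zero lip[of 1 0]] by simp
  fix u v :: real assume "u \<le> v"
  then show "norm (f v - f u) \<le> M * norm (0 + v - (0 + u))"
    using lip[of v u] by simp
qed

lemma flow_arc_increment_le:
  assumes f: "flow_arc H {s..t} f" and st: "s < t"
    and bound: "\<And>r v. r \<in> {s..t} \<Longrightarrow> f r \<in> flow_set H \<Longrightarrow> v \<in> flow_map H (f r) \<Longrightarrow> p \<bullet> v \<le> c"
  shows "p \<bullet> (f t - f s) \<le> c * (t - s)"
proof -
  let ?N = "flow_defect H {s..t} f"
  have "interior {s..t} \<noteq> {}"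
    using st by simp
  then have N: "negligible ?N" and C: "\<And>r. r \<in> {s..t} \<Longrightarrow> r < t \<Longrightarrow> f r \<in> flow_set H"
    using f st unfolding flow_arc_def by force+
  show ?thesis
  proof (rule absolutely_continuous_increment_le)
    show "absolutely_continuous_on_interval s t f"
      using f by (simp add: flow_arc_def locally_absolutely_continuous_on_def)
    \<comment> \<open>The final time joins the exceptional set because the state need not lie in the
      flow set there.\<close>
    show "negligible (?N \<union> {t})"
      using N by (intro negligible_Un) auto
    fix r assume r: "r \<in> {s..t} - (?N \<union> {t})"
    then obtain v where "v \<in> flow_map H (f r)" "(f has_vector_derivative v) (at r within {s..t})"
      unfolding flow_defect_def by blast
    moreover have "f r \<in> flow_set H"
      using C[of r] r by auto
    ultimately show "\<exists>v. (f has_vector_derivative v) (at r within {s..t}) \<and> p \<bullet> v \<le> c"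
      using bound r by blast
  qed (use st in auto)
qed

text \<open>Testing the increment with \<open>p = f t - f s\<close> gives
  \<open>norm p * norm p \<le> norm p * (M * (t - s))\<close>, so a bound on the velocities bounds
  the increment itself.\<close>

lemma flow_arc_lipschitz:
  assumes f: "flow_arc H S f" and ab: "{a..b} \<subseteq> S" and M: "0 \<le> M"
    and bound: "\<And>r v. r \<in> {a..b} \<Longrightarrow> f r \<in> flow_set H \<Longrightarrow> v \<in> flow_map H (f r) \<Longrightarrow> norm v \<le> M"
    and st: "s \<in> {a..b}" "t \<in> {a..b}"
  shows "norm (f t - f s) \<le> M * \<bar>t - s\<bar>"
proof -
  have *: "norm (f t - f s) \<le> M * (t - s)" if st: "s \<in> {a..b}" "t \<in> {a..b}" "s < t" for s t
  proof (cases "f t = f s")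
    case False
    let ?p = "f t - f s"
    have "?p \<bullet> (f t - f s) \<le> (norm ?p * M) * (t - s)"
    proof (rule flow_arc_increment_le[OF _ st(3)])
      show "flow_arc H {s..t} f"
        using f by (rule flow_arc_subset) (use ab st in auto)
      fix r v assume r: "r \<in> {s..t}" "f r \<in> flow_set H" "v \<in> flow_map H (f r)"
      have "?p \<bullet> v \<le> norm ?p * norm v"
        by (rule norm_cauchy_schwarz)
      also have "\<dots> \<le> norm ?p * M"
        using bound[OF _ r(2,3)] r(1) st by (intro mult_left_mono) auto
      finally show "?p \<bullet> v \<le> norm ?p * M" .
    qed
    then have "norm ?p * norm ?p \<le> norm ?p * (M * (t - s))"
      by (simp add: dot_square_norm power2_eq_square algebra_simps)
    then show ?thesis
      using False by (subst (asm) mult_le_cancel_left_pos) auto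
  qed (use M st in auto)
  show ?thesis
    using *[OF st] *[OF st(2,1)] by (cases s t rule: linorder_cases) (auto simp: norm_minus_commute)
qed

text \<open>Upper semicontinuity tested on one open half-space. Values outside it at points of
  \<open>S\<close> tending to \<open>x\<close> would be bounded, and outer semicontinuity would put
  a cluster point of them into \<open>M x\<close>; if \<open>x\<close> is off the closed set
  \<open>S\<close>, the claim is vacuous near \<open>x\<close>.\<close>

lemma outer_semicontinuous_halfspace:
  fixes M :: "'a::metric_space \<Rightarrow> 'b::euclidean_space set"
  assumes osc: "outer_semicontinuous M" and lb: "locally_bounded_on S M" and S: "closed S"
    and half: "\<And>w. w \<in> M x \<Longrightarrow> p \<bullet> w < c"
  obtains r where "r > 0" "\<And>y w. y \<in> S \<Longrightarrow> dist x y < r \<Longrightarrow> w \<in> M y \<Longrightarrow> p \<bullet> w < c"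
proof (cases "x \<in> S")
  case False
  then obtain r where "r > 0" "ball x r \<subseteq> - S"
    using S open_contains_ball[of "- S"] by (auto simp: closed_def)
  then show thesis
    using that[of r] by (auto simp: subset_eq)
next
  case True
  then obtain r where r: "r > 0" "bounded (\<Union>y\<in>ball x r \<inter> S. M y)"
    using lb unfolding locally_bounded_on_def by blast
  show thesis
  proof (rule ccontr)
    assume no: "\<not> thesis"
    have "\<exists>y w. y \<in> S \<and> dist x y < min r (inverse (real (Suc n))) \<and> w \<in> M y \<and> c \<le> p \<bullet> w" for n
    proof (rule ccontr)
      assume *: "\<not> ?thesis"
      have "thesis"
      proof (rule that)
        show "0 < min r (inverse (real (Suc n)))"
          using r(1) by simp
      qed (use * not_le in blast)
      then show False using no by blast
    qed
    then obtain Y W where YW: "\<And>n. Y n \<in> S" "\<And>n. dist x (Y n) < min r (inverse (real (Suc n)))"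
      "\<And>n. W n \<in> M (Y n)" "\<And>n. c \<le> p \<bullet> W n"
      by metis
    have "(\<lambda>n. dist (Y n) x) \<longlonglongrightarrow> 0"
    proof (rule tendsto_sandwich[OF _ _ tendsto_const LIMSEQ_inverse_real_of_nat])
      have "dist (Y n) x \<le> inverse (real (Suc n))" for n
        using YW(2)[of n] by (simp add: dist_commute)
      then show "eventually (\<lambda>n. dist (Y n) x \<le> inverse (real (Suc n))) sequentially"
        by simp
    qed simp
    then have Y: "Y \<longlonglongrightarrow> x"
      by (rule tendsto_dist_iff[THEN iffD2])
    have "bounded (range W)"
      using r(2) by (rule bounded_subset) (use YW in force)
    then obtain w k where k: "strict_mono k" "(W \<circ> k) \<longlonglongrightarrow> w"
      using bounded_imp_convergent_subsequence by blast
    have "w \<in> M x"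
      using osc k(2) LIMSEQ_subseq_LIMSEQ[OF Y k(1)] YW(3) unfolding outer_semicontinuous_def
      by (metis comp_apply)
    moreover have "c \<le> p \<bullet> w"
    proof (rule LIMSEQ_le_const)
      show "(\<lambda>n. p \<bullet> (W \<circ> k) n) \<longlonglongrightarrow> p \<bullet> w"
        by (intro tendsto_intros k(2))
    qed (use YW(4) in auto)
    ultimately show False
      using half by fastforce
  qed
qed

lemma outer_semicontinuous_closed_value:
  assumes "outer_semicontinuous M"
  shows "closed (M x)"
  unfolding closed_sequential_limits
proof (intro allI impI)
  fix X l assume "(\<forall>n. X n \<in> M x) \<and> X \<longlonglongrightarrow> l"
  then show "l \<in> M x"
    using assms tendsto_const[of x sequentially] unfolding outer_semicontinuous_def by blast
qed

text \<open>A velocity \<open>v\<close> outside the closed convex set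
  \<open>flow_map H (g t)\<close> is separated from it by a half-space. For large \<open>n\<close>
  that half-space contains the velocities of \<open>f n\<close> shortly after \<open>t\<close>, so
  its inequality holds for the increments of \<open>f n\<close>, then for those of \<open>g\<close>,
  and finally for \<open>v\<close>.\<close>

lemma limit_flow_derivative:
  fixes f :: "nat \<Rightarrow> real \<Rightarrow> 'a::euclidean_space"
  assumes BA: "basic_assumptions H" and e: "e > 0"
    and flow: "eventually (\<lambda>n. flow_arc H {t..t+e} (f n)) sequentially"
    and lip: "\<And>n s r. norm (f n s - f n r) \<le> M * \<bar>s - r\<bar>"
    and lim: "\<And>s. (\<lambda>n. f n s) \<longlonglongrightarrow> g s"
    and gC: "g t \<in> flow_set H"
    and deriv: "(g has_vector_derivative v) (at t)"
  shows "v \<in> flow_map H (g t)"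
proof (rule ccontr)
  assume v: "v \<notin> flow_map H (g t)"
  have osc: "outer_semicontinuous (flow_map H)" and lb: "locally_bounded_on (flow_set H) (flow_map H)"
    and C: "closed (flow_set H)" and cv: "convex (flow_map H (g t))"
    using BA gC by (auto simp: basic_assumptions_def)
  obtain p c where "p \<bullet> v < c" "\<And>w. w \<in> flow_map H (g t) \<Longrightarrow> c < p \<bullet> w"
    using separating_hyperplane_closed_point[OF cv outer_semicontinuous_closed_value[OF osc] v] by blast
  then have sep: "- c < (- p) \<bullet> v" "\<And>w. w \<in> flow_map H (g t) \<Longrightarrow> (- p) \<bullet> w < - c"
    by auto
  obtain r where r: "r > 0" "\<And>y w. y \<in> flow_set H \<Longrightarrow> dist (g t) y < r \<Longrightarrow> w \<in> flow_map H y \<Longrightarrow> (- p) \<bullet> w < - c"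
    using outer_semicontinuous_halfspace[OF osc lb C sep(2)] by blast
  have M: "0 \<le> M"
    using order_trans[OF norm_ge_zero lip[of 0 1 0]] by simp
  \<comment> \<open>Over time \<open>d\<close> the Lipschitz bound moves the state by less than
    \<open>r / 2\<close>; the other half of \<open>r\<close> absorbs the distance of
    \<open>f n t\<close> from \<open>g t\<close>. Using \<open>M + 1\<close> keeps the quotient
    meaningful when \<open>M = 0\<close>.\<close>
  define d where "d = min e (r / (2 * (M + 1)))"
  have d: "d > 0" "d \<le> e" "M * d < r / 2"
  proof -
    show "d > 0" "d \<le> e"
      using e r(1) M by (auto simp: d_def)
    have "M * d \<le> M * (r / (2 * (M + 1)))"
      using M by (intro mult_left_mono) (auto simp: d_def)
    also have "\<dots> < r / 2"
      using M r(1) by (simp add: field_simps)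
    finally show "M * d < r / 2" .
  qed
  have near: "eventually (\<lambda>n. dist (g t) (f n t) < r / 2) sequentially"
    using tendstoD[OF lim[of t], of "r / 2"] r(1) by (simp add: dist_commute)
  have ineq: "(- p) \<bullet> (g (t + h) - g t) \<le> (- c) * h" if h: "0 < h" "h \<le> d" for h
  proof (rule tendsto_upperbound)
    show "(\<lambda>n. (- p) \<bullet> (f n (t + h) - f n t)) \<longlonglongrightarrow> (- p) \<bullet> (g (t + h) - g t)"
      by (intro tendsto_intros lim)
    show "eventually (\<lambda>n. (- p) \<bullet> (f n (t + h) - f n t) \<le> (- c) * h) sequentially"
      using flow near
    proof eventually_elim
      case (elim n)
      have "(- p) \<bullet> (f n (t + h) - f n t) \<le> (- c) * (t + h - t)"
      proof (rule flow_arc_increment_le)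
        show "flow_arc H {t..t+h} (f n)"
          using elim(1) by (rule flow_arc_subset) (use h d in auto)
        fix s w assume s: "s \<in> {t..t+h}" "f n s \<in> flow_set H" "w \<in> flow_map H (f n s)"
        have "norm (f n s - f n t) \<le> M * \<bar>s - t\<bar>"
          by (rule lip)
        also have "\<dots> \<le> M * d"
          using s(1) h M by (intro mult_left_mono) auto
        finally have "dist (f n t) (f n s) < r / 2"
          using d(3) by (simp add: dist_norm norm_minus_commute)
        then have "dist (g t) (f n s) < r"
          using elim(2) dist_triangle_half_r[of "f n t" "g t" r "f n s"] by (simp add: dist_commute)
        then show "(- p) \<bullet> w \<le> - c"
          using r(2)[OF s(2) _ s(3)] by simp
      qed (use h in auto)
      then show ?case by simp
    qed
  qed simp
  have "(- p) \<bullet> v \<le> - c"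
  proof (rule tendsto_upperbound)
    have "((\<lambda>s. (- p) \<bullet> g s) has_real_derivative (- p) \<bullet> v) (at t)"
      unfolding has_real_derivative_iff_has_vector_derivative
      using deriv by (rule bounded_linear.has_vector_derivative[OF bounded_linear_inner_right])
    then have "((\<lambda>h. ((- p) \<bullet> g (t + h) - (- p) \<bullet> g t) / h) \<longlongrightarrow> (- p) \<bullet> v) (at 0)"
      by (simp add: DERIV_def)
    then show "((\<lambda>h. ((- p) \<bullet> g (t + h) - (- p) \<bullet> g t) / h) \<longlongrightarrow> (- p) \<bullet> v) (at_right 0)"
      by (rule filterlim_mono) (auto simp: at_le)
    show "eventually (\<lambda>h. ((- p) \<bullet> g (t + h) - (- p) \<bullet> g t) / h \<le> - c) (at_right 0)"
      unfolding eventually_at_right_field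
    proof (intro exI[of _ d] conjI allI impI d(1))
      fix h assume h: "0 < h" "h < d"
      have "((- p) \<bullet> g (t + h) - (- p) \<bullet> g t) / h \<le> ((- c) * h) / h"
        using ineq[of h] h by (intro divide_right_mono) (auto simp: inner_diff_right)
      then show "((- p) \<bullet> g (t + h) - (- p) \<bullet> g t) / h \<le> - c"
        using h by simp
    qed
  qed simp
  then show False
    using sep(1) by simp
qed

section \<open>Compactness of the set of solutions\<close>

text \<open>A single diagonal selection serves all data: states at rational times, the jump times
  compactified by \<open>\<theta> = \<tau> / (1 + \<tau>)\<close>, and the indicator
  \<open>\<iota>\<close> of \<open>j \<le> J n\<close>. The Lipschitz bound extends convergence to
  real times, \<open>\<theta>\<close> tending to \<open>1\<close> means that \<open>\<tau>\<close>
  tends to infinity, and a convergent indicator is eventually constant.\<close>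

lemma lipschitz_family_convergent_subsequence:
  fixes \<phi> :: "nat \<Rightarrow> nat \<Rightarrow> real \<Rightarrow> 'a::euclidean_space" and \<tau> :: "nat \<Rightarrow> nat \<Rightarrow> real"
    and J :: "nat \<Rightarrow> nat"
  assumes bound: "\<And>n j t. norm (\<phi> n j t) \<le> K"
    and lip: "\<And>n j s t. norm (\<phi> n j s - \<phi> n j t) \<le> M * \<bar>s - t\<bar>"
    and nonneg: "\<And>n j. 0 \<le> \<tau> n j"
  obtains r f a where "strict_mono r" "\<And>j t. (\<lambda>n. \<phi> (r n) j t) \<longlonglongrightarrow> f j t"
    "\<And>j. (\<lambda>n. ereal (\<tau> (r n) j)) \<longlonglongrightarrow> a j"
    "\<And>j. eventually (\<lambda>n. j \<le> J (r n)) sequentially \<or> eventually (\<lambda>n. J (r n) < j) sequentially"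
proof -
  define \<theta> where "\<theta> n j = \<tau> n j / (1 + \<tau> n j)" for n j
  define \<iota> where "\<iota> n j = (if j \<le> J n then 1 else 0 :: real)" for n j
  have \<theta>: "0 \<le> \<theta> n j" "\<theta> n j < 1" for n j
    using nonneg[of n j] by (auto simp: \<theta>_def)
  have M: "0 \<le> M"
    using order_trans[OF norm_ge_zero lip[of 0 0 1 0]] by simp
  have cnt: "countable (\<rat> \<times> (UNIV :: nat set) :: (real \<times> nat) set)"
    using countable_rat by (intro countable_SIGMA) auto
  have bnd: "norm (\<phi> n j q, \<theta> n j, \<iota> n j) \<le> K + (1 + 1)" for n j q
  proof -
    have "norm (\<theta> n j, \<iota> n j) \<le> norm (\<theta> n j) + norm (\<iota> n j)"
      by (rule norm_Pair_le)
    also have "\<dots> \<le> 1 + 1"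
      using \<theta>[of n j] by (intro add_mono) (auto simp: \<iota>_def)
    finally show ?thesis
      using norm_Pair_le[of "\<phi> n j q" "(\<theta> n j, \<iota> n j)"] bound[of n j q] by linarith
  qed
  obtain r where r: "strict_mono r"
    and conv: "\<And>x. x \<in> \<rat> \<times> UNIV \<Longrightarrow> \<exists>l. (\<lambda>n. (\<lambda>(q, j). (\<phi> (r n) j q, \<theta> (r n) j, \<iota> (r n) j)) x) \<longlonglongrightarrow> l"
    by (rule function_convergent_subsequence[of "\<rat> \<times> UNIV" "\<lambda>n (q, j). (\<phi> n j q, \<theta> n j, \<iota> n j)" "K + (1 + 1)", OF cnt])
       (use bnd in \<open>auto simp: split_def\<close>)
  have conv': "\<exists>l. (\<lambda>n. (\<phi> (r n) j q, \<theta> (r n) j, \<iota> (r n) j)) \<longlonglongrightarrow> l" if "q \<in> \<rat>" for q j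
    using conv[of "(q, j)"] that by auto
  have conv_\<phi>_rat: "convergent (\<lambda>n. \<phi> (r n) j q)" if q: "q \<in> \<rat>" for q j
    using conv'[OF q, of j] tendsto_fst unfolding convergent_def by fastforce
  have conv_\<theta>\<iota>: "\<exists>l m. (\<lambda>n. \<theta> (r n) j) \<longlonglongrightarrow> l \<and> (\<lambda>n. \<iota> (r n) j) \<longlonglongrightarrow> m" for j
  proof -
    obtain l where l: "(\<lambda>n. (\<phi> (r n) j 0, \<theta> (r n) j, \<iota> (r n) j)) \<longlonglongrightarrow> l"
      using conv'[of 0 j] by auto
    have "(\<lambda>n. fst (snd (\<phi> (r n) j 0, \<theta> (r n) j, \<iota> (r n) j))) \<longlonglongrightarrow> fst (snd l)"
      "(\<lambda>n. snd (snd (\<phi> (r n) j 0, \<theta> (r n) j, \<iota> (r n) j))) \<longlonglongrightarrow> snd (snd l)"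
      by (intro tendsto_fst tendsto_snd l)+
    then show ?thesis
      by auto
  qed
  have conv_\<phi>: "\<exists>l. (\<lambda>n. \<phi> (r n) j t) \<longlonglongrightarrow> l" for j t
  proof -
    have "Cauchy (\<lambda>n. \<phi> (r n) j t)"
      unfolding Cauchy_def
    proof (intro allI impI)
      fix e :: real assume e: "0 < e"
      obtain q where q: "q \<in> \<rat>" "t < q" "q < t + e / (3 * (M + 1))"
        using Rats_dense_in_real[of t "t + e / (3 * (M + 1))"] e M by auto
      have "M * \<bar>t - q\<bar> \<le> M * (e / (3 * (M + 1)))"
        using q M by (intro mult_left_mono) auto
      also have "\<dots> < e / 3"
        using M e by (simp add: field_simps)
      finally have near: "dist (\<phi> n j t) (\<phi> n j q) < e / 3" for n
        using lip[of n j t q] by (simp add: dist_norm)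
      have "Cauchy (\<lambda>n. \<phi> (r n) j q)"
        using conv_\<phi>_rat[OF q(1)] by (rule convergent_Cauchy)
      then obtain N where N: "\<And>m n. N \<le> m \<Longrightarrow> N \<le> n \<Longrightarrow> dist (\<phi> (r m) j q) (\<phi> (r n) j q) < e / 3"
        using e unfolding Cauchy_def by (metis divide_pos_pos zero_less_numeral)
      have "dist (\<phi> (r m) j t) (\<phi> (r n) j t) < e" if "N \<le> m" "N \<le> n" for m n
        using dist_triangle[of "\<phi> (r m) j t" "\<phi> (r n) j t" "\<phi> (r m) j q"]
          dist_triangle[of "\<phi> (r m) j q" "\<phi> (r n) j t" "\<phi> (r n) j q"]
          near[of "r m"] near[of "r n"] N[OF that] by (simp add: dist_commute)
      then show "\<exists>N. \<forall>m\<ge>N. \<forall>n\<ge>N. dist (\<phi> (r m) j t) (\<phi> (r n) j t) < e"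
        by blast
    qed
    then show ?thesis
      unfolding Cauchy_convergent_iff convergent_def .
  qed
  have conv_\<tau>: "\<exists>a. (\<lambda>n. ereal (\<tau> (r n) j)) \<longlonglongrightarrow> a" for j
  proof -
    obtain l where l: "(\<lambda>n. \<theta> (r n) j) \<longlonglongrightarrow> l"
      using conv_\<theta>\<iota> by blast
    have \<tau>_eq: "\<tau> n j = \<theta> n j / (1 - \<theta> n j)" for n
      using nonneg[of n j] by (simp add: \<theta>_def field_simps)
    show ?thesis
    proof (cases "l < 1")
      case True
      then have "(\<lambda>n. \<theta> (r n) j / (1 - \<theta> (r n) j)) \<longlonglongrightarrow> l / (1 - l)"
        by (intro tendsto_intros l) auto
      then show ?thesis
        unfolding \<tau>_eq[symmetric] by (intro exI[of _ "ereal (l / (1 - l))"]) simp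
    next
      case False
      have "(\<lambda>n. ereal (\<tau> (r n) j)) \<longlonglongrightarrow> \<infinity>"
        unfolding tendsto_PInfty
      proof
        fix R :: real
        define R' where "R' = max R 0"
        have "R' / (1 + R') < l"
          using False by (simp add: R'_def divide_less_eq_1) (smt (verit) divide_less_eq_1_pos)
        then have "eventually (\<lambda>n. R' / (1 + R') < \<theta> (r n) j) sequentially"
          by (rule order_tendstoD(1)[OF l])
        then show "eventually (\<lambda>n. ereal R < ereal (\<tau> (r n) j)) sequentially"
        proof eventually_elim
          case (elim n)
          have "0 \<le> R'" by (simp add: R'_def)
          then have "R' * (1 + \<tau> (r n) j) < \<tau> (r n) j * (1 + R')"
            using elim nonneg[of "r n" j] by (simp add: \<theta>_def divide_simps mult.commute)
          then have "R' < \<tau> (r n) j"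
            by (simp add: algebra_simps)
          then show ?case by (simp add: R'_def)
        qed
      qed
      then show ?thesis by blast
    qed
  qed
  have "eventually (\<lambda>n. j \<le> J (r n)) sequentially \<or> eventually (\<lambda>n. J (r n) < j) sequentially" for j
  proof -
    obtain l where l: "(\<lambda>n. \<iota> (r n) j) \<longlonglongrightarrow> l"
      using conv_\<theta>\<iota> by blast
    show ?thesis
    proof (cases "l > 0")
      case True
      then have "eventually (\<lambda>n. 0 < \<iota> (r n) j) sequentially"
        by (rule order_tendstoD(1)[OF l])
      then have "eventually (\<lambda>n. j \<le> J (r n)) sequentially"
        by eventually_elim (auto simp: \<iota>_def split: if_splits)
      then show ?thesis ..
    next
      case False
      then have "eventually (\<lambda>n. \<iota> (r n) j < 1) sequentially"
        using order_tendstoD(2)[OF l, of 1] by auto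
      then have "eventually (\<lambda>n. J (r n) < j) sequentially"
        by eventually_elim (auto simp: \<iota>_def split: if_splits)
      then show ?thesis ..
    qed
  qed
  moreover obtain f where "\<And>j t. (\<lambda>n. \<phi> (r n) j t) \<longlonglongrightarrow> f j t"
    using conv_\<phi> by metis
  moreover obtain a where "\<And>j. (\<lambda>n. ereal (\<tau> (r n) j)) \<longlonglongrightarrow> a j"
    using conv_\<tau> by metis
  ultimately show thesis
    using r that by blast
qed

lemma abs_clamp_diff_le:
  fixes a b s t :: real
  shows "\<bar>max a (min s b) - max a (min t b)\<bar> \<le> \<bar>s - t\<bar>"
  by (auto simp: max_def min_def abs_if)

text \<open>Here \<open>y\<close> is the limit of the images under \<open>L\<close> of the pieces of the arcs \<open>x (r n)\<close> up to
  hybrid time \<open>(T (r n), J (r n))\<close>.\<close>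

definition window_limit ::
  "('a \<Rightarrow> 'b::euclidean_space) \<Rightarrow> (nat \<Rightarrow> 'a arc) \<Rightarrow> (nat \<Rightarrow> real) \<Rightarrow> (nat \<Rightarrow> nat) \<Rightarrow> (nat \<Rightarrow> nat) \<Rightarrow> 'b arc \<Rightarrow> bool" where
  "window_limit L x T J r y \<longleftrightarrow> strict_mono r \<and>
    (\<forall>t j. (t, j) \<in> dom y \<longrightarrow> (\<exists>s. s \<longlonglongrightarrow> t \<and> (\<lambda>n. L (the (x (r n) (s n, j)))) \<longlonglongrightarrow> the (y (t, j)) \<and>
       eventually (\<lambda>n. (s n, j) \<in> dom (x (r n)) \<and> s n \<le> T (r n) \<and> j \<le> J (r n)) sequentially)) \<and>
    (\<lambda>n. L (the (x (r n) (0, 0)))) \<longlonglongrightarrow> the (y (0, 0)) \<and>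
    (\<forall>N. (\<forall>n. T n + real (J n) \<le> N) \<longrightarrow>
      (\<exists>t j. (t, j) \<in> dom y \<and> (\<lambda>n. L (the (x (r n) (T (r n), J (r n))))) \<longlonglongrightarrow> the (y (t, j)))) \<and>
    (filterlim (\<lambda>n. T n + real (J n)) at_top sequentially \<longrightarrow> complete_arc y)"

lemma window_limit_subseq: "window_limit L x T J r y \<Longrightarrow> strict_mono r"
  and window_limit_start: "window_limit L x T J r y \<Longrightarrow> (\<lambda>n. L (the (x (r n) (0, 0)))) \<longlonglongrightarrow> the (y (0, 0))"
  and window_limit_complete: "window_limit L x T J r y \<Longrightarrow>
    filterlim (\<lambda>n. T n + real (J n)) at_top sequentially \<Longrightarrow> complete_arc y"
  unfolding window_limit_def by blast+

lemma window_limit_approx: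
  assumes "window_limit L x T J r y" "(t, j) \<in> dom y"
  obtains s where "s \<longlonglongrightarrow> t" "(\<lambda>n. L (the (x (r n) (s n, j)))) \<longlonglongrightarrow> the (y (t, j))"
    "eventually (\<lambda>n. (s n, j) \<in> dom (x (r n)) \<and> s n \<le> T (r n) \<and> j \<le> J (r n)) sequentially"
  using assms unfolding window_limit_def by blast

lemma window_limit_end:
  assumes "window_limit L x T J r y" "\<And>n. T n + real (J n) \<le> N"
  obtains t j where "(t, j) \<in> dom y" "(\<lambda>n. L (the (x (r n) (T (r n), J (r n))))) \<longlonglongrightarrow> the (y (t, j))"
  using assms unfolding window_limit_def by blast

text \<open>Arzela-Ascoli is applied to each flow piece separately, the pieces being matched by
  their number of preceding jumps. An end point may go to infinity, and the number of pieces may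
  grow or stabilise; this decides whether the limit is complete.\<close>

theorem solutions_compactness:
  fixes H :: "'a::euclidean_space hybrid_system" and x :: "nat \<Rightarrow> 'a arc"
  assumes BA: "basic_assumptions H" and sol: "\<And>n. solution H (x n)"
    and end_dom: "\<And>n. (T n, J n) \<in> dom (x n)"
    and B: "compact B"
    and in_B: "\<forall>n t j. (t, j) \<in> dom (x n) \<longrightarrow> t \<le> T n \<longrightarrow> j \<le> J n \<longrightarrow> the (x n (t, j)) \<in> B"
  shows "\<exists>r y. solution H y \<and> window_limit (\<lambda>z. z) x T J r y"
proof -
  have C: "closed (flow_set H)" and D: "closed (jump_set H)"
    and oscG: "outer_semicontinuous (jump_map H)"
    and lbF: "locally_bounded_on (flow_set H) (flow_map H)"
    using BA by (auto simp: basic_assumptions_def)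
  obtain M0 where M0: "\<And>v. v \<in> (\<Union>z\<in>B \<inter> flow_set H. flow_map H z) \<Longrightarrow> norm v \<le> M0"
    using locally_bounded_on_compact[OF lbF C B] unfolding bounded_iff by blast
  define M where "M = max M0 0"
  have M: "0 \<le> M" "\<And>z v. z \<in> B \<Longrightarrow> z \<in> flow_set H \<Longrightarrow> v \<in> flow_map H z \<Longrightarrow> norm v \<le> M"
    using M0 unfolding M_def by (force intro: max.coboundedI1)+
  obtain K where K: "\<And>z. z \<in> B \<Longrightarrow> norm z \<le> K"
    using compact_imp_bounded[OF B] unfolding bounded_iff by blast
  have dom: "hybrid_time_domain (dom (x n))" for n
    using sol by (rule solution_time_domain)
  have "\<exists>\<tau>. \<tau> 0 = (0::real) \<and> incseq \<tau> \<and> (\<forall>j. J n < j \<longrightarrow> \<tau> j = T n) \<and>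
    (\<forall>t j. j \<le> J n \<longrightarrow> \<tau> j \<le> t \<longrightarrow> t \<le> \<tau> (Suc j) \<longrightarrow> (t, j) \<in> dom (x n)) \<and>
    (\<forall>t j. (t, j) \<in> dom (x n) \<longrightarrow> j \<le> J n \<longrightarrow> t \<le> T n \<longrightarrow> \<tau> j \<le> t \<and> t \<le> \<tau> (Suc j))" for n
    using hybrid_time_domain_truncation[OF dom end_dom, of n] by metis
  then obtain \<tau> where \<tau>0: "\<And>n. \<tau> n 0 = (0::real)" and \<tau>_inc: "\<And>n. incseq (\<tau> n)"
    and \<tau>_end: "\<And>n j. J n < j \<Longrightarrow> \<tau> n j = T n"
    and \<tau>_dom: "\<And>n t j. j \<le> J n \<Longrightarrow> \<tau> n j \<le> t \<Longrightarrow> t \<le> \<tau> n (Suc j) \<Longrightarrow> (t, j) \<in> dom (x n)"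
    by metis
  have \<tau>_Suc: "\<tau> n j \<le> \<tau> n (Suc j)" for n j
    using \<tau>_inc by (rule incseq_SucD)
  have \<tau>_nonneg: "0 \<le> \<tau> n j" for n j
    using incseqD[OF \<tau>_inc, of 0 j n] \<tau>0 by simp
  have \<tau>_le: "\<tau> n j \<le> T n" for n j
    using incseqD[OF \<tau>_inc, of j "max j (Suc (J n))" n] \<tau>_end[of n "max j (Suc (J n))"] by simp
  \<comment> \<open>Clamping extends piece \<open>j\<close> constantly beyond its ends. All pieces
    become curves on the whole line with the same Lipschitz constant, although their intervals vary
    with \<open>n\<close>.\<close>
  define cl where "cl n j t = max (\<tau> n j) (min t (\<tau> n (Suc j)))" for n j t
  have cl_bounds: "\<tau> n j \<le> cl n j t" "cl n j t \<le> \<tau> n (Suc j)" for n j t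
    using \<tau>_Suc[of n j] by (auto simp: cl_def)
  have cl_eq: "cl n j t = t" if "\<tau> n j \<le> t" "t \<le> \<tau> n (Suc j)" for n j t
    using that by (simp add: cl_def)
  \<comment> \<open>The default \<open>0\<close> for absent pieces keeps the family bounded and
    Lipschitz; it does not enter the limit arc, whose slices \<open>j\<close> all satisfy
    \<open>P j\<close>.\<close>
  define \<phi> where "\<phi> n j t = (if j \<le> J n then the (x n (cl n j t, j)) else 0)" for n j t
  have \<phi>_eq: "\<phi> n j t = the (x n (t, j))" if "j \<le> J n" "\<tau> n j \<le> t" "t \<le> \<tau> n (Suc j)" for n j t
    using that cl_eq by (simp add: \<phi>_def)
  have slice_sub: "{\<tau> n j..\<tau> n (Suc j)} \<subseteq> time_slice (x n) j" if "j \<le> J n" for n j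
    using \<tau>_dom[OF that] unfolding time_slice_def by (intro subsetI CollectI) simp
  have piece_B: "the (x n (t, j)) \<in> B" if "j \<le> J n" "\<tau> n j \<le> t" "t \<le> \<tau> n (Suc j)" for n j t
    using in_B[rule_format, OF \<tau>_dom[OF that]] \<tau>_le[of n "Suc j"] that by simp
  have \<phi>_bound: "norm (\<phi> n j t) \<le> max K 0" for n j t
  proof (cases "j \<le> J n")
    case True
    then show ?thesis
      using K[OF piece_B[OF True cl_bounds]] by (simp add: \<phi>_def max.coboundedI1)
  qed (simp add: \<phi>_def)
  have \<phi>_lip: "norm (\<phi> n j s - \<phi> n j t) \<le> M * \<bar>s - t\<bar>" for n j s t
  proof (cases "j \<le> J n")
    case True
    have "norm (the (x n (cl n j s, j)) - the (x n (cl n j t, j))) \<le> M * \<bar>cl n j s - cl n j t\<bar>"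
    proof (rule flow_arc_lipschitz[OF solution_flow_arc[OF sol] slice_sub[OF True] M(1)])
      fix r v assume "r \<in> {\<tau> n j..\<tau> n (Suc j)}" "the (x n (r, j)) \<in> flow_set H" "v \<in> flow_map H (the (x n (r, j)))"
      then show "norm v \<le> M"
        using M(2) piece_B[OF True] by auto
    qed (use cl_bounds in auto)
    also have "\<dots> \<le> M * \<bar>s - t\<bar>"
      unfolding cl_def by (intro mult_left_mono abs_clamp_diff_le M(1))
    finally show ?thesis
      using True by (simp add: \<phi>_def)
  qed (simp add: \<phi>_def M(1))
  obtain r f a where r: "strict_mono r" and f: "\<And>j t. (\<lambda>n. \<phi> (r n) j t) \<longlonglongrightarrow> f j t"
    and a: "\<And>j. (\<lambda>n. ereal (\<tau> (r n) j)) \<longlonglongrightarrow> a j"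
    and J_alt: "\<And>j. eventually (\<lambda>n. j \<le> J (r n)) sequentially \<or> eventually (\<lambda>n. J (r n) < j) sequentially"
    using lipschitz_family_convergent_subsequence[of \<phi> "max K 0" M \<tau> J] \<phi>_bound \<phi>_lip \<tau>_nonneg by blast
  define P where "P j \<longleftrightarrow> eventually (\<lambda>n. j \<le> J (r n)) sequentially" for j
  have P_ev: "eventually (\<lambda>n. j \<le> J (r n)) sequentially" if "P j" for j
    using that by (simp add: P_def)
  have P0: "P 0"
    by (simp add: P_def)
  have P_Suc: "P j" if "P (Suc j)" for j
    using P_ev[OF that] unfolding P_def by eventually_elim simp
  have notP: "eventually (\<lambda>n. J (r n) < j) sequentially" if "\<not> P j" for j
    using J_alt[of j] that by (auto simp: P_def)
  have f_lip: "norm (f j s - f j t) \<le> M * \<bar>s - t\<bar>" for j s t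
  proof (rule tendsto_upperbound)
    show "(\<lambda>n. norm (\<phi> (r n) j s - \<phi> (r n) j t)) \<longlonglongrightarrow> norm (f j s - f j t)"
      by (intro tendsto_intros f)
  qed (use \<phi>_lip in auto)
  have f_moving: "(\<lambda>n. \<phi> (r n) j (s n)) \<longlonglongrightarrow> f j t" if s: "s \<longlonglongrightarrow> t" for j s t
  proof -
    have "(\<lambda>n. M * \<bar>s n - t\<bar>) \<longlonglongrightarrow> M * \<bar>t - t\<bar>"
      by (intro tendsto_intros s)
    then have "(\<lambda>n. M * \<bar>s n - t\<bar>) \<longlonglongrightarrow> 0"
      by simp
    then have "(\<lambda>n. \<phi> (r n) j (s n) - \<phi> (r n) j t) \<longlonglongrightarrow> 0"
      by (rule Lim_null_comparison[rotated]) (use \<phi>_lip in auto)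
    from tendsto_add[OF this f[of j t]] show ?thesis by simp
  qed
  have f_lipschitz: "M-lipschitz_on UNIV (f j)" for j
    by (rule lipschitz_onI) (use f_lip M in \<open>auto simp: dist_norm\<close>)
  have f_diff: "negligible {t. \<not> f j differentiable (at t)}" for j
    by (rule negligible_lipschitz_not_differentiable[OF f_lipschitz])
  have a0: "a 0 = 0"
    using LIMSEQ_unique[OF a[of 0]] by (simp add: \<tau>0 zero_ereal_def)
  have a_nonneg: "0 \<le> a j" for j
    by (rule tendsto_lowerbound[OF a]) (use \<tau>_nonneg in auto)
  have ev_less: "eventually (\<lambda>n. \<tau> (r n) j < t) sequentially" if "a j < ereal t" for j t
    using order_tendstoD(2)[OF a that] by simp
  have ev_greater: "eventually (\<lambda>n. t < \<tau> (r n) j) sequentially" if "ereal t < a j" for j t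
    using order_tendstoD(1)[OF a that] by simp
  \<comment> \<open>If \<open>a (Suc j)\<close> is infinite and \<open>a j\<close> finite, slice
    \<open>j\<close> is unbounded, and all later slices are empty because
    \<open>a i \<le> ereal t\<close> fails there.\<close>
  define E where "E = {(t, j). P j \<and> a j \<le> ereal t \<and> ereal t \<le> a (Suc j)}"
  define y where "y = (\<lambda>(t, j). if (t, j) \<in> E then Some (f j t) else None)"
  have dom_y: "dom y = E"
    by (auto simp: y_def split: if_splits)
  have y_eq: "the (y (t, j)) = f j t" if "(t, j) \<in> E" for t j
    using that by (simp add: y_def)
  have E_P: "P j" and E_lo: "a j \<le> ereal t" and E_hi: "ereal t \<le> a (Suc j)" if "(t, j) \<in> E" for t j
    using that by (simp_all add: E_def)
  \<comment> \<open>A time of the limit slice may lie just outside the slices of the approximating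
    arcs; the clamped times supply the approximating times required by
    \<open>window_limit\<close>.\<close>
  have cl_lim: "(\<lambda>n. cl (r n) j t) \<longlonglongrightarrow> t" if t: "(t, j) \<in> E" for t j
  proof (rule LIMSEQ_I)
    fix e :: real assume e: "0 < e"
    have "a j < ereal (t + e)"
      by (rule le_less_trans[OF E_lo[OF t]]) (simp add: e)
    moreover have "ereal (t - e) < a (Suc j)"
      by (rule less_le_trans[OF _ E_hi[OF t]]) (simp add: e)
    ultimately have "eventually (\<lambda>n. \<tau> (r n) j < t + e \<and> t - e < \<tau> (r n) (Suc j)) sequentially"
      by (intro eventually_conj ev_less ev_greater)
    then have "eventually (\<lambda>n. norm (cl (r n) j t - t) < e) sequentially"
      by eventually_elim (use e in \<open>auto simp: cl_def max_def min_def abs_if\<close>)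
    then show "\<exists>N. \<forall>n\<ge>N. norm (cl (r n) j t - t) < e"
      by (simp add: eventually_sequentially)
  qed
  have E_dom: "hybrid_time_domain E"
    unfolding hybrid_time_domain_iff
  proof (intro conjI allI impI)
    show "(0, 0) \<in> E"
      using P0 a0 a_nonneg[of "Suc 0"] by (simp add: E_def zero_ereal_def[symmetric])
  next
    fix t j assume "(t, j) \<in> E"
    then have "0 \<le> ereal t"
      using order_trans[OF a_nonneg E_lo] by blast
    then show "0 \<le> t" by simp
  next
    fix j s t u assume *: "(s, j) \<in> E" "(u, j) \<in> E" "s \<le> t" "t \<le> u"
    have "a j \<le> ereal t"
      by (rule order_trans[OF E_lo[OF *(1)]]) (simp add: *)
    moreover have "ereal t \<le> a (Suc j)"
      by (rule order_trans[OF _ E_hi[OF *(2)]]) (simp add: *)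
    ultimately show "(t, j) \<in> E"
      using E_P[OF *(1)] by (simp add: E_def)
  next
    fix j t assume t: "(t, Suc j) \<in> E"
    then have "a (Suc j) \<le> ereal t" by (simp add: E_def)
    then obtain m where m: "a (Suc j) = ereal m"
      using a_nonneg[of "Suc j"] by (cases "a (Suc j)") auto
    have "a j \<le> a (Suc j)"
      by (rule LIMSEQ_le[OF a a]) (use \<tau>_Suc in auto)
    moreover have "a (Suc j) \<le> a (Suc (Suc j))"
      by (rule LIMSEQ_le[OF a a]) (use \<tau>_Suc in auto)
    ultimately have "(m, j) \<in> E" "(m, Suc j) \<in> E"
      using E_P[OF t] P_Suc by (auto simp: E_def m)
    moreover have "\<forall>s. (s, j) \<in> E \<longrightarrow> s \<le> m" "\<forall>s. (s, Suc j) \<in> E \<longrightarrow> m \<le> s"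
      by (auto simp: E_def m)
    ultimately show "\<exists>m. (m, j) \<in> E \<and> (m, Suc j) \<in> E \<and> (\<forall>s. (s, j) \<in> E \<longrightarrow> s \<le> m) \<and> (\<forall>s. (s, Suc j) \<in> E \<longrightarrow> m \<le> s)"
      by blast
  qed
  have conv_slice: "convex (time_slice y j)" for j
    using E_dom dom_y by (intro convex_time_slice) simp
  have slice_E: "time_slice y j = {t. (t, j) \<in> E}" for j
    by (simp add: time_slice_def dom_y)
  \<comment> \<open>Away from its ends a limit piece is eventually covered by the approximating
    pieces. The ends themselves are reached by closure for the flow set, and belong to a null
    frontier for the differential inclusion.\<close>
  have flow_inner: "eventually (\<lambda>n. flow_arc H {u..v} (\<phi> (r n) j)) sequentially"
    if "P j" "a j < ereal u" "ereal v < a (Suc j)" for j u v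
    using P_ev[OF that(1)] ev_less[OF that(2)] ev_greater[OF that(3)]
  proof eventually_elim
    case (elim n)
    have "flow_arc H {u..v} (\<lambda>t. the (x (r n) (t, j)))"
      using solution_flow_arc[OF sol] by (rule flow_arc_subset) (use elim slice_sub[of j "r n"] in auto)
    then show ?case
      by (rule flow_arc_cong) (use elim \<phi>_eq in auto)
  qed
  have f_C: "f j t \<in> flow_set H" if t: "(t, j) \<in> E" and s: "(s, j) \<in> E" and ts: "t < s" for j t s
  proof -
    have inner: "f j u \<in> flow_set H" if u: "t < u" "u < s" for u
    proof -
      define v where "v = (u + s) / 2"
      have v: "u < v" "v < s" using u by (auto simp: v_def)
      have "a j < ereal u"
        by (rule le_less_trans[OF E_lo[OF t]]) (simp add: u)
      moreover have "ereal v < a (Suc j)"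
        by (rule less_le_trans[OF _ E_hi[OF s]]) (simp add: v)
      ultimately have "eventually (\<lambda>n. flow_arc H {u..v} (\<phi> (r n) j)) sequentially"
        by (rule flow_inner[OF E_P[OF t]])
      then have "eventually (\<lambda>n. \<phi> (r n) j u \<in> flow_set H) sequentially"
      proof eventually_elim
        case (elim n)
        moreover have "interior {u..v} \<noteq> {}" "u \<in> {u..v}" "v \<in> {u..v}"
          using v by auto
        ultimately show ?case
          using v(1) unfolding flow_arc_def by blast
      qed
      then show ?thesis
        by (rule Lim_in_closed_set[OF C _ _ f]) simp
    qed
    have "f j ` closure {t<..<s} \<subseteq> flow_set H"
    proof (rule image_closure_subset[OF _ C])
      show "continuous_on (closure {t<..<s}) (f j)"
        using lipschitz_on_continuous_on[OF f_lipschitz] by (rule continuous_on_subset) simp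
    qed (use inner in auto)
    then show ?thesis
      using ts by auto
  qed
  have sol_y: "solution H y"
    unfolding solution_iff_flow_arc
  proof (intro conjI allI impI)
    show "hybrid_time_domain (dom y)"
      using E_dom dom_y by simp
  next
    fix j
    let ?S = "time_slice y j"
    have "flow_arc H ?S (f j)"
      unfolding flow_arc_def
    proof (intro conjI impI ballI)
      show "locally_absolutely_continuous_on ?S (f j)"
        unfolding locally_absolutely_continuous_on_def
        using f_lip by (blast intro: lipschitz_imp_absolutely_continuous)
      have "flow_defect H ?S (f j) \<subseteq> {t. \<not> f j differentiable (at t)} \<union> frontier ?S"
      proof
        fix t assume t: "t \<in> flow_defect H ?S (f j)"
        show "t \<in> {t. \<not> f j differentiable (at t)} \<union> frontier ?S"
        proof (rule ccontr)
          assume not: "t \<notin> {t. \<not> f j differentiable (at t)} \<union> frontier ?S"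
          then obtain v where v: "(f j has_vector_derivative v) (at t)"
            using vector_derivative_works by blast
          have "t \<in> interior ?S"
            using not t closure_subset[of ?S] by (auto simp: frontier_def flow_defect_def)
          then obtain e where e: "e > 0" "ball t e \<subseteq> ?S"
            by (auto simp: mem_interior)
          have "t - e/2 \<in> ball t e" "t + e/2 \<in> ball t e" "t \<in> ball t e"
            using e(1) by (auto simp: dist_real_def)
          then have in_E: "(t - e/2, j) \<in> E" "(t + e/2, j) \<in> E" "(t, j) \<in> E"
            using e(2) unfolding slice_E by blast+
          have "a j < ereal t"
            by (rule le_less_trans[OF E_lo[OF in_E(1)]]) (simp add: e)
          moreover have "ereal (t + e/4) < a (Suc j)"
            by (rule less_le_trans[OF _ E_hi[OF in_E(2)]]) (simp add: e)
          ultimately have "eventually (\<lambda>n. flow_arc H {t..t + e/4} (\<phi> (r n) j)) sequentially"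
            by (rule flow_inner[OF E_P[OF in_E(3)]])
          moreover have "f j t \<in> flow_set H"
            by (rule f_C[OF in_E(3,2)]) (use e in simp)
          ultimately have "v \<in> flow_map H (f j t)"
            using e(1) by (intro limit_flow_derivative[OF BA _ _ _ f _ v, of "e/4" M] \<phi>_lip) auto
          moreover have "(f j has_vector_derivative v) (at t within ?S)"
            using v by (rule has_vector_derivative_at_within)
          ultimately show False
            using t unfolding flow_defect_def by blast
        qed
      qed
      moreover have "negligible ({t. \<not> f j differentiable (at t)} \<union> frontier ?S)"
        using conv_slice by (intro negligible_Un f_diff negligible_convex_frontier)
      ultimately show "negligible (flow_defect H ?S (f j))"
        using negligible_subset by blast
      fix t assume "t \<in> ?S" "\<exists>s\<in>?S. t < s"
      then show "f j t \<in> flow_set H"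
        using f_C by (auto simp: slice_E)
    qed
    then show "flow_arc H ?S (\<lambda>t. the (y (t, j)))"
      by (rule flow_arc_cong) (simp add: y_eq slice_E)
  next
    fix t j assume "(t, j) \<in> dom y" "(t, Suc j) \<in> dom y"
    then have tE: "(t, j) \<in> E" "(t, Suc j) \<in> E"
      by (simp_all add: dom_y)
    then have "a (Suc j) = ereal t"
      by (auto simp: E_def)
    then have \<tau>t: "(\<lambda>n. \<tau> (r n) (Suc j)) \<longlonglongrightarrow> t"
      using a[of "Suc j"] by simp
    \<comment> \<open>Outer semicontinuity is stated for sequences whose every term satisfies the
      inclusion, so the terms without slice \<open>Suc j\<close> are dropped.\<close>
    obtain N where N: "\<And>n. N \<le> n \<Longrightarrow> Suc j \<le> J (r n)"
      using P_ev[OF E_P[OF tE(2)]] by (auto simp: eventually_sequentially)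
    define k where "k n = r (n + N)" for n
    define m where "m n = \<tau> (k n) (Suc j)" for n
    have lim: "(\<lambda>n. \<phi> (k n) j (m n)) \<longlonglongrightarrow> f j t" "(\<lambda>n. \<phi> (k n) (Suc j) (m n)) \<longlonglongrightarrow> f (Suc j) t"
      using LIMSEQ_ignore_initial_segment[OF f_moving[OF \<tau>t, of j], of N]
        LIMSEQ_ignore_initial_segment[OF f_moving[OF \<tau>t, of "Suc j"], of N] by (simp_all add: k_def m_def)
    have Jk: "Suc j \<le> J (k n)" for n
      using N by (simp add: k_def)
    have "\<phi> (k n) j (m n) = the (x (k n) (m n, j))" "\<phi> (k n) (Suc j) (m n) = the (x (k n) (m n, Suc j))"
      "(m n, j) \<in> dom (x (k n))" "(m n, Suc j) \<in> dom (x (k n))" for n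
      using Jk[of n] \<tau>_Suc[of "k n" j] \<tau>_Suc[of "k n" "Suc j"] \<phi>_eq[of j "k n" "m n"] \<phi>_eq[of "Suc j" "k n" "m n"]
        \<tau>_dom[of j "k n" "m n"] \<tau>_dom[of "Suc j" "k n" "m n"] by (simp_all add: m_def)
    then have jump: "\<phi> (k n) j (m n) \<in> jump_set H" "\<phi> (k n) (Suc j) (m n) \<in> jump_map H (\<phi> (k n) j (m n))" for n
      using solution_jump[OF sol] by simp_all
    show "the (y (t, j)) \<in> jump_set H"
      unfolding y_eq[OF tE(1)] by (rule closed_sequentially[OF D jump(1) lim(1)])
    show "the (y (t, Suc j)) \<in> jump_map H (the (y (t, j)))"
      unfolding y_eq[OF tE(1)] y_eq[OF tE(2)] using oscG lim jump(2) unfolding outer_semicontinuous_def by blast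
  qed
  have "window_limit (\<lambda>z. z) x T J r y"
    unfolding window_limit_def
  proof (intro conjI allI impI r)
    fix t j assume "(t, j) \<in> dom y"
    then have tE: "(t, j) \<in> E" by (simp add: dom_y)
    show "\<exists>s. s \<longlonglongrightarrow> t \<and> (\<lambda>n. the (x (r n) (s n, j))) \<longlonglongrightarrow> the (y (t, j)) \<and>
       eventually (\<lambda>n. (s n, j) \<in> dom (x (r n)) \<and> s n \<le> T (r n) \<and> j \<le> J (r n)) sequentially"
    proof (intro exI[of _ "\<lambda>n. cl (r n) j t"] conjI)
      show "(\<lambda>n. cl (r n) j t) \<longlonglongrightarrow> t"
        by (rule cl_lim[OF tE])
      have "eventually (\<lambda>n. \<phi> (r n) j t = the (x (r n) (cl (r n) j t, j))) sequentially"
        using P_ev[OF E_P[OF tE]] by eventually_elim (simp add: \<phi>_def)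
      with f[of j t] show "(\<lambda>n. the (x (r n) (cl (r n) j t, j))) \<longlonglongrightarrow> the (y (t, j))"
        unfolding y_eq[OF tE] by (rule Lim_transform_eventually)
      show "eventually (\<lambda>n. (cl (r n) j t, j) \<in> dom (x (r n)) \<and> cl (r n) j t \<le> T (r n) \<and> j \<le> J (r n)) sequentially"
        using P_ev[OF E_P[OF tE]]
        by eventually_elim (use \<tau>_dom cl_bounds \<tau>_le order_trans in blast)
    qed
  next
    have "\<phi> n 0 0 = the (x n (0, 0))" for n
      using \<tau>_nonneg[of n "Suc 0"] by (intro \<phi>_eq) (auto simp: \<tau>0)
    moreover have "(0, 0) \<in> E"
      using E_dom by (rule hybrid_time_domain_0)
    ultimately show "(\<lambda>n. the (x (r n) (0, 0))) \<longlonglongrightarrow> the (y (0, 0))"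
      using f[of 0 0] y_eq by simp
  next
    fix N assume N: "\<forall>n. T n + real (J n) \<le> N"
    have T0: "0 \<le> T n" for n
      using hybrid_time_domain_nonneg[OF dom end_dom] .
    have TN: "T n \<le> N" for n
      using N[rule_format, of n] T0[of n] by linarith
    \<comment> \<open>A bound on the lengths bounds the number of jumps, so the last index
      \<open>J (r n)\<close> is eventually a constant \<open>j\<close>, and
      \<open>\<tau> (r n) (Suc j)\<close> is then the end time by the padding.\<close>
    have "\<exists>j. P j \<and> \<not> P (Suc j)"
    proof (rule ccontr)
      assume "\<nexists>j. P j \<and> \<not> P (Suc j)"
      then have P: "P j" for j
        by (induction j) (use P0 in auto)
      obtain k where k: "N < real k"
        using reals_Archimedean2 by blast
      obtain n where "k \<le> J (r n)"
        using P_ev[OF P[of k]] by (auto simp: eventually_sequentially)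
      then show False
        using N[rule_format, of "r n"] T0[of "r n"] k by linarith
    qed
    then obtain j where j: "P j" "\<not> P (Suc j)" by blast
    have ev: "eventually (\<lambda>n. J (r n) = j) sequentially"
      using P_ev[OF j(1)] notP[OF j(2)] by eventually_elim simp
    have "a (Suc j) \<le> ereal N"
      by (rule tendsto_upperbound[OF a]) (auto intro!: always_eventually order_trans[OF \<tau>_le TN])
    then obtain t where t: "a (Suc j) = ereal t"
      using a_nonneg[of "Suc j"] by (cases "a (Suc j)") auto
    have "a j \<le> a (Suc j)"
      by (rule LIMSEQ_le[OF a a]) (use \<tau>_Suc in auto)
    then have tE: "(t, j) \<in> E"
      using j(1) t by (simp add: E_def)
    have "(\<lambda>n. \<tau> (r n) (Suc j)) \<longlonglongrightarrow> t"
      using a[of "Suc j"] t by simp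
    then have "(\<lambda>n. \<phi> (r n) j (\<tau> (r n) (Suc j))) \<longlonglongrightarrow> f j t"
      by (rule f_moving)
    moreover have "eventually (\<lambda>n. \<phi> (r n) j (\<tau> (r n) (Suc j)) = the (x (r n) (T (r n), J (r n)))) sequentially"
      using ev
    proof eventually_elim
      case (elim n)
      then show ?case
        using \<phi>_eq[of j "r n" "\<tau> (r n) (Suc j)"] \<tau>_Suc[of "r n" j] \<tau>_end[of "r n" "Suc j"] by simp
    qed
    ultimately have "(\<lambda>n. the (x (r n) (T (r n), J (r n)))) \<longlonglongrightarrow> f j t"
      by (rule Lim_transform_eventually)
    then show "\<exists>t j. (t, j) \<in> dom y \<and> (\<lambda>n. the (x (r n) (T (r n), J (r n)))) \<longlonglongrightarrow> the (y (t, j))"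
      using tE y_eq unfolding dom_y by metis
  next
    assume inf: "filterlim (\<lambda>n. T n + real (J n)) at_top sequentially"
    then have inf_r: "filterlim (\<lambda>n. T (r n) + real (J (r n))) at_top sequentially"
      using filterlim_compose[OF inf filterlim_subseq[OF r]] by simp
    show "complete_arc y"
      unfolding complete_arc_def
    proof
      assume "bounded ((\<lambda>(t, j). (t, real j)) ` dom y)"
      then obtain K where K: "\<And>t j. (t, j) \<in> E \<Longrightarrow> norm (t, real j) \<le> K"
        unfolding bounded_iff dom_y by force
      have bd: "t \<le> K" "real j \<le> K" if "(t, j) \<in> E" for t j
        using K[OF that] norm_fst_le[of t "real j"] norm_snd_le[of "real j" t] by auto
      show False
      \<comment> \<open>Either every slice occurs at a finite time, and the number of jumps is
        unbounded, or there is a last slice that starts at a finite time, and it is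
        unbounded.\<close>
      proof (cases "\<forall>j. P j \<and> a j \<noteq> \<infinity>")
        case True
        obtain k where k: "K < real k"
          using reals_Archimedean2 by blast
        obtain t where "a k = ereal t"
          using True a_nonneg[of k] by (cases "a k") auto
        moreover have "a k \<le> a (Suc k)"
          by (rule LIMSEQ_le[OF a a]) (use \<tau>_Suc in auto)
        ultimately have "(t, k) \<in> E"
          using True by (simp add: E_def)
        then show False
          using bd(2) k by fastforce
      next
        case False
        have "\<exists>j. (P j \<and> a j \<noteq> \<infinity>) \<and> \<not> (P (Suc j) \<and> a (Suc j) \<noteq> \<infinity>)"
        proof (rule ccontr)
          assume *: "\<not> ?thesis"
          have "P j \<and> a j \<noteq> \<infinity>" for j
            by (induction j) (use * P0 a0 in auto)
          then show False using False by blast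
        qed
        then obtain j where j: "P j" "a j \<noteq> \<infinity>" "\<not> (P (Suc j) \<and> a (Suc j) \<noteq> \<infinity>)"
          by blast
        \<comment> \<open>If slice \<open>Suc j\<close> is missing, the windows eventually end in
          slice \<open>j\<close>; with \<open>J (r n) = j\<close> fixed, the growing lengths force
          the end times \<open>\<tau> (r n) (Suc j)\<close> to infinity.\<close>
        have "a (Suc j) = \<infinity>"
        proof (cases "P (Suc j)")
          case False
          have ev: "eventually (\<lambda>n. J (r n) = j) sequentially"
            using P_ev[OF j(1)] notP[OF False] by eventually_elim simp
          have "(\<lambda>n. ereal (\<tau> (r n) (Suc j))) \<longlonglongrightarrow> \<infinity>"
            unfolding tendsto_PInfty
          proof
            fix R :: real
            have "eventually (\<lambda>n. R + real j < T (r n) + real (J (r n))) sequentially"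
              using inf_r by (simp add: filterlim_at_top_dense)
            then show "eventually (\<lambda>n. ereal R < ereal (\<tau> (r n) (Suc j))) sequentially"
              using ev by eventually_elim (use \<tau>_end in auto)
          qed
          then show ?thesis
            using LIMSEQ_unique[OF a] by blast
        qed (use j in blast)
        moreover obtain t where "a j = ereal t"
          using j(2) a_nonneg[of j] by (cases "a j") auto
        ultimately have "(max t (K + 1), j) \<in> E"
          using j(1) by (simp add: E_def)
        then show False
          using bd(1) by fastforce
      qed
    qed
  qed
  then show ?thesis
    using sol_y by blast
qed

section \<open>Hitting times and stability in terms of solutions\<close>

lemma absolutely_continuous_imp_continuous_on:
  assumes "absolutely_continuous_on_interval a b f"
  shows "continuous_on {a..b} f"
  unfolding continuous_on_iff
proof (intro ballI allI impI)
  fix s e :: real assume s: "s \<in> {a..b}" and "0 < e"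
  then obtain d where d: "d > 0" "\<And>(m::nat) u v. (\<forall>i<m. a \<le> u i \<and> u i \<le> v i \<and> v i \<le> b) \<Longrightarrow>
        disjoint_family_on (\<lambda>i. {u i<..<v i}) {..<m} \<Longrightarrow>
        (\<Sum>i<m. v i - u i) < d \<Longrightarrow> (\<Sum>i<m. norm (f (v i) - f (u i))) < e"
    using assms unfolding absolutely_continuous_on_interval_def by meson
  have "dist (f t) (f s) < e" if t: "t \<in> {a..b}" "dist t s < d" for t
  proof (cases "s \<le> t")
    case True
    then show ?thesis
      using d(2)[of 1 "\<lambda>_. s" "\<lambda>_. t"] s t by (auto simp: disjoint_family_on_def dist_real_def dist_norm)
  next
    case False
    then show ?thesis
      using d(2)[of 1 "\<lambda>_. t" "\<lambda>_. s"] s t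
      by (auto simp: disjoint_family_on_def dist_real_def dist_norm norm_minus_commute)
  qed
  then show "\<exists>d>0. \<forall>t\<in>{a..b}. dist t s < d \<longrightarrow> dist (f t) (f s) < e"
    using d(1) by blast
qed

lemma absolutely_continuous_bounded_linear:
  assumes L: "bounded_linear L" and f: "absolutely_continuous_on_interval a b f"
  shows "absolutely_continuous_on_interval a b (\<lambda>t. L (f t))"
proof -
  obtain K where K: "0 < K" "\<And>z. norm (L z) \<le> norm z * K"
    using bounded_linear.pos_bounded[OF L] by blast
  have "norm (L (f v) - L (f u)) \<le> K * norm (f (0 + v) - f (0 + u))" for u v
    using K(2)[of "f v - f u"] by (simp add: linear_diff[OF bounded_linear.linear[OF L]] mult.commute)
  then show ?thesis
    by (intro absolutely_continuous_dominated[of 0 a b f K]) (use f K in auto)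
qed

text \<open>The inclusions are demanded on \<open>ran x\<close> only, because the projection to the
  first subsystem is available only where the second component vanishes.\<close>

lemma solution_bounded_linear_image:
  fixes L :: "'a::euclidean_space \<Rightarrow> 'b::euclidean_space"
  assumes L: "bounded_linear L" and x: "solution H x"
    and C: "\<And>z. z \<in> ran x \<Longrightarrow> z \<in> flow_set H \<Longrightarrow> L z \<in> flow_set H'"
    and F: "\<And>z v. z \<in> ran x \<Longrightarrow> v \<in> flow_map H z \<Longrightarrow> L v \<in> flow_map H' (L z)"
    and D: "\<And>z. z \<in> ran x \<Longrightarrow> z \<in> jump_set H \<Longrightarrow> L z \<in> jump_set H'"
    and G: "\<And>z v. z \<in> ran x \<Longrightarrow> v \<in> jump_map H z \<Longrightarrow> L v \<in> jump_map H' (L z)"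
  shows "solution H' (map_option L \<circ> x)"
  unfolding solution_iff_flow_arc
proof (intro conjI allI impI)
  have dom: "dom (map_option L \<circ> x) = dom x"
    by (auto simp: dom_def)
  have the_eq: "the ((map_option L \<circ> x) p) = L (the (x p))" if "p \<in> dom x" for p
    using that by auto
  have ran: "the (x p) \<in> ran x" if "p \<in> dom x" for p
    using that by (auto intro: ranI)
  show "hybrid_time_domain (dom (map_option L \<circ> x))"
    unfolding dom by (rule solution_time_domain[OF x])
  fix j
  let ?S = "time_slice x j" and ?f = "\<lambda>t. the (x (t, j))"
  have f: "flow_arc H ?S ?f"
    by (rule solution_flow_arc[OF x])
  have "flow_arc H' ?S (\<lambda>t. L (?f t))"
    unfolding flow_arc_def
  proof (intro conjI impI ballI)
    show "locally_absolutely_continuous_on ?S (\<lambda>t. L (?f t))"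
      using f absolutely_continuous_bounded_linear[OF L]
      unfolding flow_arc_def locally_absolutely_continuous_on_def by blast
    assume int: "interior ?S \<noteq> {}"
    show "negligible (flow_defect H' ?S (\<lambda>t. L (?f t)))"
    proof (rule negligible_subset)
      show "negligible (flow_defect H ?S ?f)"
        using f int unfolding flow_arc_def by blast
      have "\<exists>w\<in>flow_map H' (L (?f t)). ((\<lambda>t. L (?f t)) has_vector_derivative w) (at t within ?S)"
        if "t \<in> ?S" "v \<in> flow_map H (?f t)" "(?f has_vector_derivative v) (at t within ?S)" for t v
      proof (rule bexI)
        show "((\<lambda>t. L (?f t)) has_vector_derivative L v) (at t within ?S)"
          by (rule bounded_linear.has_vector_derivative[OF L that(3)])
        show "L v \<in> flow_map H' (L (?f t))"
          using F[OF ran that(2)] that(1) by (simp add: time_slice_def)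
      qed
      then show "flow_defect H' ?S (\<lambda>t. L (?f t)) \<subseteq> flow_defect H ?S ?f"
        unfolding flow_defect_def by blast
    qed
    fix t assume t: "t \<in> ?S" "\<exists>s\<in>?S. t < s"
    then have "?f t \<in> flow_set H"
      using f int unfolding flow_arc_def by blast
    then show "L (?f t) \<in> flow_set H'"
      using C[OF ran] t(1) by (simp add: time_slice_def)
  qed
  moreover have "time_slice (map_option L \<circ> x) j = ?S"
    unfolding time_slice_def dom ..
  ultimately show "flow_arc H' (time_slice (map_option L \<circ> x) j) (\<lambda>t. the ((map_option L \<circ> x) (t, j)))"
    using the_eq flow_arc_cong[of H' ?S "\<lambda>t. L (?f t)" "\<lambda>t. the ((map_option L \<circ> x) (t, j))"]
    by (simp add: time_slice_def)
next
  fix t j assume "(t, j) \<in> dom (map_option L \<circ> x)" "(t, Suc j) \<in> dom (map_option L \<circ> x)"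
  then have tj: "(t, j) \<in> dom x" "(t, Suc j) \<in> dom x"
    by (auto simp: dom_def)
  have ran: "the (x (t, j)) \<in> ran x"
    using tj(1) by (auto intro: ranI)
  have eq: "the ((map_option L \<circ> x) (t, j)) = L (the (x (t, j)))"
    "the ((map_option L \<circ> x) (t, Suc j)) = L (the (x (t, Suc j)))"
    using tj by auto
  show "the ((map_option L \<circ> x) (t, j)) \<in> jump_set H'"
    "the ((map_option L \<circ> x) (t, Suc j)) \<in> jump_map H' (the ((map_option L \<circ> x) (t, j)))"
    unfolding eq using solution_jump[OF x tj] D[OF ran] G[OF ran] by blast+
qed

section \<open>Hitting times of closed sets\<close>

lemma solution_continuous_on:
  assumes "solution H x" "\<And>t. a \<le> t \<Longrightarrow> t \<le> b \<Longrightarrow> (t, j) \<in> dom x"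
  shows "continuous_on {a..b} (\<lambda>t. the (x (t, j)))"
proof (rule absolutely_continuous_imp_continuous_on)
  have "{a..b} \<subseteq> time_slice x j"
    unfolding time_slice_def using assms(2) by (intro subsetI CollectI) simp
  then show "absolutely_continuous_on_interval a b (\<lambda>t. the (x (t, j)))"
    using solution_flow_arc[OF assms(1), of j] unfolding flow_arc_def locally_absolutely_continuous_on_def by blast
qed

text \<open>Up to \<open>(T, J)\<close> every slice is a compact interval, even if the full slice is
  half-open or unbounded; this is why first and last hitting times are attained.\<close>

lemma solution_hitting_times_compact:
  assumes x: "solution H x" and A: "closed A" and TJ: "(T, J) \<in> dom x" and I: "I \<le> J"
  shows "compact {t. (t, I) \<in> dom x \<and> t \<le> T \<and> the (x (t, I)) \<in> A}" (is "compact ?Z")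
proof -
  obtain \<tau> where \<tau>: "\<And>t j. j \<le> J \<Longrightarrow> \<tau> j \<le> t \<Longrightarrow> t \<le> \<tau> (Suc j) \<Longrightarrow> (t, j) \<in> dom x"
    "\<And>t j. (t, j) \<in> dom x \<Longrightarrow> j \<le> J \<Longrightarrow> t \<le> T \<Longrightarrow> \<tau> j \<le> t \<and> t \<le> \<tau> (Suc j)"
    "incseq \<tau>" "\<tau> (Suc J) = T"
    using hybrid_time_domain_truncation[OF solution_time_domain[OF x] TJ] by (metis lessI)
  have "\<tau> (Suc I) \<le> T"
    using incseqD[OF \<tau>(3), of "Suc I" "Suc J"] I \<tau>(4) by simp
  then have Z: "?Z = {\<tau> I..\<tau> (Suc I)} \<inter> (\<lambda>t. the (x (t, I))) -` A"
    using \<tau>(1)[OF I] \<tau>(2)[OF _ I] order_trans[of _ "\<tau> (Suc I)" T]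
    unfolding set_eq_iff Int_iff mem_Collect_eq vimage_eq atLeastAtMost_iff by metis
  have "closed ?Z"
    unfolding Z
    by (intro continuous_closed_preimage[OF solution_continuous_on[OF x \<tau>(1)[OF I]]] closed_atLeastAtMost A)
  then have "compact ({\<tau> I..\<tau> (Suc I)} \<inter> ?Z)"
    by (intro compact_Int_closed compact_Icc)
  moreover have "{\<tau> I..\<tau> (Suc I)} \<inter> ?Z = ?Z"
    unfolding Z by blast
  ultimately show ?thesis by simp
qed

text \<open>The first hit in the order of hybrid time: the least jump index with a hit, and in its
  slice the least time, which exists by compactness.\<close>

lemma solution_first_hit:
  assumes x: "solution H x" and A: "closed A" and TJ: "(T, J) \<in> dom x" "the (x (T, J)) \<in> A"
  obtains S I where "(S, I) \<in> dom x" "the (x (S, I)) \<in> A"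
    "\<And>t j. (t, j) \<in> dom x \<Longrightarrow> t \<le> S \<Longrightarrow> j \<le> I \<Longrightarrow> (t, j) \<noteq> (S, I) \<Longrightarrow> the (x (t, j)) \<notin> A"
proof -
  define Z where "Z j = {t. (t, j) \<in> dom x \<and> t \<le> T \<and> the (x (t, j)) \<in> A}" for j
  define I where "I = (LEAST j. Z j \<noteq> {})"
  have J: "Z J \<noteq> {}"
    using TJ by (auto simp: Z_def)
  have I: "Z I \<noteq> {}" "I \<le> J" and min_I: "\<And>j. j < I \<Longrightarrow> Z j = {}"
    unfolding I_def using LeastI[of "\<lambda>j. Z j \<noteq> {}", OF J] Least_le[of "\<lambda>j. Z j \<noteq> {}", OF J]
      not_less_Least[of _ "\<lambda>j. Z j \<noteq> {}"] by blast+
  have "compact (Z I)"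
    unfolding Z_def by (rule solution_hitting_times_compact[OF x A TJ(1) I(2)])
  from compact_attains_inf[OF this I(1)] obtain S where S: "S \<in> Z I" "\<And>t. t \<in> Z I \<Longrightarrow> S \<le> t"
    by auto
  show thesis
  proof (rule that)
    show "(S, I) \<in> dom x" "the (x (S, I)) \<in> A"
      using S(1) by (simp_all add: Z_def)
    fix t j assume *: "(t, j) \<in> dom x" "t \<le> S" "j \<le> I" "(t, j) \<noteq> (S, I)"
    show "the (x (t, j)) \<notin> A"
    proof
      assume "the (x (t, j)) \<in> A"
      then have "t \<in> Z j"
        using * S(1) by (simp add: Z_def)
      then show False
        using min_I[of j] S(2)[of t] * by (cases "j = I") auto
    qed
  qed
qed

lemma solution_last_visit:
  assumes x: "solution H x" and A: "closed A" and TJ: "(T, J) \<in> dom x"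
    and visit: "(t0, j0) \<in> dom x" "t0 \<le> T" "j0 \<le> J" "the (x (t0, j0)) \<in> A"
  obtains S I where "(S, I) \<in> dom x" "S \<le> T" "I \<le> J" "the (x (S, I)) \<in> A"
    "\<And>t j. (t, j) \<in> dom x \<Longrightarrow> S \<le> t \<Longrightarrow> I \<le> j \<Longrightarrow> t \<le> T \<Longrightarrow> j \<le> J \<Longrightarrow> (t, j) \<noteq> (S, I) \<Longrightarrow> the (x (t, j)) \<notin> A"
proof -
  define Z where "Z j = {t. (t, j) \<in> dom x \<and> t \<le> T \<and> the (x (t, j)) \<in> A}" for j
  define I where "I = Max {j. j \<le> J \<and> Z j \<noteq> {}}"
  have fin: "finite {j. j \<le> J \<and> Z j \<noteq> {}}" and ne: "{j. j \<le> J \<and> Z j \<noteq> {}} \<noteq> {}"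
    using visit by (auto simp: Z_def)
  have I: "I \<le> J" "Z I \<noteq> {}" "\<And>j. j \<le> J \<Longrightarrow> Z j \<noteq> {} \<Longrightarrow> j \<le> I"
    using Max_in[OF fin ne] Max_ge[OF fin] by (auto simp: I_def)
  have "compact (Z I)"
    unfolding Z_def by (rule solution_hitting_times_compact[OF x A TJ I(1)])
  from compact_attains_sup[OF this I(2)] obtain S where S: "S \<in> Z I" "\<And>t. t \<in> Z I \<Longrightarrow> t \<le> S"
    by auto
  show thesis
  proof (rule that[OF _ _ I(1)])
    show "(S, I) \<in> dom x" "S \<le> T" "the (x (S, I)) \<in> A"
      using S(1) by (simp_all add: Z_def)
    fix t j assume *: "(t, j) \<in> dom x" "S \<le> t" "I \<le> j" "t \<le> T" "j \<le> J" "(t, j) \<noteq> (S, I)"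
    show "the (x (t, j)) \<notin> A"
    proof
      assume "the (x (t, j)) \<in> A"
      then have t: "t \<in> Z j"
        using * by (simp add: Z_def)
      then have "j = I"
        using I(3)[of j] * by auto
      then show False
        using S(2)[of t] t * by auto
    qed
  qed
qed

text \<open>A point other than the origin is reached either by flowing, and is then a limit of
  earlier values, or by a jump from an earlier value. At a first exit this bounds the state even if
  a jump overshoots.\<close>

lemma solution_value_after:
  assumes x: "solution H x" and SI: "(S, I) \<in> dom x" "(S, I) \<noteq> (0, 0)"
    and before: "\<And>t j. (t, j) \<in> dom x \<Longrightarrow> t \<le> S \<Longrightarrow> j \<le> I \<Longrightarrow> (t, j) \<noteq> (S, I) \<Longrightarrow> the (x (t, j)) \<in> U"
  shows "the (x (S, I)) \<in> closure U \<or> (\<exists>z\<in>U \<inter> jump_set H. the (x (S, I)) \<in> jump_map H z)"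
proof -
  obtain \<tau> where \<tau>: "\<And>t j. j \<le> I \<Longrightarrow> \<tau> j \<le> t \<Longrightarrow> t \<le> \<tau> (Suc j) \<Longrightarrow> (t, j) \<in> dom x"
    "incseq \<tau>" "\<tau> (Suc I) = S" "\<tau> 0 = 0"
    using hybrid_time_domain_truncation[OF solution_time_domain[OF x] SI(1)] by (metis lessI)
  have le: "\<tau> I \<le> S"
    using incseq_SucD[OF \<tau>(2), of I] \<tau>(3) by simp
  show ?thesis
  proof (cases "\<tau> I < S")
    case True
    have cont: "continuous_on {\<tau> I..S} (\<lambda>t. the (x (t, I)))"
      using \<tau>(1)[of I] \<tau>(3) by (intro solution_continuous_on[OF x]) auto
    have "(\<lambda>t. the (x (t, I))) ` closure {\<tau> I<..<S} \<subseteq> closure U"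
    proof (rule image_closure_subset)
      show "continuous_on (closure {\<tau> I<..<S}) (\<lambda>t. the (x (t, I)))"
        using cont True by simp
      have "the (x (t, I)) \<in> U" if "t \<in> {\<tau> I<..<S}" for t
        using before[of t I] \<tau>(1)[of I t] \<tau>(3) that by simp
      then show "(\<lambda>t. the (x (t, I))) ` {\<tau> I<..<S} \<subseteq> closure U"
        using closure_subset by blast
    qed simp
    then show ?thesis
      using True by auto
  next
    case False
    then have S: "S = \<tau> I" using le by simp
    show ?thesis
    proof (cases I)
      case 0
      then show ?thesis using S SI(2) \<tau>(4) by simp
    next
      case (Suc i)
      have Si: "(S, i) \<in> dom x"
        using \<tau>(1)[of i S] S Suc incseq_SucD[OF \<tau>(2), of i] by simp
      have "the (x (S, i)) \<in> U"
        by (rule before[OF Si]) (use Suc in auto)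
      moreover have "the (x (S, i)) \<in> jump_set H \<and> the (x (S, I)) \<in> jump_map H (the (x (S, i)))"
        using solution_jump[OF x Si] SI(1) Suc by simp
      ultimately show ?thesis by blast
    qed
  qed
qed

section \<open>Convergence and completeness, and the passage from maximal to arbitrary
  solutions\<close>

lemma converges_to_set_iff:
  "converges_to_set x \<Gamma> \<longleftrightarrow>
     (\<forall>e>0. \<exists>N. \<forall>t j. (t, j) \<in> dom x \<longrightarrow> N \<le> t + real j \<longrightarrow> infdist (the (x (t, j))) \<Gamma> < e)"
proof -
  have "eventually Q (inf (filtercomap (\<lambda>(t, j). t + real j) at_top) (principal (dom x))) \<longleftrightarrow>
    (\<exists>N. \<forall>t j. (t, j) \<in> dom x \<longrightarrow> N \<le> t + real j \<longrightarrow> Q (t, j))" for Q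
    unfolding eventually_inf_principal eventually_filtercomap eventually_at_top_linorder
  proof
    assume "\<exists>Qa. (\<exists>N. \<forall>n\<ge>N. Qa n) \<and> (\<forall>p. Qa (case p of (t, j) \<Rightarrow> t + real j) \<longrightarrow> p \<in> dom x \<longrightarrow> Q p)"
    then show "\<exists>N. \<forall>t j. (t, j) \<in> dom x \<longrightarrow> N \<le> t + real j \<longrightarrow> Q (t, j)"
      by fastforce
  next
    assume "\<exists>N. \<forall>t j. (t, j) \<in> dom x \<longrightarrow> N \<le> t + real j \<longrightarrow> Q (t, j)"
    then obtain N where "\<forall>t j. (t, j) \<in> dom x \<longrightarrow> N \<le> t + real j \<longrightarrow> Q (t, j)"
      by blast
    then show "\<exists>Qa. (\<exists>N. \<forall>n\<ge>N. Qa n) \<and> (\<forall>p. Qa (case p of (t, j) \<Rightarrow> t + real j) \<longrightarrow> p \<in> dom x \<longrightarrow> Q p)"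
      by (intro exI[of _ "\<lambda>s. N \<le> s"]) auto
  qed
  then show ?thesis
    unfolding converges_to_set_def tendsto_iff dist_real_def by (simp add: infdist_nonneg)
qed

lemma complete_arc_iff:
  assumes dom: "hybrid_time_domain (dom x)"
  shows "complete_arc x \<longleftrightarrow> (\<forall>N. \<exists>t j. (t, j) \<in> dom x \<and> N \<le> t + real j)"
proof
  assume c: "complete_arc x"
  show "\<forall>N. \<exists>t j. (t, j) \<in> dom x \<and> N \<le> t + real j"
  proof (rule ccontr)
    assume "\<not> ?thesis"
    then obtain N where N: "\<And>t j. (t, j) \<in> dom x \<Longrightarrow> t + real j < N"
      by (auto simp: not_le)
    have "norm z \<le> N" if z: "z \<in> (\<lambda>(t, j). (t, real j)) ` dom x" for z
    proof -
      obtain t j where tj: "(t, j) \<in> dom x" "z = (t, real j)"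
        using z by force
      have "norm z \<le> norm t + norm (real j)"
        unfolding tj(2) by (rule norm_Pair_le)
      then show ?thesis
        using N[OF tj(1)] hybrid_time_domain_nonneg[OF dom tj(1)] by simp
    qed
    then show False
      using c unfolding complete_arc_def bounded_iff by blast
  qed
next
  assume *: "\<forall>N. \<exists>t j. (t, j) \<in> dom x \<and> N \<le> t + real j"
  show "complete_arc x"
    unfolding complete_arc_def
  proof
    assume "bounded ((\<lambda>(t, j). (t, real j)) ` dom x)"
    then obtain B where B: "\<And>t j. (t, j) \<in> dom x \<Longrightarrow> norm (t, real j) \<le> B"
      unfolding bounded_iff by force
    obtain t j where tj: "(t, j) \<in> dom x" "2 * B + 1 \<le> t + real j"
      using * by blast
    have "t \<le> norm (t, real j)" "real j \<le> norm (t, real j)"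
      using norm_fst_le[of t "real j"] norm_snd_le[of "real j" t] by auto
    then show False
      using B[OF tj(1)] tj(2) by linarith
  qed
qed

lemma map_le_the:
  assumes "x \<subseteq>\<^sub>m y" "p \<in> dom x"
  shows "y p = Some (the (x p))"
  using assms unfolding map_le_def by (metis domIff option.collapse)

lemma stable_solutions:
  assumes st: "stable H \<Gamma>" and e: "0 < e"
  obtains d where "0 < d"
    "\<And>x p. solution H x \<Longrightarrow> infdist (the (x (0, 0))) \<Gamma> < d \<Longrightarrow> p \<in> dom x \<Longrightarrow> infdist (the (x p)) \<Gamma> < e"
proof -
  obtain d where d: "0 < d" "rge (solutions_from H (set_nbhd d \<Gamma>)) \<subseteq> set_nbhd e \<Gamma>"
    using st e unfolding stable_def by blast
  show thesis
  proof (rule that[OF d(1)])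
    fix x p assume x: "solution H x" "infdist (the (x (0, 0))) \<Gamma> < d" "p \<in> dom x"
    obtain y where y: "maximal_solution H y" "x \<subseteq>\<^sub>m y"
      using maximal_extension_exists[OF x(1)] by blast
    have "y (0, 0) = Some (the (x (0, 0)))"
      by (rule map_le_the[OF y(2) solution_start_dom[OF x(1)]])
    then have "y \<in> solutions_from H (set_nbhd d \<Gamma>)"
      using y(1) x(2) by (auto simp: solutions_from_def set_nbhd_def)
    moreover have "the (x p) \<in> ran y"
      using map_le_the[OF y(2) x(3)] by (rule ranI)
    ultimately have "the (x p) \<in> set_nbhd e \<Gamma>"
      using d(2) unfolding rge_def by blast
    then show "infdist (the (x p)) \<Gamma> < e"
      by (simp add: set_nbhd_def)
  qed
qed

text \<open>A maximal extension of a complete arc is complete, and its convergence restricts to the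
  smaller domain.\<close>

lemma basin_of_attraction_solutions:
  assumes x: "solution H x" "the (x (0, 0)) \<in> basin_of_attraction H \<Gamma>" "complete_arc x"
  shows "converges_to_set x \<Gamma>"
proof -
  obtain y where y: "maximal_solution H y" "x \<subseteq>\<^sub>m y"
    using maximal_extension_exists[OF x(1)] by blast
  have "y (0, 0) = Some (the (x (0, 0)))"
    by (rule map_le_the[OF y(2) solution_start_dom[OF x(1)]])
  then have "y \<in> solutions_from H {the (x (0, 0))}"
    using y(1) by (auto simp: solutions_from_def)
  moreover have sub: "dom x \<subseteq> dom y"
    using y(2) by (rule map_le_implies_dom_le)
  have "complete_arc y"
    using x(3) bounded_subset[OF _ image_mono[OF sub]] unfolding complete_arc_def by blast
  ultimately have "converges_to_set y \<Gamma>"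
    using x(2) by (auto simp: basin_of_attraction_def)
  moreover have "x p = y p" if "p \<in> dom x" for p
    using y(2) that by (auto simp: map_le_def)
  ultimately show ?thesis
    using sub unfolding converges_to_set_iff by (metis subsetD)
qed

section \<open>Cascades\<close>

text \<open>The triangular structure is expressed by projections: the second component always
  satisfies the inclusions of \<open>H2\<close>, the first one those of \<open>H1\<close> only over
  \<open>snd z = 0\<close>. \<open>K\<close> is nonempty so that nearest points exist and
  \<open>infdist\<close> is a genuine distance.\<close>

locale cascade =
  fixes H :: "('a::euclidean_space \<times> 'b::euclidean_space) hybrid_system"
    and H1 :: "'a hybrid_system" and H2 :: "'b hybrid_system" and K :: "'a set"
  assumes BA: "basic_assumptions H" and K: "compact K" "K \<noteq> {}"
    and flow_set_fst: "\<And>z. z \<in> flow_set H \<Longrightarrow> fst z \<in> flow_set H1"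
    and flow_set_snd: "\<And>z. z \<in> flow_set H \<Longrightarrow> snd z \<in> flow_set H2"
    and jump_set_fst: "\<And>z. z \<in> jump_set H \<Longrightarrow> fst z \<in> jump_set H1"
    and jump_set_snd: "\<And>z. z \<in> jump_set H \<Longrightarrow> snd z \<in> jump_set H2"
    and flow_map_fst: "\<And>z v. snd z = 0 \<Longrightarrow> v \<in> flow_map H z \<Longrightarrow> fst v \<in> flow_map H1 (fst z)"
    and flow_map_snd: "\<And>z v. v \<in> flow_map H z \<Longrightarrow> snd v \<in> flow_map H2 (snd z)"
    and jump_map_fst: "\<And>z v. snd z = 0 \<Longrightarrow> v \<in> jump_map H z \<Longrightarrow> fst v \<in> jump_map H1 (fst z)"
    and jump_map_snd: "\<And>z v. v \<in> jump_map H z \<Longrightarrow> snd v \<in> jump_map H2 (snd z)"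
begin

abbreviation \<Gamma> :: "('a \<times> 'b) set" where "\<Gamma> \<equiv> K \<times> {0}"

lemma K_nearest:
  obtains k where "k \<in> K" "infdist p K = dist p k"
  using infdist_attains_inf[OF compact_imp_closed[OF K(1)] K(2)] by blast

lemma \<Gamma>_nearest:
  obtains k where "k \<in> K" "infdist z \<Gamma> = dist z (k, 0)"
proof -
  have "closed \<Gamma>" "\<Gamma> \<noteq> {}"
    using K by (auto intro!: compact_imp_closed compact_Times)
  then obtain w where "w \<in> \<Gamma>" "infdist z \<Gamma> = dist z w"
    using infdist_attains_inf by blast
  then show thesis
    using that by auto
qed

lemma infdist_fst_le: "infdist (fst z) K \<le> infdist z \<Gamma>"
proof -
  obtain k where k: "k \<in> K" "infdist z \<Gamma> = dist z (k, 0)"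
    by (rule \<Gamma>_nearest)
  show ?thesis
    using infdist_le[OF k(1), of "fst z"] dist_fst_le[of z "(k, 0)"] k(2) by simp
qed

lemma norm_snd_le_infdist: "norm (snd z) \<le> infdist z \<Gamma>"
proof -
  obtain k where k: "k \<in> K" "infdist z \<Gamma> = dist z (k, 0)"
    by (rule \<Gamma>_nearest)
  show ?thesis
    using dist_snd_le[of z "(k, 0)"] k(2) by simp
qed

lemma infdist_le_fst_snd: "infdist z \<Gamma> \<le> infdist (fst z) K + norm (snd z)"
proof -
  obtain k where k: "k \<in> K" "infdist (fst z) K = dist (fst z) k"
      by (rule K_nearest)
  have "infdist z \<Gamma> \<le> dist z (k, 0)"
    using k(1) by (intro infdist_le) auto
  also have "\<dots> = norm (fst z - k, snd z)"
    by (cases z) (simp add: dist_norm)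
  also have "\<dots> \<le> norm (fst z - k) + norm (snd z)"
    by (rule norm_Pair_le)
  finally show ?thesis
    using k(2) by (simp add: dist_norm)
qed

lemma solution_snd: "solution H x \<Longrightarrow> solution H2 (map_option snd \<circ> x)"
  by (rule solution_bounded_linear_image[OF bounded_linear_snd])
     (use flow_set_snd jump_set_snd flow_map_snd jump_map_snd in blast)+

lemma stable_snd:
  assumes st: "stable H2 {0}" and e: "0 < e"
  obtains d where "0 < d"
    "\<And>x p. solution H x \<Longrightarrow> norm (snd (the (x (0, 0)))) < d \<Longrightarrow> p \<in> dom x \<Longrightarrow> norm (snd (the (x p))) < e"
proof -
  obtain d where d: "0 < d"
    "\<And>x p. solution H2 x \<Longrightarrow> infdist (the (x (0, 0))) {0} < d \<Longrightarrow> p \<in> dom x \<Longrightarrow> infdist (the (x p)) {0} < e"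
    using stable_solutions[OF st e] by blast
  show thesis
  proof (rule that[OF d(1)])
    fix x p assume x: "solution H x" "norm (snd (the (x (0, 0)))) < d" "p \<in> dom x"
    have eq: "the ((map_option snd \<circ> x) p) = snd (the (x p))" if "p \<in> dom x" for p
      using that by auto
    have "the ((map_option snd \<circ> x) (0, 0)) = snd (the (x (0, 0)))"
      by (rule eq[OF solution_start_dom[OF x(1)]])
    then have "infdist (the ((map_option snd \<circ> x) (0, 0))) {0} < d"
      using x(2) by (simp del: comp_apply)
    moreover have "p \<in> dom (map_option snd \<circ> x)"
      using x(3) by (auto simp: dom_def)
    ultimately have "infdist (the ((map_option snd \<circ> x) p)) {0} < e"
      using d(2) solution_snd[OF x(1)] by blast
    then show "norm (snd (the (x p))) < e"
      using x(3) by (simp only: eq) simp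
  qed
qed

text \<open>The limit is taken for the whole system \<open>H\<close>, since the first components by
  themselves need not solve \<open>H1\<close>. In the limit the second component vanishes
  identically, and only then is the first one projected.\<close>

lemma limit_solution_fst:
  fixes x :: "nat \<Rightarrow> ('a \<times> 'b) arc"
  assumes sol: "\<And>n. solution H (x n)" and end_dom: "\<And>n. (T n, J n) \<in> dom (x n)"
    and near: "\<forall>n t j. (t, j) \<in> dom (x n) \<longrightarrow> t \<le> T n \<longrightarrow> j \<le> J n \<longrightarrow>
      norm (the (x n (t, j))) \<le> R \<and> norm (snd (the (x n (t, j)))) \<le> \<eta> n"
    and \<eta>: "\<eta> \<longlonglongrightarrow> 0"
  shows "\<exists>r y. solution H1 y \<and> window_limit fst x T J r y"
proof -
  have in_ball: "\<forall>n t j. (t, j) \<in> dom (x n) \<longrightarrow> t \<le> T n \<longrightarrow> j \<le> J n \<longrightarrow> the (x n (t, j)) \<in> cball 0 R"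
    using near by simp
  obtain r y where y: "solution H y" and lim: "window_limit (\<lambda>z. z) x T J r y"
    using solutions_compactness[of H x T J "cball 0 R", OF BA sol end_dom compact_cball in_ball] by blast
  have snd0: "snd (the (y p)) = 0" if p: "p \<in> dom y" for p
  proof -
    obtain t j where tj: "p = (t, j)" "(t, j) \<in> dom y"
      using p by (cases p) simp
    obtain s where "s \<longlonglongrightarrow> t" and s: "(\<lambda>n. the (x (r n) (s n, j))) \<longlonglongrightarrow> the (y (t, j))"
      "eventually (\<lambda>n. (s n, j) \<in> dom (x (r n)) \<and> s n \<le> T (r n) \<and> j \<le> J (r n)) sequentially"
      by (rule window_limit_approx[OF lim tj(2)])
    have "(\<lambda>n. \<eta> (r n)) \<longlonglongrightarrow> 0"
      using LIMSEQ_subseq_LIMSEQ[OF \<eta> window_limit_subseq[OF lim]] by (simp add: o_def)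
    moreover have "eventually (\<lambda>n. norm (snd (the (x (r n) (s n, j)))) \<le> \<eta> (r n)) sequentially"
      using s(2) by eventually_elim (use near in blast)
    ultimately have "(\<lambda>n. snd (the (x (r n) (s n, j)))) \<longlonglongrightarrow> 0"
      by (rule Lim_null_comparison[rotated])
    then show ?thesis
      using LIMSEQ_unique tendsto_snd[OF s(1)] tj(1) by auto
  qed
  have ran0: "snd z = 0" if "z \<in> ran y" for z
    using that snd0 unfolding ran_def by fastforce
  let ?y = "map_option fst \<circ> y"
  have dom: "dom ?y = dom y"
    by (auto simp: dom_def)
  have eq: "the (?y p) = fst (the (y p))" if "p \<in> dom y" for p
    using that by auto
  have "solution H1 ?y"
    by (rule solution_bounded_linear_image[OF bounded_linear_fst y])
       (use flow_set_fst jump_set_fst flow_map_fst jump_map_fst ran0 in blast)+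
  moreover have "window_limit fst x T J r ?y"
    unfolding window_limit_def dom
  proof (intro conjI allI impI)
    show "strict_mono r"
      by (rule window_limit_subseq[OF lim])
    fix t j assume tj: "(t, j) \<in> dom y"
    show "\<exists>s. s \<longlonglongrightarrow> t \<and> (\<lambda>n. fst (the (x (r n) (s n, j)))) \<longlonglongrightarrow> the (?y (t, j)) \<and>
       eventually (\<lambda>n. (s n, j) \<in> dom (x (r n)) \<and> s n \<le> T (r n) \<and> j \<le> J (r n)) sequentially"
      unfolding eq[OF tj] by (rule window_limit_approx[OF lim tj]) (use tendsto_fst in blast)
  next
    show "(\<lambda>n. fst (the (x (r n) (0, 0)))) \<longlonglongrightarrow> the (?y (0, 0))"
      unfolding eq[OF solution_start_dom[OF y]]
      by (rule tendsto_fst[OF window_limit_start[OF lim]])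
  next
    fix N assume "\<forall>n. T n + real (J n) \<le> N"
    then obtain t j where tj: "(t, j) \<in> dom y" "(\<lambda>n. the (x (r n) (T (r n), J (r n)))) \<longlonglongrightarrow> the (y (t, j))"
      using window_limit_end[OF lim] by blast
    have "(\<lambda>n. fst (the (x (r n) (T (r n), J (r n))))) \<longlonglongrightarrow> the (?y (t, j))"
      unfolding eq[OF tj(1)] by (rule tendsto_fst[OF tj(2)])
    then show "\<exists>t j. (t, j) \<in> dom y \<and> (\<lambda>n. fst (the (x (r n) (T (r n), J (r n))))) \<longlonglongrightarrow> the (?y (t, j))"
      using tj(1) by blast
  next
    assume "filterlim (\<lambda>n. T n + real (J n)) at_top sequentially"
    then show "complete_arc ?y"
      using window_limit_complete[OF lim] unfolding complete_arc_def dom by blast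
  qed
  ultimately show ?thesis
    by blast
qed

section \<open>Stability of the cascade\<close>

lemma closed_sublevel: "closed {z :: 'a \<times> 'b. infdist (fst z) K \<le> c}"
  and closed_superlevel: "closed {z :: 'a \<times> 'b. c \<le> infdist (fst z) K}"
  by (intro closed_Collect_le continuous_intros)+

lemma bounded_tube: "bounded {z :: 'a \<times> 'b. infdist (fst z) K \<le> c \<and> norm (snd z) \<le> b}"
proof -
  obtain B where B: "\<And>k. k \<in> K \<Longrightarrow> norm k \<le> B"
    using compact_imp_bounded[OF K(1)] unfolding bounded_iff by blast
  have "norm z \<le> (B + c) + b" if z: "infdist (fst z) K \<le> c" "norm (snd z) \<le> b" for z :: "'a \<times> 'b"
  proof -
    obtain k where k: "k \<in> K" "infdist (fst z) K = dist (fst z) k"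
      by (rule K_nearest)
    have "norm (fst z) \<le> norm k + dist (fst z) k"
      using norm_triangle_ineq[of k "fst z - k"] by (simp add: dist_norm)
    then have "norm (fst z) \<le> B + c"
      using B[OF k(1)] k(2) z(1) by linarith
    then show ?thesis
      using norm_Pair_le[of "fst z" "snd z"] z(2) by simp
  qed
  then show ?thesis
    unfolding bounded_iff by blast
qed

text \<open>If solutions starting ever closer to \<open>\<Gamma>\<close> left a fixed neighbourhood, cut them to the window
  between the last visit to a smaller neighbourhood and the first exit.  In the limit of the windows
  the first subsystem has a solution that starts in the smaller neighbourhood and either leaves the
  large one or, when the lengths of the windows are unbounded, never converges to \<open>K\<close>.\<close>

lemma fst_stays_near:
  assumes st1: "stable H1 K" and basin: "\<And>p. infdist p K \<le> c \<Longrightarrow> p \<in> basin_of_attraction H1 K"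
    and st2: "stable H2 {0}" and c: "0 < c" and e: "0 < e"
  obtains d where "0 < d"
    "\<And>x p. solution H x \<Longrightarrow> infdist (the (x (0, 0))) \<Gamma> < d \<Longrightarrow> p \<in> dom x \<Longrightarrow> infdist (fst (the (x p))) K < e"
proof -
  obtain d1 where d1: "0 < d1"
    "\<And>x p. solution H1 x \<Longrightarrow> infdist (the (x (0, 0))) K < d1 \<Longrightarrow> p \<in> dom x \<Longrightarrow> infdist (the (x p)) K < e"
    using stable_solutions[OF st1 e] by blast
  \<comment> \<open>Below \<open>d1\<close> so that limits of windows of bounded length stay within
    \<open>e\<close>, at most \<open>c\<close> so that limits of unbounded ones start in the basin,
    and below \<open>e\<close> so that no window shrinks to a point.\<close>
  define d' where "d' = min (min d1 c) e / 2"
  have d': "0 < d'" "d' < d1" "d' \<le> c" "d' < e"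
    using d1(1) c e by (auto simp: d'_def)
  have "\<exists>d>0. \<forall>x p. solution H x \<longrightarrow> norm (snd (the (x (0, 0)))) < d \<longrightarrow> p \<in> dom x \<longrightarrow>
      norm (snd (the (x p))) < inverse (real (Suc n))" for n
    using stable_snd[OF st2, of "inverse (real (Suc n))"] by (metis inverse_positive_iff_positive of_nat_0_less_iff zero_less_Suc)
  then obtain d2 where d2: "\<And>n. 0 < d2 n"
    "\<And>n x p. solution H x \<Longrightarrow> norm (snd (the (x (0, 0)))) < d2 n \<Longrightarrow> p \<in> dom x \<Longrightarrow>
      norm (snd (the (x p))) < inverse (real (Suc n))"
    by metis
  define tube where "tube = {z :: 'a \<times> 'b. infdist (fst z) K \<le> e \<and> norm (snd z) \<le> 1}"
  have "compact tube"
  proof -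
    have "tube = {z. infdist (fst z) K \<le> e} \<inter> {z. norm (snd z) \<le> 1}"
      by (auto simp: tube_def)
    moreover have "closed {z :: 'a \<times> 'b. norm (snd z) \<le> 1}"
      by (intro closed_Collect_le continuous_intros)
    ultimately have "closed tube"
      using closed_sublevel by auto
    moreover have "bounded tube"
      unfolding tube_def by (rule bounded_tube)
    ultimately show ?thesis
      by (simp add: compact_eq_bounded_closed)
  qed
  \<comment> \<open>The exit may be a jump that lands far outside the tube, so the bound must cover
    the jump image of the tube as well.\<close>
  then have "bounded (tube \<union> (\<Union>z\<in>tube \<inter> jump_set H. jump_map H z))"
    using BA locally_bounded_on_compact[of "jump_set H" "jump_map H" tube] compact_imp_bounded
    by (auto simp: basic_assumptions_def)
  then obtain R where R: "\<And>z. z \<in> tube \<union> (\<Union>z\<in>tube \<inter> jump_set H. jump_map H z) \<Longrightarrow> norm z \<le> R"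
    unfolding bounded_iff by blast
  show thesis
  proof (rule ccontr)
    assume no: "\<not> thesis"
    define window where "window n y T J \<longleftrightarrow>
        solution H y \<and> (T, J) \<in> dom y \<and> infdist (fst (the (y (0, 0)))) K \<le> d' \<and>
        e \<le> infdist (fst (the (y (T, J)))) K \<and>
        (\<forall>t j. (t, j) \<in> dom y \<longrightarrow> t \<le> T \<longrightarrow> j \<le> J \<longrightarrow>
           norm (the (y (t, j))) \<le> R \<and> norm (snd (the (y (t, j)))) \<le> inverse (real (Suc n)) \<and>
           ((t, j) \<noteq> (0, 0) \<longrightarrow> d' < infdist (fst (the (y (t, j)))) K))" for n y T J
    have "\<exists>y T J. window n y T J" for n
    proof -
      have pos: "0 < min d' (d2 n)"
        using d' d2 by simp
      have "\<exists>x p. solution H x \<and> infdist (the (x (0, 0))) \<Gamma> < min d' (d2 n) \<and> p \<in> dom x \<and> e \<le> infdist (fst (the (x p))) K"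
        using no that[OF pos] by (meson not_le)
      then obtain x T0 J0 where x: "solution H x" "infdist (the (x (0, 0))) \<Gamma> < min d' (d2 n)"
        and out0: "(T0, J0) \<in> dom x" "the (x (T0, J0)) \<in> {z. e \<le> infdist (fst z) K}"
        by auto
      have dom: "hybrid_time_domain (dom x)"
        by (rule solution_time_domain[OF x(1)])
      have start: "infdist (fst (the (x (0, 0)))) K < d'" "norm (snd (the (x (0, 0)))) < d2 n"
        using infdist_fst_le[of "the (x (0, 0))"] norm_snd_le_infdist[of "the (x (0, 0))"] x(2) by auto
      have small: "norm (snd (the (x p))) < inverse (real (Suc n))" if "p \<in> dom x" for p
        using d2(2)[OF x(1) start(2) that] .
      have inv_le: "inverse (real (Suc n)) \<le> 1"
        by (simp add: inverse_eq_divide)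
      obtain T J where TJ: "(T, J) \<in> dom x" "e \<le> infdist (fst (the (x (T, J)))) K"
        and first: "\<And>t j. (t, j) \<in> dom x \<Longrightarrow> t \<le> T \<Longrightarrow> j \<le> J \<Longrightarrow> (t, j) \<noteq> (T, J) \<Longrightarrow> infdist (fst (the (x (t, j)))) K < e"
        using solution_first_hit[OF x(1) closed_superlevel out0] by (metis (mono_tags, lifting) mem_Collect_eq not_le)
      have "0 \<le> T"
        using hybrid_time_domain_nonneg[OF dom TJ(1)] .
      obtain S I where SI: "(S, I) \<in> dom x" "S \<le> T" "I \<le> J" "infdist (fst (the (x (S, I)))) K \<le> d'"
        and last: "\<And>t j. (t, j) \<in> dom x \<Longrightarrow> S \<le> t \<Longrightarrow> I \<le> j \<Longrightarrow> t \<le> T \<Longrightarrow> j \<le> J \<Longrightarrow> (t, j) \<noteq> (S, I) \<Longrightarrow>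
          d' < infdist (fst (the (x (t, j)))) K"
      proof (rule solution_last_visit[OF x(1) closed_sublevel[of d'] TJ(1) hybrid_time_domain_0[OF dom] \<open>0 \<le> T\<close>])
        show "the (x (0, 0)) \<in> {z. infdist (fst z) K \<le> d'}"
          using start(1) by simp
      qed (auto simp: not_le)
      have in_tube: "the (x (t, j)) \<in> tube" if "(t, j) \<in> dom x" "t \<le> T" "j \<le> J" "(t, j) \<noteq> (T, J)" for t j
        using first[OF that] small[OF that(1)] inv_le by (auto simp: tube_def)
      have "(T, J) \<noteq> (0, 0)"
        using TJ(2) start(1) d'(4) by (metis leD less_trans prod.inject)
      then have "the (x (T, J)) \<in> closure tube \<or> (\<exists>z\<in>tube \<inter> jump_set H. the (x (T, J)) \<in> jump_map H z)"
        using solution_value_after[OF x(1) TJ(1)] in_tube by blast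
      then have RT: "norm (the (x (T, J))) \<le> R"
        using R closure_closed[OF compact_imp_closed[OF \<open>compact tube\<close>]] by blast
      have Rx: "norm (the (x (t, j))) \<le> R" if "(t, j) \<in> dom x" "t \<le> T" "j \<le> J" for t j
        using R[of "the (x (t, j))"] in_tube[OF that] RT by (cases "(t, j) = (T, J)") auto
      let ?y = "shift_arc S I x"
      have y: "solution H ?y"
        by (rule solution_shift[OF x(1) SI(1)])
      have "window n ?y (T - S) (J - I)"
        unfolding window_def
      proof (intro conjI allI impI y)
        show "(T - S, J - I) \<in> dom ?y"
          using TJ(1) SI by (simp add: dom_shift_arc)
        show "infdist (fst (the (?y (0, 0)))) K \<le> d'"
          using SI(4) by (simp add: shift_arc_eq)
        show "e \<le> infdist (fst (the (?y (T - S, J - I)))) K"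
          using TJ(2) SI by (simp add: shift_arc_eq)
        fix t j assume tj: "(t, j) \<in> dom ?y" "t \<le> T - S" "j \<le> J - I"
        then have *: "0 \<le> t" "(S + t, I + j) \<in> dom x" "S + t \<le> T" "I + j \<le> J"
          using SI(3) by (auto simp: dom_shift_arc)
        show "norm (the (?y (t, j))) \<le> R"
          unfolding shift_arc_eq[OF *(1)] by (rule Rx[OF *(2,3,4)])
        show "norm (snd (the (?y (t, j)))) \<le> inverse (real (Suc n))"
          unfolding shift_arc_eq[OF *(1)] using small[OF *(2)] by simp
        assume "(t, j) \<noteq> (0, 0)"
        then show "d' < infdist (fst (the (?y (t, j)))) K"
          unfolding shift_arc_eq[OF *(1)] using * by (intro last) auto
      qed
      then show ?thesis by blast
    qed
    then obtain y T J where "\<And>n. window n (y n) (T n) (J n)"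
      by metis
    then have y: "\<And>n. solution H (y n)" and TJ: "\<And>n. (T n, J n) \<in> dom (y n)"
      and start: "\<And>n. infdist (fst (the (y n (0, 0)))) K \<le> d'"
      and exit: "\<And>n. e \<le> infdist (fst (the (y n (T n, J n)))) K"
      and near: "\<And>k. \<forall>n t j. (t, j) \<in> dom (y (k n)) \<longrightarrow> t \<le> T (k n) \<longrightarrow> j \<le> J (k n) \<longrightarrow>
        norm (the (y (k n) (t, j))) \<le> R \<and> norm (snd (the (y (k n) (t, j)))) \<le> inverse (real (Suc (k n)))"
      and away: "\<And>n t j. (t, j) \<in> dom (y n) \<Longrightarrow> t \<le> T n \<Longrightarrow> j \<le> J n \<Longrightarrow> (t, j) \<noteq> (0, 0) \<Longrightarrow>
        d' < infdist (fst (the (y n (t, j)))) K"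
      unfolding window_def by blast+
    have limit_start: "infdist (the (w (0, 0))) K \<le> d'"
      if "(\<lambda>n. fst (the (y (k n) (0, 0)))) \<longlonglongrightarrow> the (w (0, 0))" for w :: "'a arc" and k
      by (rule tendsto_upperbound[OF tendsto_infdist[OF that]]) (use start in auto)
    show False
    proof (cases "\<exists>N. \<forall>n\<ge>N. T n + real (J n) \<le> real N")
      case True
      then obtain N where N: "\<And>n. N \<le> n \<Longrightarrow> T n + real (J n) \<le> real N"
        by blast
      \<comment> \<open>The end values of the windows converge under a bound on the lengths that
        holds for every index, hence the dropped initial segment.\<close>
      let ?k = "\<lambda>n. n + N"
      have \<eta>: "(\<lambda>n. inverse (real (Suc (n + N)))) \<longlonglongrightarrow> 0"
        using LIMSEQ_ignore_initial_segment[OF LIMSEQ_inverse_real_of_nat, of N] .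
      obtain r w where w: "solution H1 w"
        and lim: "window_limit fst (\<lambda>n. y (?k n)) (\<lambda>n. T (?k n)) (\<lambda>n. J (?k n)) r w"
        using limit_solution_fst[where x = "\<lambda>n. y (?k n)" and T = "\<lambda>n. T (?k n)" and J = "\<lambda>n. J (?k n)",
              OF y TJ near[of ?k] \<eta>] by blast
      obtain t j where tj: "(t, j) \<in> dom w"
        "(\<lambda>n. fst (the (y (?k (r n)) (T (?k (r n)), J (?k (r n)))))) \<longlonglongrightarrow> the (w (t, j))"
        using window_limit_end[OF lim, of "real N"] N by auto
      have "e \<le> infdist (the (w (t, j))) K"
        by (rule tendsto_lowerbound[OF tendsto_infdist[OF tj(2)]]) (use exit in auto)
      moreover have "infdist (the (w (t, j))) K < e"
        using d1(2)[OF w _ tj(1)] limit_start[of "\<lambda>n. ?k (r n)" w] window_limit_start[OF lim] d'(2) by simp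
      ultimately show False by simp
    next
      case False
      then have "\<exists>n\<ge>N. real N < T n + real (J n)" for N
        by (meson not_le)
      \<comment> \<open>\<open>k\<close> need not be monotone: \<open>N \<le> k N\<close> already
        keeps the second components below \<open>inverse (real (Suc N))\<close>, and the lengths
        tend to infinity.\<close>
      then obtain k where k: "\<And>N. N \<le> k N" "\<And>N. real N < T (k N) + real (J (k N))"
        by metis
      have "inverse (real (Suc (k n))) \<le> inverse (real (Suc n))" for n
        using k(1)[of n] by (simp add: le_imp_inverse_le)
      then have near': "\<forall>n t j. (t, j) \<in> dom (y (k n)) \<longrightarrow> t \<le> T (k n) \<longrightarrow> j \<le> J (k n) \<longrightarrow>
        norm (the (y (k n) (t, j))) \<le> R \<and> norm (snd (the (y (k n) (t, j)))) \<le> inverse (real (Suc n))"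
        using near[of k] order_trans by blast
      obtain r w where w: "solution H1 w"
        and lim: "window_limit fst (\<lambda>n. y (k n)) (\<lambda>n. T (k n)) (\<lambda>n. J (k n)) r w"
        using limit_solution_fst[where x = "\<lambda>n. y (k n)" and T = "\<lambda>n. T (k n)" and J = "\<lambda>n. J (k n)",
              OF y TJ near' LIMSEQ_inverse_real_of_nat] by blast
      have "filterlim (\<lambda>n. T (k n) + real (J (k n))) at_top sequentially"
        by (rule filterlim_at_top_mono[OF filterlim_real_sequentially]) (intro always_eventually allI less_imp_le k(2))
      then have w_complete: "complete_arc w"
        by (rule window_limit_complete[OF lim])
      have "the (w (0, 0)) \<in> basin_of_attraction H1 K"
        using limit_start[of "\<lambda>n. k (r n)" w] window_limit_start[OF lim] d'(3) by (intro basin) simp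
      then have "converges_to_set w K"
        by (rule basin_of_attraction_solutions[OF w _ w_complete])
      then obtain N where N: "\<And>t j. (t, j) \<in> dom w \<Longrightarrow> N \<le> t + real j \<Longrightarrow> infdist (the (w (t, j))) K < d'"
        using d'(1) unfolding converges_to_set_iff by blast
      \<comment> \<open>The \<open>1\<close> excludes the initial time, the only one at which a
        window may be within \<open>d'\<close> of \<open>K\<close>: the times approximating
        \<open>(t, j)\<close> are eventually different from \<open>(0, 0)\<close>.\<close>
      obtain t j where tj: "(t, j) \<in> dom w" "max N 1 \<le> t + real j"
        using w_complete unfolding complete_arc_iff[OF solution_time_domain[OF w]] by blast
      obtain s where s: "s \<longlonglongrightarrow> t" "(\<lambda>n. fst (the (y (k (r n)) (s n, j)))) \<longlonglongrightarrow> the (w (t, j))"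
        "eventually (\<lambda>n. (s n, j) \<in> dom (y (k (r n))) \<and> s n \<le> T (k (r n)) \<and> j \<le> J (k (r n))) sequentially"
        by (rule window_limit_approx[OF lim tj(1)])
      have "eventually (\<lambda>n. (s n, j) \<noteq> (0, 0)) sequentially"
      proof (cases "j = 0")
        case True
        then have "0 < t" using tj(2) by simp
        then have "eventually (\<lambda>n. 0 < s n) sequentially"
          by (rule order_tendstoD(1)[OF s(1)])
        then show ?thesis
          by eventually_elim simp
      qed simp
      with s(3) have "eventually (\<lambda>n. d' \<le> infdist (fst (the (y (k (r n)) (s n, j)))) K) sequentially"
        by eventually_elim (use away less_imp_le in blast)
      then have "d' \<le> infdist (the (w (t, j))) K"
        by (intro tendsto_lowerbound[OF tendsto_infdist[OF s(2)]]) auto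
      then show False
        using N[OF tj(1)] tj(2) by simp
    qed
  qed
qed

lemma stable_cascade:
  assumes "stable H1 K" "\<And>p. infdist p K \<le> c \<Longrightarrow> p \<in> basin_of_attraction H1 K" "stable H2 {0}" "0 < c"
  shows "stable H \<Gamma>"
  unfolding stable_def
proof (intro allI impI)
  fix e :: real assume "0 < e"
  \<comment> \<open>Half of \<open>e\<close> goes to each component, as
    \<open>infdist_le_fst_snd\<close> adds their distances.\<close>
  then have e: "0 < e / 2" by simp
  obtain d where d: "0 < d"
    "\<And>x p. solution H x \<Longrightarrow> infdist (the (x (0, 0))) \<Gamma> < d \<Longrightarrow> p \<in> dom x \<Longrightarrow> infdist (fst (the (x p))) K < e / 2"
    using fst_stays_near[OF assms e] by blast
  obtain d' where d': "0 < d'"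
    "\<And>x p. solution H x \<Longrightarrow> norm (snd (the (x (0, 0)))) < d' \<Longrightarrow> p \<in> dom x \<Longrightarrow> norm (snd (the (x p))) < e / 2"
    using stable_snd[OF assms(3) e] by blast
  have "rge (solutions_from H (set_nbhd (min d d') \<Gamma>)) \<subseteq> set_nbhd e \<Gamma>"
  proof
    fix z assume "z \<in> rge (solutions_from H (set_nbhd (min d d') \<Gamma>))"
    then obtain x p0 p where x: "maximal_solution H x" "x (0, 0) = Some p0" "infdist p0 \<Gamma> < min d d'" "x p = Some z"
      by (auto simp: rge_def solutions_from_def set_nbhd_def ran_def)
    have sol: "solution H x"
      using x(1) by (simp add: maximal_solution_def)
    have p: "p \<in> dom x" "the (x p) = z"
      using x(4) by auto
    have "infdist (fst z) K < e / 2"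
      using d(2)[OF sol _ p(1)] x p by simp
    moreover have "norm (snd z) < e / 2"
      using d'(2)[OF sol _ p(1)] norm_snd_le_infdist[of p0] x p by simp
    ultimately show "z \<in> set_nbhd e \<Gamma>"
      using infdist_le_fst_snd[of z] by (simp add: set_nbhd_def)
  qed
  then show "\<exists>d>0. rge (solutions_from H (set_nbhd d \<Gamma>)) \<subseteq> set_nbhd e \<Gamma>"
    using d(1) d'(1) by (intro exI[of _ "min d d'"]) auto
qed

text \<open>The limit of the shifts of a bounded complete solution whose second component tends to \<open>0\<close>
  solves the first subsystem inside the basin, so the solution enters every neighbourhood
  of \<open>\<Gamma>\<close>; stability keeps it there.\<close>

lemma converges_cascade:
  assumes st: "stable H \<Gamma>" and x: "solution H x" "complete_arc x" "bounded (ran x)"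
    and snd_conv: "converges_to_set (map_option snd \<circ> x) {0}"
    and W: "closed W" "W \<subseteq> basin_of_attraction H1 K" and xW: "\<And>z. z \<in> ran x \<Longrightarrow> fst z \<in> W"
  shows "converges_to_set x \<Gamma>"
proof -
  have dom: "hybrid_time_domain (dom x)"
    by (rule solution_time_domain[OF x(1)])
  have late: "\<exists>t j. (t, j) \<in> dom x \<and> N \<le> t + real j" for N
    using x(2) unfolding complete_arc_iff[OF dom] by blast
  have ran: "the (x p) \<in> ran x" if "p \<in> dom x" for p
    using that by (auto intro: ranI)
  obtain R where R: "\<And>z. z \<in> ran x \<Longrightarrow> norm z \<le> R"
    using x(3) unfolding bounded_iff by blast
  have visits: "\<exists>p\<in>dom x. infdist (the (x p)) \<Gamma> < d" if d: "0 < d" for d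
  proof (rule ccontr)
    assume no: "\<not> (\<exists>p\<in>dom x. infdist (the (x p)) \<Gamma> < d)"
    \<comment> \<open>The tails start so late that their second components are uniformly small, as
      \<open>limit_solution_fst\<close> requires with
      \<open>\<eta> n = inverse (real (Suc n))\<close>.\<close>
    have "\<exists>S I. (S, I) \<in> dom x \<and> real n \<le> S + real I \<and>
        (\<forall>t j. (t, j) \<in> dom x \<longrightarrow> S \<le> t \<longrightarrow> I \<le> j \<longrightarrow> norm (snd (the (x (t, j)))) \<le> inverse (real (Suc n)))" for n
    proof -
      have "0 < inverse (real (Suc n))" by simp
      then obtain N where N: "\<And>t j. (t, j) \<in> dom (map_option snd \<circ> x) \<Longrightarrow> N \<le> t + real j \<Longrightarrow>
          infdist (the ((map_option snd \<circ> x) (t, j))) {0} < inverse (real (Suc n))"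
        using snd_conv unfolding converges_to_set_iff by blast
      obtain S I where SI: "(S, I) \<in> dom x" "max N (real n) \<le> S + real I"
        using late by blast
      have "norm (snd (the (x (t, j)))) \<le> inverse (real (Suc n))"
        if tj: "(t, j) \<in> dom x" "S \<le> t" "I \<le> j" for t j
      proof -
        have "(t, j) \<in> dom (map_option snd \<circ> x)" "the ((map_option snd \<circ> x) (t, j)) = snd (the (x (t, j)))"
          using tj(1) by auto
        then show ?thesis
          using N[of t j] tj SI(2) by (simp del: of_nat_Suc)
      qed
      then show ?thesis
        using SI by auto
    qed
    then obtain S I where SI: "\<And>n. (S n, I n) \<in> dom x"
      and small: "\<And>n t j. (t, j) \<in> dom x \<Longrightarrow> S n \<le> t \<Longrightarrow> I n \<le> j \<Longrightarrow>
        norm (snd (the (x (t, j)))) \<le> inverse (real (Suc n))"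
      by metis
    define y where "y n = shift_arc (S n) (I n) x" for n
    have y: "solution H (y n)" for n
      unfolding y_def by (rule solution_shift[OF x(1) SI])
    have y_dom: "0 \<le> t" "(S n + t, I n + j) \<in> dom x" "the (y n (t, j)) = the (x (S n + t, I n + j))"
      if "(t, j) \<in> dom (y n)" for n t j
      using that unfolding y_def dom_shift_arc by (auto simp: shift_arc_eq)
    have "\<exists>T J. (T, J) \<in> dom (y n) \<and> real n \<le> T + real J" for n
    proof -
      \<comment> \<open>A strictly larger sum orders both coordinates, so the difference from
        \<open>(S n, I n)\<close> is a point of the tail.\<close>
      obtain t j where tj: "(t, j) \<in> dom x" "S n + real (I n) + real (Suc n) \<le> t + real j"
        using late by blast
      then have "S n \<le> t" "I n \<le> j"
        using hybrid_time_domain_order_sum[OF dom SI tj(1)] by auto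
      then show ?thesis
        using tj by (intro exI[of _ "t - S n"] exI[of _ "j - I n"]) (auto simp: y_def dom_shift_arc of_nat_diff)
    qed
    then obtain T J where TJ: "\<And>n. (T n, J n) \<in> dom (y n)" "\<And>n. real n \<le> T n + real (J n)"
      by metis
    have ysmall: "norm (snd (the (y n (t, j)))) \<le> inverse (real (Suc n))" if "(t, j) \<in> dom (y n)" for n t j
      unfolding y_dom(3)[OF that] using y_dom(1,2)[OF that] by (intro small) auto
    then have near: "\<forall>n t j. (t, j) \<in> dom (y n) \<longrightarrow> t \<le> T n \<longrightarrow> j \<le> J n \<longrightarrow>
      norm (the (y n (t, j))) \<le> R \<and> norm (snd (the (y n (t, j)))) \<le> inverse (real (Suc n))"
      using y_dom R ran by simp
    obtain r w where w: "solution H1 w" and lim: "window_limit fst y T J r w"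
      using limit_solution_fst[where x = y and T = T and J = J, OF y TJ(1) near LIMSEQ_inverse_real_of_nat]
      by blast
    have "filterlim (\<lambda>n. T n + real (J n)) at_top sequentially"
      by (rule filterlim_at_top_mono[OF filterlim_real_sequentially]) (use TJ(2) in auto)
    then have w_complete: "complete_arc w"
      by (rule window_limit_complete[OF lim])
    \<comment> \<open>Closedness of \<open>W\<close> keeps the limit of the starting points in the
      basin, which itself need not be closed.\<close>
    have "the (w (0, 0)) \<in> W"
    proof (rule closed_sequentially[OF W(1) _ window_limit_start[OF lim]])
      fix n
      have "(0, 0) \<in> dom (y (r n))"
        by (rule solution_start_dom[OF y])
      from y_dom[OF this] show "fst (the (y (r n) (0, 0))) \<in> W"
        using xW ran by simp
    qed
    then have "converges_to_set w K"
      using basin_of_attraction_solutions[OF w _ w_complete] W(2) by blast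
    then obtain N where N: "\<And>t j. (t, j) \<in> dom w \<Longrightarrow> N \<le> t + real j \<Longrightarrow> infdist (the (w (t, j))) K < d / 2"
      using d unfolding converges_to_set_iff by (meson half_gt_zero)
    obtain t j where tj: "(t, j) \<in> dom w" "N \<le> t + real j"
      using w_complete unfolding complete_arc_iff[OF solution_time_domain[OF w]] by blast
    obtain s where s: "(\<lambda>n. fst (the (y (r n) (s n, j)))) \<longlonglongrightarrow> the (w (t, j))"
      "eventually (\<lambda>n. (s n, j) \<in> dom (y (r n)) \<and> s n \<le> T (r n) \<and> j \<le> J (r n)) sequentially"
      by (rule window_limit_approx[OF lim tj(1)])
    have "(\<lambda>n. inverse (real (Suc (r n)))) \<longlonglongrightarrow> 0"
      using LIMSEQ_subseq_LIMSEQ[OF LIMSEQ_inverse_real_of_nat window_limit_subseq[OF lim]] by (simp add: o_def)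
    then have lim: "(\<lambda>n. d - inverse (real (Suc (r n)))) \<longlonglongrightarrow> d - 0"
      by (intro tendsto_diff tendsto_const)
    \<comment> \<open>Distance at least \<open>d\<close> from \<open>\<Gamma>\<close> and a
      vanishing second component leave distance at least \<open>d\<close> from \<open>K\<close> in
      the limit, against the bound \<open>d / 2\<close>.\<close>
    have "d - 0 \<le> infdist (the (w (t, j))) K"
    proof (rule tendsto_le[OF _ tendsto_infdist[OF s(1)] lim])
      show "eventually (\<lambda>n. d - inverse (real (Suc (r n))) \<le> infdist (fst (the (y (r n) (s n, j)))) K) sequentially"
        using s(2)
      proof eventually_elim
        case (elim n)
        then have sn: "(s n, j) \<in> dom (y (r n))" by blast
        have "d \<le> infdist (the (y (r n) (s n, j))) \<Gamma>"
          using no y_dom[OF sn] by (auto simp: not_less)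
        then show ?case
          using infdist_le_fst_snd[of "the (y (r n) (s n, j))"] ysmall[OF sn] by linarith
      qed
    qed simp
    then show False
      using N[OF tj] d by simp
  qed
  show ?thesis
    unfolding converges_to_set_iff
  proof (intro allI impI)
    fix e :: real assume "0 < e"
    then obtain d where d: "0 < d"
      "\<And>x p. solution H x \<Longrightarrow> infdist (the (x (0, 0))) \<Gamma> < d \<Longrightarrow> p \<in> dom x \<Longrightarrow> infdist (the (x p)) \<Gamma> < e"
      using stable_solutions[OF st] by blast
    obtain S I where SI: "(S, I) \<in> dom x" "infdist (the (x (S, I))) \<Gamma> < d"
      using visits[OF d(1)] by auto
    \<comment> \<open>The \<open>1\<close> makes the later sum strictly larger, so that
      \<open>(t, j)\<close> follows \<open>(S, I)\<close> in both coordinates.\<close>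
    have "infdist (the (x (t, j))) \<Gamma> < e" if tj: "(t, j) \<in> dom x" "S + real I + 1 \<le> t + real j" for t j
    proof -
      have le: "S \<le> t" "I \<le> j"
        using hybrid_time_domain_order_sum[OF dom SI(1) tj(1)] tj(2) by auto
      have "infdist (the (shift_arc S I x (t - S, j - I))) \<Gamma> < e"
      proof (rule d(2)[OF solution_shift[OF x(1) SI(1)]])
        show "infdist (the (shift_arc S I x (0, 0))) \<Gamma> < d"
          using SI(2) by (simp add: shift_arc_eq)
        show "(t - S, j - I) \<in> dom (shift_arc S I x)"
          using tj(1) le by (simp add: dom_shift_arc)
      qed
      then show ?thesis
        using le by (simp add: shift_arc_eq)
    qed
    then show "\<exists>N. \<forall>t j. (t, j) \<in> dom x \<longrightarrow> N \<le> t + real j \<longrightarrow> infdist (the (x (t, j))) \<Gamma> < e"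
      by blast
  qed
qed

section \<open>Local and global attractivity of the cascade\<close>

lemma basin_contains_tube:
  assumes "attractive H1 K"
  obtains c where "0 < c" "\<And>p. infdist p K \<le> c \<Longrightarrow> p \<in> basin_of_attraction H1 K"
proof -
  \<comment> \<open>Compactness of \<open>K\<close> gives one radius that serves all its
    points.\<close>
  obtain c where c: "0 < c" "(\<Union>k\<in>K. cball k c) \<subseteq> interior (basin_of_attraction H1 K)"
    using compact_subset_open_imp_cball_epsilon_subset[OF K(1) open_interior, of "basin_of_attraction H1 K"] assms
    unfolding attractive_def by blast
  show thesis
  proof (rule that[OF c(1)])
    fix p assume p: "infdist p K \<le> c"
    obtain k where k: "k \<in> K" "infdist p K = dist p k"
      by (rule K_nearest)
    then have "p \<in> cball k c"
      using p by (simp add: dist_commute)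
    then show "p \<in> basin_of_attraction H1 K"
      using c(2) k(1) interior_subset by blast
  qed
qed

lemma snd_converges:
  assumes x: "solution H x" "complete_arc x" and start: "snd (the (x (0, 0))) \<in> basin_of_attraction H2 {0}"
  shows "converges_to_set (map_option snd \<circ> x) {0}"
proof (rule basin_of_attraction_solutions[OF solution_snd[OF x(1)]])
  have "(0, 0) \<in> dom x"
    by (rule solution_start_dom[OF x(1)])
  then show "the ((map_option snd \<circ> x) (0, 0)) \<in> basin_of_attraction H2 {0}"
    using start by auto
  have "dom (map_option snd \<circ> x) = dom x"
    by (auto simp: dom_def)
  then show "complete_arc (map_option snd \<circ> x)"
    using x(2) by (metis complete_arc_def)
qed

theorem asymptotically_stable_cascade:
  assumes as1: "asymptotically_stable H1 K" and as2: "asymptotically_stable H2 {0}"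
  shows "asymptotically_stable H \<Gamma>"
proof -
  obtain c where c: "0 < c" "\<And>p. infdist p K \<le> c \<Longrightarrow> p \<in> basin_of_attraction H1 K"
    using basin_contains_tube as1 unfolding asymptotically_stable_def by blast
  have st: "stable H \<Gamma>"
    using stable_cascade[OF _ c(2) _ c(1)] as1 as2 unfolding asymptotically_stable_def by blast
  \<comment> \<open>Stability of the cascade is used once more, with radius \<open>c\<close>: it
    confines solutions to a bounded tube whose first components lie in a closed part of the basin of
    \<open>K\<close>.\<close>
  obtain d where d: "0 < d"
    "\<And>x p. solution H x \<Longrightarrow> infdist (the (x (0, 0))) \<Gamma> < d \<Longrightarrow> p \<in> dom x \<Longrightarrow> infdist (the (x p)) \<Gamma> < c"
    using stable_solutions[OF st c(1)] by blast
  have "0 \<in> interior (basin_of_attraction H2 {0})"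
    using as2 unfolding asymptotically_stable_def attractive_def by blast
  then obtain b where b: "0 < b" "ball 0 b \<subseteq> basin_of_attraction H2 {0}"
    by (auto simp: mem_interior)
  have "set_nbhd (min d b) \<Gamma> \<subseteq> basin_of_attraction H \<Gamma>"
  proof
    fix p assume p: "p \<in> set_nbhd (min d b) \<Gamma>"
    show "p \<in> basin_of_attraction H \<Gamma>"
      unfolding basin_of_attraction_def
    proof (intro CollectI ballI)
      fix x assume "x \<in> solutions_from H {p}"
      then have x: "solution H x" "x (0, 0) = Some p"
        by (auto simp: solutions_from_def maximal_solution_def)
      have near: "infdist z \<Gamma> < c" if z: "z \<in> ran x" for z
      proof -
        obtain q where "x q = Some z"
          using z by (auto simp: ran_def)
        then show ?thesis
          using d(2)[OF x(1), of q] x(2) p by (auto simp: set_nbhd_def)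
      qed
      have fst_near: "infdist (fst z) K \<le> c" "norm (snd z) \<le> c" if "z \<in> ran x" for z
        using near[OF that] infdist_fst_le[of z] norm_snd_le_infdist[of z] by auto
      have bdd: "bounded (ran x)"
        by (rule bounded_subset[OF bounded_tube[of c c]]) (use fst_near in auto)
      have "converges_to_set x \<Gamma>" if comp: "complete_arc x"
      proof (rule converges_cascade[OF st x(1) comp bdd])
        have "norm (snd p) < b"
          using norm_snd_le_infdist[of p] p by (simp add: set_nbhd_def)
        then show "converges_to_set (map_option snd \<circ> x) {0}"
          using b(2) x(2) by (intro snd_converges[OF x(1) comp]) (auto simp: subset_eq)
        show "closed {z. infdist z K \<le> c}"
          by (intro closed_Collect_le continuous_intros)
      qed (use c(2) fst_near in auto)
      with bdd show "bounded_arc x \<and> (complete_arc x \<longrightarrow> converges_to_set x \<Gamma>)"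
        by (simp add: bounded_arc_def)
    qed
  qed
  moreover have "open (set_nbhd (min d b) \<Gamma>)"
    unfolding set_nbhd_def by (intro open_Collect_less continuous_intros)
  moreover have "\<Gamma> \<subseteq> set_nbhd (min d b) \<Gamma>"
    using d(1) b(1) by (auto simp: set_nbhd_def)
  ultimately have "\<Gamma> \<subseteq> interior (basin_of_attraction H \<Gamma>)"
    using interior_maximal by blast
  then show ?thesis
    using st by (simp add: asymptotically_stable_def attractive_def)
qed

theorem globally_asymptotically_stable_cascade:
  assumes gas1: "globally_asymptotically_stable H1 K" and gas2: "globally_asymptotically_stable H2 {0}"
    and bdd: "\<And>x. x \<in> solutions_from H UNIV \<Longrightarrow> bounded_arc x"
  shows "globally_asymptotically_stable H \<Gamma>"
proof -
  have B1: "basin_of_attraction H1 K = UNIV" and B2: "basin_of_attraction H2 {0} = UNIV"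
    using gas1 gas2 by (auto simp: globally_asymptotically_stable_def globally_attractive_def)
  \<comment> \<open>The basin is the whole space, so every positive radius is admissible;
    \<open>1\<close> is an arbitrary choice.\<close>
  have st: "stable H \<Gamma>"
    using stable_cascade[of 1] gas1 gas2 B1 by (simp add: globally_asymptotically_stable_def)
  have "p \<in> basin_of_attraction H \<Gamma>" for p
    unfolding basin_of_attraction_def
  proof (intro CollectI ballI)
    fix x assume x: "x \<in> solutions_from H {p}"
    then have "bounded_arc x"
      by (intro bdd) (auto simp: solutions_from_def)
    then have b: "bounded (ran x)"
      by (simp add: bounded_arc_def)
    have sol: "solution H x"
      using x by (auto simp: solutions_from_def maximal_solution_def)
    have "converges_to_set x \<Gamma>" if comp: "complete_arc x"
      by (rule converges_cascade[OF st sol comp b snd_converges[OF sol comp] closed_UNIV]) (simp_all add: B1 B2)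
    with b show "bounded_arc x \<and> (complete_arc x \<longrightarrow> converges_to_set x \<Gamma>)"
      by (simp add: bounded_arc_def)
  qed
  then show ?thesis
    using st by (auto simp: globally_asymptotically_stable_def globally_attractive_def)
qed

end

text \<open>The case of an empty \<open>\<Gamma>hat1\<close> rests on the convention \<open>infdist x {} = 0\<close>.\<close>

lemma stable_empty: "stable H {}"
  unfolding stable_def set_nbhd_def by (auto simp: infdist_def intro: exI[of _ 1])

lemma converges_to_empty: "converges_to_set x {}"
  unfolding converges_to_set_iff by (simp add: infdist_def)

theorem mainTheorem5:
  fixes C1 D1 :: "(real ^ 'n1) set" and C2 D2 :: "(real ^ 'n2) set"
    and F1 G1 :: "real ^ 'n1 \<Rightarrow> real ^ 'n2 \<Rightarrow> (real ^ 'n1) set"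
    and F2 G2 :: "real ^ 'n2 \<Rightarrow> (real ^ 'n2) set"
    and F G :: "(real ^ 'n1) \<times> (real ^ 'n2) \<Rightarrow> ((real ^ 'n1) \<times> (real ^ 'n2)) set"
    and Fhat1 Ghat1 :: "real ^ 'n1 \<Rightarrow> (real ^ 'n1) set"
    and H :: "((real ^ 'n1) \<times> (real ^ 'n2)) hybrid_system"
    and H1 :: "(real ^ 'n1) hybrid_system"
    and H2 :: "(real ^ 'n2) hybrid_system"
    and \<Gamma>hat1 :: "(real ^ 'n1) set"
    and \<Gamma>1 :: "((real ^ 'n1) \<times> (real ^ 'n2)) set"
  assumes "closed C1" "closed D1" "closed C2" "closed D2"
    and "\<And>x1 x2. F (x1, x2) = F1 x1 x2 \<times> F2 x2"
    and "\<And>x1 x2. G (x1, x2) = G1 x1 x2 \<times> G2 x2"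
    and "\<And>x1. Fhat1 x1 = F1 x1 0"
    and "\<And>x1. Ghat1 x1 = G1 x1 0"
    and "H = \<lparr>flow_set = C1 \<times> C2, flow_map = F, jump_set = D1 \<times> D2, jump_map = G\<rparr>"
    and "H1 = \<lparr>flow_set = C1, flow_map = Fhat1, jump_set = D1, jump_map = Ghat1\<rparr>"
    and "H2 = \<lparr>flow_set = C2, flow_map = F2, jump_set = D2, jump_map = G2\<rparr>"
    and "basic_assumptions H" "basic_assumptions H1" "basic_assumptions H2"
    and "compact \<Gamma>hat1"
    and "\<Gamma>1 = {(x1, x2). x1 \<in> \<Gamma>hat1 \<and> x2 = 0}"
    and "0 \<in> C2 \<union> D2"
  shows "(asymptotically_stable H1 \<Gamma>hat1 \<and> asymptotically_stable H2 {0}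
            \<longrightarrow> asymptotically_stable H \<Gamma>1) \<and>
         (globally_asymptotically_stable H1 \<Gamma>hat1 \<and> globally_asymptotically_stable H2 {0} \<and>
            (\<forall>x\<in>solutions_from H UNIV. bounded_arc x)
            \<longrightarrow> globally_asymptotically_stable H \<Gamma>1)"
proof (cases "\<Gamma>hat1 = {}")
  case True
  then have [simp]: "\<Gamma>1 = {}"
    using assms(16) by simp
  \<comment> \<open>Every point has \<open>infdist\<close> equal to \<open>0\<close> from the empty
    set, so convergence is automatic and only boundedness remains. In the local claim, attractivity
    is the inclusion of the empty set in an interior.\<close>
  have "p \<in> basin_of_attraction H {}" if "\<forall>x\<in>solutions_from H UNIV. bounded_arc x" for p
    unfolding basin_of_attraction_def
    using that converges_to_empty by (auto simp: solutions_from_def)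
  then show ?thesis
    by (auto simp: asymptotically_stable_def globally_asymptotically_stable_def attractive_def
        globally_attractive_def stable_empty)
next
  case False
  have F: "F z = F1 (fst z) (snd z) \<times> F2 (snd z)" and G: "G z = G1 (fst z) (snd z) \<times> G2 (snd z)" for z
    using assms(5,6)[of "fst z" "snd z"] by simp_all
  interpret cascade H H1 H2 \<Gamma>hat1
    by unfold_locales (use assms(12,15) False in \<open>auto simp: assms(7-11) F G\<close>)
  have "\<Gamma>1 = \<Gamma>hat1 \<times> {0}"
    using assms(16) by auto
  then show ?thesis
    using asymptotically_stable_cascade globally_asymptotically_stable_cascade by blast
qed

end
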